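(* In the setting of the context (graph assumptions (G1)-(G2), loss assumptions (L1)-(L2), sampling condition (S), and the distributed zeroth-order CVaR iteration), let $x^\ast\in\arg\min_{x\in\mathcal X}\mathcal C(x)$. Then for every $T\ge 1$, $$\mathbb E\big[\mathcal C(\hat x_T)-\mathcal C(x^\ast)\big]\le \frac{D_x^2}{2\sum_{k=0}^{T-1}\eta_k}+G_{\max}^2\,\frac{\sum_{k=0}^{T-1}\eta_k^2}{2\sum_{k=0}^{T-1}\eta_k}+\frac{L_{\max}}{m}\,\frac{\sum_{k=0}^{T-1}\eta_k\,\mathbb E\big[\sum_{j=1}^m\|\bar x_k-x_k^j\|\big]}{\sum_{k=0}^{T-1}\eta_k}+D_2,$$ where $\bar x_k=\frac1m\sum_{i=1}^m x_k^i$, $\hat x_T=\frac{\sum_{k=0}^{T-1}\eta_k\bar x_k}{\sum_{k=0}^{T-1}\eta_k}$, $L_{\max}=\max_i L_i$, $G_{\max}=\max_i \frac{dU_i}{\delta_i}$, and $$D_1=2L_{\max}\delta_{\max}+\sqrt{2\pi}\,d\,D_x\Big\{\max_{i}\frac{U_i}{\alpha_i\delta_i}\Big\}e_s,\qquad D_2=D_1+\frac{D_x\delta_{\max}L_{\max}}{r}.$$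
   Context: Problem. Let $m,d\ge1$ be integers, $\mathcal V=[m]=\{1,\dots,m\}$, $\|\cdot\|$ the Euclidean norm on $\mathbb R^d$, $\mathbb B$ the closed unit ball and $\mathbb S^{d-1}$ the unit sphere. $\mathcal X\subset\mathbb R^d$ is nonempty, compact and convex with diameter $D_x=\sup_{x,y\in\mathcal X}\|x-y\|$, and $r\mathbb B\subseteq\mathcal X$ for some $r>0$. For each agent $i\in[m]$: $P_i$ is a probability distribution on $\Xi_i$, $J^i:\mathcal X\times\Xi_i\to\mathbb R$ is a loss ($J^i(x,\xi^i)$ is a real random variable for $\xi^i\sim P_i$), $\alpha_i\in(0,1)$ is a risk level, and, with $(z)_+=\max\{z,0\}$, $$C^i(x)=\min_{\tau\in\mathbb R}\Big\{\tau+\tfrac1{\alpha_i}\mathbb E_{\xi^i\sim P_i}\big[(J^i(x,\xi^i)-\tau)_+\big]\Big\},\qquad \mathcal C(x)=\frac1m\sum_{i=1}^mC^i(x).$$ Loss assumptions. (L1) For every $i$ and $\xi^i\in\Xi_i$, $J^i(\cdot,\xi^i)$ is $L_i$-Lipschitz on $\mathcal X$, and $|J^i(x,\xi^i)|\le U_i$ for all $(x,\xi^i)$, with $U_i>0$. (L2) For every $i$ and $\xi^i\in\Xi_i$, $J^i(\cdot,\xi^i)$ is convex on $\mathcal X$. Graph assumptions. $\mathcal G_k=(\mathcal V,\mathcal E_k)$, $k\ge0$, is a deterministic sequence of undirected graphs; $\mathcal N_k^i$ consists of $i$ and its neighbors in $\mathcal G_k$. (G1) There is an integer $q\ge1$ such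 that $(\mathcal V,\bigcup_{l=1}^q\mathcal E_{k+l})$ is connected for all $k$. (G2) For every $k\ge0$ the weight matrix $W_k=[w_k^{ij}]$ is doubly stochastic, $w_k^{ij}=0$ whenever $j\notin\mathcal N_k^i$, $w_k^{ii}>0$ for all $i$, and there is $\varrho>0$ (independent of $k$) with $w_k^{ij}\ge\varrho$ for all $i\in\mathcal V$, $j\in\mathcal N_k^i$. Algorithm. Smoothing radii $\delta_i>0$, $\delta_{\max}=\max_i\delta_i<r$; $\mathcal X_\delta=\{x: x/(1-\delta_{\max}/r)\in\mathcal X\}$; $\mathcal P_{\mathcal X_\delta}$ is Euclidean projection onto $\mathcal X_\delta$; step sizes $\eta_k>0$; sample sizes $s_k^i\ge1$ (integers); initial points $x_0^i\in\mathcal X_\delta$. For $k\ge0$ and $i\in[m]$: $y_k^i=\sum_{j\in\mathcal N_k^i}w_k^{ij}x_k^j$; $\hat y_k^i=y_k^i+\delta_iu_k^i$ with $u_k^i\sim\mathrm{Unif}(\mathbb S^{d-1})$ (this lies in $\mathcal X$); $\widehat C_k^i(\hat y_k^i)=\min_{\tau\in\mathbb R}\{\tau+\frac1{\alpha_is_k^i}\sum_{j=1}^{s_k^i}(J^i(\hat y_k^i,\xi_k^{i,j})-\tau)_+\}$; $\hat g_k^i=\frac d{\delta_i}\widehat C_k^i(\hat y_k^i)u_k^i$; $x_{k+1}^i=\mathcal P_{\mathcal X_\delta}[y_k^i-\eta_k\hat g_k^i]$. Randomness. For each $i$ the samples $\{\xi_k^{i,j}\}_{k,j}$ are i.i.d.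 from $P_i$ and independent of the perturbation directions and past iterates. Let $\mathcal F_k$ be the sigma-algebra generated by $\{x_0^i,u_t^i,\xi_t^{i,j}: i\in[m],\,1\le j\le s_t^i,\,0\le t\le k-1\}$. Conditional on $\mathcal F_k$, the $u_k^1,\dots,u_k^m$ are independent and uniform on $\mathbb S^{d-1}$, and for every $i$ the batch $(\xi_k^{i,j})_j$ is independent of $\mathcal F_k\vee\sigma(u_k^1,\dots,u_k^m)$. Sampling condition (S). For a given $e_s>0$, $\sum_{i=1}^m\frac1{m\sqrt{s_k^i}}\le e_s$ for all $k$. *)

theory Defs
  imports "HOL-Probability.Probability"
begin

(* The normalized surface measure of the unit sphere, as the radial projection of the uniform
   distribution on the unit ball (the cone measure): sgn x = x / norm x, and the centre, where
   sgn is 0, is a null set.  The three lemmas below check that it is a rotation-invariant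
   probability measure carried by the sphere, which determines it. *)
definition unif_sphere :: "(real ^ 'd) measure" where
  "unif_sphere = distr (uniform_measure lborel (ball 0 1)) borel sgn"

lemma sets_unif_sphere [simp, measurable_cong]: "sets unif_sphere = sets borel"
  and space_unif_sphere [simp]: "space unif_sphere = UNIV"
  by (simp_all add: unif_sphere_def)

lemma sgn_borel_vec [measurable]: "(sgn :: real ^ 'd \<Rightarrow> real ^ 'd) \<in> borel_measurable borel"
  unfolding sgn_div_norm by measurable

lemma prob_space_unif_ball: "prob_space (uniform_measure lborel (ball (0 :: real ^ 'd) 1))"
  by (rule prob_space_uniform_measure)
    (use emeasure_lborel_ball_finite[of "0 :: real ^ 'd" 1] in
      \<open>auto simp: emeasure_ball ennreal_eq_0_iff not_le\<close>)

lemma prob_space_unif_sphere: "prob_space unif_sphere"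
  unfolding unif_sphere_def
  by (rule prob_space.prob_space_distr[OF prob_space_unif_ball]) simp

lemma AE_unif_sphere: "AE v in (unif_sphere :: (real ^ 'd) measure). v \<in> sphere 0 1"
proof -
  have "AE x in lborel. x \<noteq> (0 :: real ^ 'd)"
    by (rule AE_lborel_singleton)
  then have "AE x in uniform_measure lborel (ball (0 :: real ^ 'd) 1). sgn x \<in> sphere 0 1"
    by (intro AE_uniform_measureI) (auto elim!: AE_mp simp: norm_sgn)
  then show ?thesis
    unfolding unif_sphere_def by (subst AE_distr_iff) (auto simp: norm_sgn)
qed

(* The wellorder sort is inherited from measure_orthogonal_image. *)
lemma unif_sphere_rotation:
  fixes f :: "real ^ 'd::{finite,wellorder} \<Rightarrow> real ^ 'd::{finite,wellorder}"
  assumes f: "orthogonal_transformation f"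
  shows "distr unif_sphere borel f = unif_sphere"
proof (rule measure_eqI)
  have lin: "linear f" and nf: "\<And>x. norm (f x) = norm x"
    using f by (auto simp: orthogonal_transformation)
  have fm [measurable]: "f \<in> borel_measurable borel"
    by (intro borel_measurable_continuous_onI linear_continuous_on linear_linear[THEN iffD2] lin)
  have sf: "sgn (f x) = f (sgn x)" for x
    by (simp add: sgn_div_norm nf linear_scale[OF lin])
  have bij: "bij f" using f by (rule orthogonal_transformation_bij)
  fix A assume "A \<in> sets (distr unif_sphere borel f)"
  then have A [measurable]: "A \<in> sets borel" by simp
  let ?B = "ball (0 :: real ^ 'd::{finite,wellorder}) 1"
  let ?S = "?B \<inter> sgn -` A"
  let ?S' = "?B \<inter> (\<lambda>x. f (sgn x)) -` A"
  have m: "?S \<in> sets borel" "?S' \<in> sets borel"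
    using measurable_sets_borel[OF sgn_borel_vec A]
      measurable_sets_borel[OF measurable_compose[OF sgn_borel_vec fm] A] by auto
  have lm: "T \<inter> ?B \<in> lmeasurable" if "T \<in> sets borel" for T
    using that by (intro bounded_set_imp_lmeasurable) auto
  have "inv f ` ?S = ?S'"
  proof -
    have "inv f ` ?S = f -` ?S"
      by (rule bij_vimage_eq_inv_image[OF bij, symmetric])
    also have "\<dots> = ?S'" by (auto simp: sf nf)
    finally show ?thesis .
  qed
  then have "measure lebesgue ?S' = measure lebesgue ?S"
    using measure_orthogonal_image[OF orthogonal_transformation_inv[OF f] , of ?S]
      lm[OF m(1)] by (simp add: Int_absorb2 Int_commute Int_left_commute)
  moreover have "emeasure lborel T = ennreal (measure lebesgue T)" if "T \<subseteq> ?B" "T \<in> sets borel" for T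
    using lm[OF that(2)] that by (simp add: Int_absorb2 fmeasurable_def emeasure_eq_ennreal_measure)
  ultimately have "emeasure lborel ?S' = emeasure lborel ?S"
    using m by simp
  moreover have "emeasure unif_sphere T = emeasure lborel (?B \<inter> sgn -` T) / emeasure lborel ?B"
    if "T \<in> sets borel" for T
    using that measurable_sets_borel[OF sgn_borel_vec that]
    by (simp add: unif_sphere_def emeasure_distr)
  ultimately have "emeasure unif_sphere (f -` A) = emeasure unif_sphere A"
    using A measurable_sets_borel[OF fm A] by (simp add: vimage_def)
  then show "emeasure (distr unif_sphere borel f) A = emeasure unif_sphere A"
    by (simp add: emeasure_distr)
qed simp

(* The minima over tau are written as infima; cvar_attained and emp_cvar_attained show that
   they are attained. *)
definition cvar :: "'b measure \<Rightarrow> real \<Rightarrow> ('b \<Rightarrow> real) \<Rightarrow> real" where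
  "cvar P \<alpha> Z = (INF \<tau>. \<tau> + 1 / \<alpha> * (\<integral>\<xi>. max (Z \<xi> - \<tau>) 0 \<partial>P))"

definition emp_cvar :: "real \<Rightarrow> nat \<Rightarrow> (nat \<Rightarrow> real) \<Rightarrow> real" where
  "emp_cvar \<alpha> s z = (INF \<tau>. \<tau> + 1 / (\<alpha> * real s) * (\<Sum>j=1..s. max (z j - \<tau>) 0))"

lemma INF_attained:
  fixes g :: "real \<Rightarrow> real"
  assumes "continuous_on UNIV g" "0 \<le> U"
    and "\<And>\<tau>. \<tau> \<le> - U \<Longrightarrow> g (- U) \<le> g \<tau>" "\<And>\<tau>. U \<le> \<tau> \<Longrightarrow> g U \<le> g \<tau>"
  shows "\<exists>\<tau>. (INF \<tau>. g \<tau>) = g \<tau> \<and> (\<forall>\<tau>'. g \<tau> \<le> g \<tau>')"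
proof -
  have "\<exists>t\<in>{-U..U}. \<forall>s\<in>{-U..U}. g t \<le> g s"
    using assms by (intro continuous_attains_inf) (auto intro: continuous_on_subset)
  then obtain t where t: "\<And>s. s \<in> {-U..U} \<Longrightarrow> g t \<le> g s" by blast
  have "g t \<le> g s" for s
  proof -
    consider "s \<le> - U" | "s \<in> {-U..U}" | "U \<le> s" by force
    then show ?thesis
      using t[of s] t[of U] t[of "- U"] assms(2) assms(3,4)[of s] by cases auto
  qed
  moreover from this have "(INF \<tau>. g \<tau>) = g t"
    by (intro cInf_eq_minimum) auto
  ultimately show ?thesis by blast
qed

lemma cvar_attained:
  assumes P: "prob_space P" and Z: "Z \<in> borel_measurable P"
    and bd: "\<And>\<xi>. \<xi> \<in> space P \<Longrightarrow> \<bar>Z \<xi>\<bar> \<le> U" and \<alpha>: "0 < \<alpha>" "\<alpha> < 1"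
  defines "g \<equiv> \<lambda>\<tau>. \<tau> + 1 / \<alpha> * (\<integral>\<xi>. max (Z \<xi> - \<tau>) 0 \<partial>P)"
  shows "\<exists>\<tau>. cvar P \<alpha> Z = g \<tau> \<and> (\<forall>\<tau>'. g \<tau> \<le> g \<tau>')"
proof -
  interpret prob_space P by (rule P)
  have U: "0 \<le> U" using bd not_empty by fastforce
  have int: "integrable P (\<lambda>\<xi>. max (Z \<xi> - \<tau>) 0)" for \<tau>
    by (rule integrable_const_bound[of _ "U + \<bar>\<tau>\<bar>"])
      (use Z bd U in \<open>fastforce intro!: AE_I2, measurable\<close>)
  have intZ: "integrable P Z"
    by (rule integrable_const_bound[of _ U]) (use Z bd in auto)
  have "1-lipschitz_on UNIV (\<lambda>\<tau>. \<integral>\<xi>. max (Z \<xi> - \<tau>) 0 \<partial>P)"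
  proof (rule lipschitz_onI)
    fix a b :: real
    have "\<bar>(\<integral>\<xi>. max (Z \<xi> - a) 0 - max (Z \<xi> - b) 0 \<partial>P)\<bar>
        \<le> (\<integral>\<xi>. \<bar>max (Z \<xi> - a) 0 - max (Z \<xi> - b) 0\<bar> \<partial>P)"
      by (rule integral_abs_bound)
    also have "\<dots> \<le> (\<integral>\<xi>. \<bar>a - b\<bar> \<partial>P)"
      by (rule integral_mono) (use int in auto)
    finally show "dist (\<integral>\<xi>. max (Z \<xi> - a) 0 \<partial>P) (\<integral>\<xi>. max (Z \<xi> - b) 0 \<partial>P) \<le> 1 * dist a b"
      using int by (simp add: dist_real_def prob_space)
  qed simp
  then have "continuous_on UNIV g"
    unfolding g_def by (intro continuous_intros lipschitz_on_continuous_on)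
  moreover have "g (- U) \<le> g \<tau>" if "\<tau> \<le> - U" for \<tau>
  proof -
    have eq: "(\<integral>\<xi>. max (Z \<xi> - t) 0 \<partial>P) = (\<integral>\<xi>. Z \<xi> \<partial>P) - t" if "t \<le> - U" for t
    proof -
      have "(\<integral>\<xi>. max (Z \<xi> - t) 0 \<partial>P) = (\<integral>\<xi>. Z \<xi> - t \<partial>P)"
        using bd that by (intro Bochner_Integration.integral_cong) force+
      then show ?thesis using intZ by (simp add: prob_space)
    qed
    have "0 \<le> (1 / \<alpha> - 1) * (- U - \<tau>)"
      using \<alpha> that by (intro mult_nonneg_nonneg) auto
    then show ?thesis
      unfolding g_def eq[OF that] eq[OF order.refl] by (simp add: algebra_simps)
  qed
  moreover have "g U \<le> g \<tau>" if "U \<le> \<tau>" for \<tau>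
  proof -
    have "(\<integral>\<xi>. max (Z \<xi> - t) 0 \<partial>P) = (\<integral>\<xi>. 0 \<partial>P)" if "U \<le> t" for t
      using bd that by (intro Bochner_Integration.integral_cong) force+
    then show ?thesis using that by (simp add: g_def)
  qed
  ultimately show ?thesis
    using INF_attained[of g U] U by (simp add: cvar_def g_def)
qed

lemma emp_cvar_attained:
  fixes z :: "nat \<Rightarrow> real"
  assumes \<alpha>: "0 < \<alpha>" "\<alpha> < 1" and s: "1 \<le> s"
  defines "g \<equiv> \<lambda>\<tau>. \<tau> + 1 / (\<alpha> * real s) * (\<Sum>j=1..s. max (z j - \<tau>) 0)"
  shows "\<exists>\<tau>. emp_cvar \<alpha> s z = g \<tau> \<and> (\<forall>\<tau>'. g \<tau> \<le> g \<tau>')"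
proof -
  define U where "U = (MAX j\<in>{1..s}. \<bar>z j\<bar>)"
  have bd: "\<bar>z j\<bar> \<le> U" if "j \<in> {1..s}" for j
    unfolding U_def using that by (intro Max_ge) auto
  have U: "0 \<le> U" using bd[of 1] s by simp
  have "continuous_on UNIV g"
    unfolding g_def by (intro continuous_intros)
  moreover have "g (- U) \<le> g \<tau>" if "\<tau> \<le> - U" for \<tau>
  proof -
    have eq: "(\<Sum>j=1..s. max (z j - t) 0) = (\<Sum>j=1..s. z j) - real s * t" if "t \<le> - U" for t :: real
    proof -
      have "(\<Sum>j=1..s. max (z j - t) 0) = (\<Sum>j=1..s. z j - t)"
        using bd that by (intro sum.cong) force+
      then show ?thesis by (simp add: sum_subtractf)
    qed
    have "0 \<le> (1 / \<alpha> - 1) * (- U - \<tau>)"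
      using \<alpha> that by (intro mult_nonneg_nonneg) auto
    then show ?thesis
      unfolding g_def eq[OF that] eq[OF order.refl] using s \<alpha>
      by (simp add: diff_divide_distrib add_divide_distrib) (simp add: algebra_simps)
  qed
  moreover have "g U \<le> g \<tau>" if "U \<le> \<tau>" for \<tau>
  proof -
    have "(\<Sum>j=1..s. max (z j - t) 0) = 0" if "U \<le> t" for t
      using bd that by (intro sum.neutral ballI) (force dest: bd)
    then show ?thesis using that by (simp add: g_def)
  qed
  ultimately show ?thesis
    using INF_attained[of g U] U by (simp add: emp_cvar_def g_def)
qed

(* Graphs on {1..m} are symmetric relations; the neighbourhood of i includes i. *)
definition nbhd :: "(nat \<times> nat) set \<Rightarrow> nat \<Rightarrow> nat set" where
  "nbhd E i = insert i (E `` {i})"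

definition connected_graph :: "nat set \<Rightarrow> (nat \<times> nat) set \<Rightarrow> bool" where
  "connected_graph V E \<longleftrightarrow> (\<forall>i\<in>V. \<forall>j\<in>V. (i, j) \<in> E\<^sup>*)"

definition doubly_stochastic :: "nat \<Rightarrow> (nat \<Rightarrow> nat \<Rightarrow> real) \<Rightarrow> bool" where
  "doubly_stochastic m W \<longleftrightarrow>
     (\<forall>i\<in>{1..m}. \<forall>j\<in>{1..m}. 0 \<le> W i j) \<and>
     (\<forall>i\<in>{1..m}. (\<Sum>j=1..m. W i j) = 1) \<and>
     (\<forall>j\<in>{1..m}. (\<Sum>i=1..m. W i j) = 1)"

(* Preimages under X of the measurable sets of N: a generator of the sigma-algebra of X. *)
definition preimages :: "'o measure \<Rightarrow> 'c measure \<Rightarrow> ('o \<Rightarrow> 'c) \<Rightarrow> 'o set set" where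
  "preimages M N X = {X -` A \<inter> space M | A. A \<in> sets N}"

(* The sigma-algebra generated by the initial points and by all directions and samples of the
   rounds before k, as a measure space so that it can be conditioned on. *)
definition history ::
  "'o measure \<Rightarrow> nat \<Rightarrow> (nat \<Rightarrow> 'b measure) \<Rightarrow> (nat \<Rightarrow> nat \<Rightarrow> nat) \<Rightarrow> (nat \<Rightarrow> 'o \<Rightarrow> real ^ 'd) \<Rightarrow>
   (nat \<Rightarrow> nat \<Rightarrow> 'o \<Rightarrow> real ^ 'd) \<Rightarrow> (nat \<Rightarrow> nat \<Rightarrow> nat \<Rightarrow> 'o \<Rightarrow> 'b) \<Rightarrow> nat \<Rightarrow> 'o measure" where
  "history M m P s x0 u \<xi> k = sigma (space M)
     ((\<Union>i\<in>{1..m}. preimages M borel (x0 i)) \<union>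
      (\<Union>t\<in>{..<k}. \<Union>i\<in>{1..m}. preimages M borel (u t i)) \<union>
      (\<Union>t\<in>{..<k}. \<Union>i\<in>{1..m}. \<Union>j\<in>{1..s t i}. preimages M (P i) (\<xi> t i j)))"

end

(*
For a convex Lipschitz function f, the mean of d/delta * f(y + delta v) * (v . w) over the unit
sphere is the derivative at y in direction w of the average of f over a ball of radius delta. Only
a lower bound for it is needed. Averaging against a radial cutoff that is linear across the shell
1 - e <= |x| <= 1, translation invariance moves the difference quotient from f to the cutoff, whose
gradient is the normal on the shell. As e tends to 0, scaling turns the shell integral into the
sphere integral, so no divergence theorem is needed.

The error of the empirical CVaR is at most 1/alpha times the integral over [-U, U] of
|F_emp(t) - F(t)|, and the variance of an empirical frequency is at most 1/(4 s). This gives a mean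
error of at most U / (alpha sqrt s), better than the constant sqrt(2 pi) asked for.

Given the past, the direction and the batch of a round are independent, so ghat is a subgradient in
the mean up to these two errors. The usual descent estimate for projected subgradient steps,
compared with the point (1 - delta_max / r) xstar of the shrunken set, is then telescoped; the
doubly stochastic averaging decreases both sum |x_i - z|^2 and sum |xbar - x_i| by convexity.
*)
theory Submission
  imports Defs
begin

subsection \<open>Smoothing over the unit sphere\<close>

text \<open>The CVaR functions need not be differentiable, and their convexity and Lipschitz
  continuity are available on \<open>X\<close> only. What replaces a gradient is a lower bound on
  difference quotients, passed through an integral in which only the cutoff is differentiated; the
  steps are restricted to (0, 1] so that the quotients never look outside \<open>X\<close>. The
  losses are measurable in the sample for each fixed decision, with no joint measurability assumed.
  Every evaluation at a random decision therefore goes through the Lipschitz property and a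
  countable dense set, just as minima over tau go through the rationals. Conditioning is turned into
  product laws, one for (y, u) and one for (batch, (y, u)), so that Fubini can freeze the outer
  variable. The batch must be independent of the pair and not merely of the direction, because the
  query point y + delta u depends on both. In the final constant, 2 Lmax delta_max pays for
  replacing the two perturbed points of the convexity inequality by their centres, and D_x delta_max
  Lmax / r pays for comparing with a shrunken minimizer.\<close>

lemma integral_unif_sphere:
  fixes h :: "real ^ 'd \<Rightarrow> real"
  assumes h: "h \<in> borel_measurable borel"
  shows "(\<integral>v. h v \<partial>unif_sphere) =
    (\<integral>x. indicator (ball 0 1) x * h (sgn x) \<partial>lborel) / measure lborel (ball (0 :: real ^ 'd) 1)"
proof -
  let ?B = "ball (0 :: real ^ 'd) 1"
  have V: "emeasure lborel ?B = ennreal (measure lborel ?B)" "0 < measure lborel ?B"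
    using emeasure_lborel_ball_finite[of "0 :: real ^ 'd" 1]
    by (auto simp: emeasure_eq_ennreal_measure content_ball_pos)
  note [measurable] = h
  have hs: "(\<lambda>x. h (sgn x)) \<in> borel_measurable borel" by measurable
  have "(\<integral>v. h v \<partial>unif_sphere) = (\<integral>x. h (sgn x) \<partial>uniform_measure lborel ?B)"
    unfolding unif_sphere_def by (rule integral_distr) measurable
  also have "uniform_measure lborel ?B
      = density lborel (\<lambda>x. ennreal (indicator ?B x / measure lborel ?B))"
    unfolding uniform_measure_def
    by (intro density_cong)
      (auto simp: V divide_ennreal indicator_def simp flip: ennreal_1)
  also have "(\<integral>x. h (sgn x) \<partial>\<dots>) = (\<integral>x. indicator ?B x / measure lborel ?B * h (sgn x) \<partial>lborel)"
    by (subst integral_density) (auto intro!: borel_measurable_times borel_measurable_divide borel_measurable_indicator hs)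
  finally show ?thesis by simp
qed

lemma integral_ball_sgn:
  fixes h :: "real ^ 'd \<Rightarrow> real"
  assumes h: "h \<in> borel_measurable borel" and c: "0 < c"
  shows "(\<integral>x. indicator (ball 0 c) x * h (sgn x) \<partial>lborel) =
    c ^ CARD('d) * (\<integral>x. indicator (ball 0 1) x * h (sgn x) \<partial>lborel)"
proof -
  note [measurable] = h
  have hs: "(\<lambda>x. h (sgn x)) \<in> borel_measurable borel" by measurable
  have "(\<integral>x. indicator (ball 0 c) x * h (sgn x) \<partial>lborel) =
      (\<integral>x. indicator (ball 0 c) x * h (sgn x) \<partial>density (distr lborel borel (\<lambda>x. 0 + c *\<^sub>R x))
        (\<lambda>_. ennreal (\<bar>c\<bar> ^ DIM(real ^ 'd))))"
    using lborel_affine[of c "0 :: real ^ 'd"] c by simp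
  also have "\<dots> = (\<integral>x. c ^ CARD('d) * (indicator (ball 0 c) x * h (sgn x))
      \<partial>distr lborel borel (\<lambda>x. 0 + c *\<^sub>R x))"
    using c by (subst integral_density)
      (auto intro!: borel_measurable_times borel_measurable_indicator hs)
  also have "\<dots> = (\<integral>x. c ^ CARD('d) * (indicator (ball 0 c) (c *\<^sub>R x) * h (sgn (c *\<^sub>R x))) \<partial>lborel)"
    by (subst integral_distr) (auto intro!: borel_measurable_times borel_measurable_indicator hs)
  also have "\<dots> = (\<integral>x. c ^ CARD('d) * (indicator (ball 0 1) x * h (sgn x)) \<partial>lborel)"
    using c by (intro Bochner_Integration.integral_cong) (auto simp: indicator_def sgn_scaleR)
  finally show ?thesis by simp
qed

lemma integrable_indicator_ball_mult:
  fixes h :: "'a::euclidean_space \<Rightarrow> real"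
  assumes "h \<in> borel_measurable borel" "\<And>x. x \<in> ball a e \<Longrightarrow> \<bar>h x\<bar> \<le> K"
  shows "integrable lborel (\<lambda>x. indicator (ball a e) x * h x)"
proof (rule Bochner_Integration.integrable_bound)
  show "integrable lborel (\<lambda>x. indicator (ball a e) x * K)"
    using emeasure_lborel_ball_finite[of a e] by auto
qed (use assms in \<open>auto simp: indicator_def intro!: AE_I2 order.trans[OF assms(2) abs_ge_self]\<close>)

section \<open>Radial cutoffs, their difference quotients and their integrals\<close>

definition cutoff :: "real \<Rightarrow> 'a::real_normed_vector \<Rightarrow> real" where
  "cutoff e x = max 0 (min 1 ((1 - norm x) / e))"

lemma cutoff_nonneg: "0 \<le> cutoff e x"
  and cutoff_le_1: "cutoff e x \<le> 1"
  by (auto simp: cutoff_def)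

lemma cutoff_eq_0: "0 < e \<Longrightarrow> x \<notin> ball 0 1 \<Longrightarrow> cutoff e x = 0"
  by (auto simp: cutoff_def max_def min_def zero_le_divide_iff)

lemma cutoff_eq_1: "0 < e \<Longrightarrow> x \<in> ball 0 (1 - e) \<Longrightarrow> cutoff e x = 1"
  by (auto simp: cutoff_def max_def min_def le_divide_eq divide_simps)

lemma cutoff_eq: "0 < e \<Longrightarrow> 1 - e \<le> norm x \<Longrightarrow> norm x \<le> 1 \<Longrightarrow> cutoff e x = (1 - norm x) / e"
  by (auto simp: cutoff_def max_def min_def divide_simps)

lemma borel_measurable_cutoff [measurable]: "cutoff e \<in> borel_measurable borel"
  unfolding cutoff_def[abs_def] by measurable

lemma cutoff_lipschitz:
  assumes "0 < e"
  shows "\<bar>cutoff e x - cutoff e y\<bar> \<le> norm (x - y) / e"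
proof -
  have "\<bar>cutoff e x - cutoff e y\<bar> \<le> \<bar>(1 - norm x) / e - (1 - norm y) / e\<bar>"
    by (auto simp: cutoff_def)
  also have "\<dots> = \<bar>norm x - norm y\<bar> / e"
    using assms by (simp add: abs_minus_commute flip: diff_divide_distrib)
  also have "\<dots> \<le> norm (x - y) / e"
    using assms norm_triangle_ineq3 by (intro divide_right_mono) auto
  finally show ?thesis .
qed

text \<open>The limit is minus the directional derivative of the cutoff: that of norm x / e inside
  the shell, and 0 off it. The two spheres where the profile has a kink are excluded. The condition
  \<open>e < 1\<close> keeps the origin, where the norm is not differentiable, away from the
  shell.\<close>

lemma cutoff_diff_quotient:
  fixes x w :: "'a::real_inner"
  assumes e: "0 < e" "e < 1" and x: "norm x \<noteq> 1" "norm x \<noteq> 1 - e"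
  shows "((\<lambda>t. (cutoff e x - cutoff e (x + t *\<^sub>R w)) / t)
    \<longlongrightarrow> indicator (ball 0 1 - ball 0 (1 - e)) x * (sgn x \<bullet> w) / e) (at 0)"
proof -
  have *: "((\<lambda>t. x + t *\<^sub>R w) \<longlongrightarrow> x) (at 0)"
    by (auto intro!: tendsto_eq_intros)
  then have lim: "((\<lambda>t. norm (x + t *\<^sub>R w)) \<longlongrightarrow> norm x) (at 0)"
    by (rule tendsto_norm)
  consider "1 < norm x" | "norm x < 1 - e" | "1 - e < norm x" "norm x < 1"
    using x by linarith
  then show ?thesis
  proof cases
    case 1
    have "eventually (\<lambda>t. (cutoff e x - cutoff e (x + t *\<^sub>R w)) / t = 0) (at (0::real))"
      using order_tendstoD(1)[OF lim 1] by eventually_elim (use 1 e in \<open>auto simp: cutoff_eq_0\<close>)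
    then show ?thesis
      using 1 by (auto intro: tendsto_eventually)
  next
    case 2
    have "eventually (\<lambda>t. (cutoff e x - cutoff e (x + t *\<^sub>R w)) / t = 0) (at (0::real))"
      using order_tendstoD(2)[OF lim 2] by eventually_elim (use 2 e in \<open>auto simp: cutoff_eq_1\<close>)
    then show ?thesis
      using 2 e by (auto intro: tendsto_eventually)
  next
    case 3
    then have [simp]: "x \<noteq> 0" using e by auto
    have "((\<lambda>t. norm (x + t *\<^sub>R w)) has_derivative (\<lambda>t. (t *\<^sub>R w) \<bullet> sgn x)) (at 0)"
      by (rule has_derivative_compose[where g=norm and f="\<lambda>t. x + t *\<^sub>R w" and g'="\<lambda>y. y \<bullet> sgn x"
            and f'="\<lambda>t. t *\<^sub>R w"])
        (auto intro!: derivative_eq_intros has_derivative_norm)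
    then have "((\<lambda>t. norm (x + t *\<^sub>R w)) has_field_derivative (sgn x \<bullet> w)) (at 0)"
      by (simp add: has_field_derivative_def inner_commute mult.commute mult_commute_abs)
    then have "((\<lambda>t. (norm (x + t *\<^sub>R w) - norm x) / t) \<longlongrightarrow> sgn x \<bullet> w) (at 0)"
      by (simp add: DERIV_def)
    then have "((\<lambda>t. (norm (x + t *\<^sub>R w) - norm x) / t / e) \<longlongrightarrow> sgn x \<bullet> w / e) (at 0)"
      using e by (intro tendsto_divide) auto
    moreover have "eventually (\<lambda>t. (norm (x + t *\<^sub>R w) - norm x) / t / e
        = (cutoff e x - cutoff e (x + t *\<^sub>R w)) / t) (at 0)"
      using order_tendstoD(1)[OF lim 3(1)] order_tendstoD(2)[OF lim 3(2)]
      by eventually_elim (use 3 e in \<open>simp add: cutoff_eq mult.commute flip: diff_divide_distrib\<close>)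
    ultimately show ?thesis
      using 3 by (auto intro: Lim_transform_eventually)
  qed
qed

lemma AE_lborel_norm_neq: "AE x in lborel. norm (x :: 'a::euclidean_space) \<noteq> a"
proof -
  have "sphere (0 :: 'a) a \<in> null_sets lborel"
    using negligible_sphere[of "0 :: 'a" a] unfolding negligible_iff_null_sets
    by (subst (asm) null_sets_completion_iff) auto
  then show ?thesis
    by (rule AE_I') auto
qed

lemma integral_ball_const:
  "(\<integral>x. indicator (ball a e) x * K \<partial>lborel) = K * measure lborel (ball a e)"
  using emeasure_lborel_ball_finite[of a e] by simp

text \<open>The shell is a difference of two balls, and the scaling law evaluates both. This is
  where volume integrals turn into multiples of the sphere average. A bound on \<open>h\<close> over
  the closed unit ball suffices because \<open>sgn\<close> takes its values there, with value 0 at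
  the origin.\<close>

lemma integral_shell_sgn:
  fixes h :: "real ^ 'd \<Rightarrow> real"
  assumes h: "h \<in> borel_measurable borel" "\<And>x. norm x \<le> 1 \<Longrightarrow> \<bar>h x\<bar> \<le> K" and e: "0 < e" "e < 1"
  shows "(\<integral>x. indicator (ball 0 1 - ball 0 (1 - e)) x * h (sgn x) \<partial>lborel) =
    (1 - (1 - e) ^ CARD('d)) * measure lborel (ball (0 :: real ^ 'd) 1) * (\<integral>v. h v \<partial>unif_sphere)"
proof -
  have V: "0 < measure lborel (ball (0 :: real ^ 'd) 1)"
    by (simp add: content_ball_pos)
  have hs: "(\<lambda>x. h (sgn x)) \<in> borel_measurable borel"
    using h(1) by measurable
  have int: "integrable lborel (\<lambda>x. indicator (ball 0 a) x * h (sgn x))" for a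
    by (rule integrable_indicator_ball_mult[OF hs]) (rule h(2), simp add: norm_sgn)
  have "(\<integral>x. indicator (ball 0 1 - ball 0 (1 - e)) x * h (sgn x) \<partial>lborel) =
      (\<integral>x. indicator (ball 0 1) x * h (sgn x) - indicator (ball 0 (1 - e)) x * h (sgn x) \<partial>lborel)"
    using e by (intro Bochner_Integration.integral_cong) (auto simp: indicator_def)
  also have "\<dots> = (1 - (1 - e) ^ CARD('d)) * (\<integral>x. indicator (ball 0 1) x * h (sgn x) \<partial>lborel)"
    using int e by (simp add: integral_ball_sgn[OF h(1), of "1 - e"] left_diff_distrib)
  finally show ?thesis
    using V by (simp add: integral_unif_sphere[OF h(1)])
qed

text \<open>The cutoff lies between the indicators of the balls of radius 1 - e and 1, so its
  integral tends to the volume of the unit ball as e tends to 0.\<close>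

lemma integral_cutoff:
  assumes e: "0 < e" "e < 1"
  shows "integrable lborel (cutoff e :: real ^ 'd \<Rightarrow> real)"
    and "(1 - e) ^ CARD('d) * measure lborel (ball (0 :: real ^ 'd) 1)
      \<le> (\<integral>x. cutoff e (x :: real ^ 'd) \<partial>lborel)"
    and "(\<integral>x. cutoff e (x :: real ^ 'd) \<partial>lborel) \<le> measure lborel (ball (0 :: real ^ 'd) 1)"
proof -
  have eq: "(cutoff e :: real ^ 'd \<Rightarrow> real) = (\<lambda>x. indicator (ball 0 1) x * cutoff e x)"
    using e by (auto simp: indicator_def cutoff_eq_0 fun_eq_iff)
  show int: "integrable lborel (cutoff e :: real ^ 'd \<Rightarrow> real)"
    by (subst eq, rule integrable_indicator_ball_mult[where K=1])
      (auto simp: cutoff_nonneg cutoff_le_1)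
  have 1: "integrable lborel (\<lambda>x :: real ^ 'd. indicator (ball 0 a) x * (1::real))" for a
    by (rule integrable_indicator_ball_mult[where K=1]) auto
  have "(1 - e) ^ CARD('d) * measure lborel (ball (0 :: real ^ 'd) 1)
      = (\<integral>x. indicator (ball 0 (1 - e)) (x :: real ^ 'd) * 1 \<partial>lborel)"
    using integral_ball_sgn[of "\<lambda>_ :: real ^ 'd. 1" "1 - e"] e
    by (simp add: integral_ball_const[of _ _ 1, simplified])
  also have "\<dots> \<le> (\<integral>x. cutoff e (x :: real ^ 'd) \<partial>lborel)"
    by (rule integral_mono[OF 1 int])
      (use e in \<open>auto simp: indicator_def cutoff_nonneg cutoff_eq_1\<close>)
  finally show "(1 - e) ^ CARD('d) * measure lborel (ball (0 :: real ^ 'd) 1)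
      \<le> (\<integral>x. cutoff e (x :: real ^ 'd) \<partial>lborel)" .
  have "(\<integral>x. cutoff e (x :: real ^ 'd) \<partial>lborel)
      \<le> (\<integral>x. indicator (ball 0 1) (x :: real ^ 'd) * 1 \<partial>lborel)"
    by (rule integral_mono[OF int 1])
      (use e in \<open>auto simp: indicator_def cutoff_le_1 cutoff_eq_0\<close>)
  then show "(\<integral>x. cutoff e (x :: real ^ 'd) \<partial>lborel) \<le> measure lborel (ball (0 :: real ^ 'd) 1)"
    by (simp add: integral_ball_const[of _ _ 1, simplified])
qed

text \<open>A discrete integration by parts: weighted by the cutoff, the quotient of
  \<open>g\<close> has the same integral as \<open>g\<close> times the reversed quotient of the
  cutoff, before any limit is taken. Hence \<open>g\<close> may be any bounded measurable function,
  and the one-sided hypothesis on its quotients survives the limit.\<close>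

lemma cutoff_smoothing:
  fixes g :: "real ^ 'd \<Rightarrow> real"
  assumes e: "0 < e" "e < 1" and g: "g \<in> borel_measurable borel" "\<And>x. \<bar>g x\<bar> \<le> B"
    and conv: "\<And>x t. x \<in> ball 0 1 \<Longrightarrow> 0 < t \<Longrightarrow> t \<le> 1 \<Longrightarrow> c \<le> (g x - g (x - t *\<^sub>R w)) / t"
  shows "c * (\<integral>x. cutoff e (x :: real ^ 'd) \<partial>lborel) \<le>
    (\<integral>x. indicator (ball 0 1 - ball 0 (1 - e)) x * (g x * (sgn x \<bullet> w)) \<partial>lborel) / e"
proof -
  note [measurable] = g(1)
  have B: "0 \<le> B" using g(2)[of 0] by linarith
  have cut: "cutoff e x = indicator (ball 0 1) x * cutoff e x" for x :: "real ^ 'd"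
    using e by (auto simp: indicator_def cutoff_eq_0)
  have int: "integrable lborel (\<lambda>x :: real ^ 'd. f x * cutoff e x)"
    if "f \<in> borel_measurable borel" "\<And>x. \<bar>f x\<bar> \<le> B" for f
  proof -
    have "integrable lborel (\<lambda>x :: real ^ 'd. indicator (ball 0 1) x * (f x * cutoff e x))"
    proof (rule integrable_indicator_ball_mult)
      show "\<bar>f x * cutoff e x\<bar> \<le> B * 1" for x :: "real ^ 'd"
        unfolding abs_mult by (intro mult_mono that(2) B) (auto simp: cutoff_nonneg cutoff_le_1)
    qed (use that(1) in measurable)
    then show ?thesis by (subst cut) (simp add: ac_simps)
  qed
  \<comment> \<open>Integrability is proved on the side where the cutoff is not moved, since there
    its support is the unit ball, and is carried over by translation invariance.\<close>
  have shift: "integrable lborel (\<lambda>x. g x * cutoff e (x + a))"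
    "(\<integral>x. g x * cutoff e (x + a) \<partial>lborel) = (\<integral>x. g (x - a) * cutoff e x \<partial>lborel)" for a
  proof -
    have *: "lborel = distr lborel borel ((+) (- a))"
      by (rule lborel_distr_plus[symmetric])
    have i: "integrable lborel (\<lambda>x. g (x - a) * cutoff e x)"
      by (rule int) (use g in auto)
    show "integrable lborel (\<lambda>x. g x * cutoff e (x + a))"
      by (subst *, subst integrable_distr_eq) (use i in \<open>auto simp: algebra_simps\<close>)
    show "(\<integral>x. g x * cutoff e (x + a) \<partial>lborel) = (\<integral>x. g (x - a) * cutoff e x \<partial>lborel)"
      by (subst *, subst integral_distr) (auto simp: algebra_simps)
  qed
  \<comment> \<open>The steps 1/(n+1) replace the limit t -> 0 by a sequence, as dominated
    convergence requires, and all of them lie in the range (0, 1] where the quotient hypothesis is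
    available.\<close>
  define D where "D n x = g x * ((cutoff e x - cutoff e (x + (1 / real (Suc n)) *\<^sub>R w)) / (1 / real (Suc n)))"
    for n x
  have "c * (\<integral>x. cutoff e (x :: real ^ 'd) \<partial>lborel) \<le> (\<integral>x. D n x \<partial>lborel)" for n
  proof -
    define t where "t = 1 / real (Suc n)"
    have t: "0 < t" "t \<le> 1" by (auto simp: t_def)
    have ig: "integrable lborel (\<lambda>x. g x * cutoff e x)"
      "integrable lborel (\<lambda>x. g (x - t *\<^sub>R w) * cutoff e x)"
      by (rule int; use g in auto)+
    have "c * (\<integral>x. cutoff e (x :: real ^ 'd) \<partial>lborel) = (\<integral>x. c * cutoff e (x :: real ^ 'd) \<partial>lborel)"
      by simp
    also have "\<dots> \<le> (\<integral>x. (g x * cutoff e x - g (x - t *\<^sub>R w) * cutoff e x) / t \<partial>lborel)"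
    proof (rule integral_mono)
      fix x :: "real ^ 'd"
      show "c * cutoff e x \<le> (g x * cutoff e x - g (x - t *\<^sub>R w) * cutoff e x) / t"
      proof (cases "x \<in> ball 0 1")
        case True
        from mult_right_mono[OF conv[OF this t] cutoff_nonneg[of e x]] show ?thesis
          by (simp add: algebra_simps)
      qed (use e in \<open>auto simp: cutoff_eq_0\<close>)
    qed (use ig integral_cutoff(1)[OF e] in auto)
    also have "\<dots> = ((\<integral>x. g x * cutoff e x \<partial>lborel) - (\<integral>x. g x * cutoff e (x + t *\<^sub>R w) \<partial>lborel)) / t"
      using ig by (simp add: shift)
    also have "\<dots> = (\<integral>x. (g x * cutoff e x - g x * cutoff e (x + t *\<^sub>R w)) / t \<partial>lborel)"
      using ig shift(1)[of "t *\<^sub>R w"] by simp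
    also have "\<dots> = (\<integral>x. D n x \<partial>lborel)"
      by (simp only: D_def t_def[symmetric] times_divide_eq_right right_diff_distrib)
    finally show ?thesis .
  qed
  moreover have "(\<lambda>n. \<integral>x. D n x \<partial>lborel) \<longlonglongrightarrow>
      (\<integral>x. g x * (indicator (ball 0 1 - ball 0 (1 - e)) x * (sgn x \<bullet> w) / e) \<partial>lborel)"
  proof (rule integral_dominated_convergence)
    \<comment> \<open>The steps are at most 1, so outside the ball of radius 1 + norm w both cutoffs
      in the quotient vanish. Inside it the Lipschitz constant 1/e of the cutoff bounds the quotient
      by norm w / e, uniformly in n.\<close>
    let ?b = "\<lambda>x :: real ^ 'd. indicator (ball 0 (1 + norm w)) x * (B * (norm w / e))"
    show "integrable lborel ?b"
      using B e by (intro integrable_indicator_ball_mult[where K="B * (norm w / e)"]) auto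
    show "AE x in lborel. norm (D n x) \<le> ?b x" for n
    proof (rule AE_I2)
      fix x :: "real ^ 'd"
      define t where "t = 1 / real (Suc n)"
      have t: "0 < t" "t \<le> 1" by (auto simp: t_def)
      have bd: "\<bar>(cutoff e x - cutoff e (x + t *\<^sub>R w)) / t\<bar> \<le> norm w / e"
        using cutoff_lipschitz[OF e(1), of x "x + t *\<^sub>R w"] t by (simp add: field_simps)
      show "norm (D n x) \<le> ?b x"
      proof (cases "x \<in> ball 0 (1 + norm w)")
        case True
        then show ?thesis
          using mult_mono[OF g(2)[of x] bd B abs_ge_zero]
          unfolding D_def t_def[symmetric] real_norm_def abs_mult by simp
      next
        case False
        have "norm (t *\<^sub>R w) \<le> 1 * norm w"
          using t mult_right_mono[of t 1 "norm w"] by simp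
        moreover have "norm x - norm (t *\<^sub>R w) \<le> norm (x + t *\<^sub>R w)"
          using norm_diff_ineq by blast
        moreover have "1 + norm w \<le> norm x"
          using False by (simp add: not_less)
        ultimately have "1 \<le> norm (x + t *\<^sub>R w)" "1 \<le> norm x"
          using norm_ge_zero[of w] by linarith+
        then have "D n x = 0"
          using e unfolding D_def t_def[symmetric] by (simp add: cutoff_eq_0)
        then show ?thesis using False by simp
      qed
    qed
    show "AE x in lborel. (\<lambda>n. D n x) \<longlonglongrightarrow>
        g x * (indicator (ball 0 1 - ball 0 (1 - e)) x * (sgn x \<bullet> w) / e)"
      using AE_lborel_norm_neq[of 1] AE_lborel_norm_neq[of "1 - e"]
    proof eventually_elim
      case (elim x)
      have "filterlim (\<lambda>n. 1 / real (Suc n)) (at 0) sequentially"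
        unfolding filterlim_at using LIMSEQ_inverse_real_of_nat
        by (auto simp: inverse_eq_divide)
      from filterlim_compose[OF cutoff_diff_quotient[OF e elim] this] show ?case
        unfolding D_def by (intro tendsto_mult tendsto_const)
    qed
    have [measurable]: "ball (0 :: real ^ 'd) 1 - ball 0 (1 - e) \<in> sets borel"
      by auto
    show "(\<lambda>x. g x * (indicator (ball 0 1 - ball 0 (1 - e)) x * (sgn x \<bullet> w) / e)) \<in> borel_measurable lborel"
      by measurable
    show "D n \<in> borel_measurable lborel" for n
      unfolding D_def by measurable
  qed
  ultimately have "c * (\<integral>x. cutoff e (x :: real ^ 'd) \<partial>lborel) \<le>
      (\<integral>x. g x * (indicator (ball 0 1 - ball 0 (1 - e)) x * (sgn x \<bullet> w) / e) \<partial>lborel)"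
    by (intro LIMSEQ_le_const) auto
  also have "\<dots> = (\<integral>x. indicator (ball 0 1 - ball 0 (1 - e)) x * (g x * (sgn x \<bullet> w)) / e \<partial>lborel)"
    by (intro Bochner_Integration.integral_cong) auto
  finally show ?thesis by simp
qed

text \<open>The shell of thickness e has volume of order e, which cancels the factor 1/e coming from
  the gradient of the cutoff. Lipschitz continuity pays for moving the value of \<open>g\<close>
  from x to \<open>sgn x\<close>, and both this error and the defect in the volume of the cutoff
  vanish with e.\<close>

lemma unif_sphere_smoothing:
  fixes g :: "real ^ 'd \<Rightarrow> real"
  assumes g: "g \<in> borel_measurable borel" "\<And>x. \<bar>g x\<bar> \<le> B" and lip: "K-lipschitz_on (cball 0 1) g"
    and conv: "\<And>x t. x \<in> ball 0 1 \<Longrightarrow> 0 < t \<Longrightarrow> t \<le> 1 \<Longrightarrow> c \<le> (g x - g (x - t *\<^sub>R w)) / t"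
  shows "c \<le> real CARD('d) * (\<integral>v. g v * (v \<bullet> w) \<partial>unif_sphere)"
proof -
  define V where "V = measure lborel (ball (0 :: real ^ 'd) 1)"
  define R where "R = (\<integral>v. g v * (v \<bullet> w) \<partial>unif_sphere)"
  \<comment> \<open>The geometric sum is (1 - (1 - e)^d) / e in polynomial form. It is continuous at
    e = 0, where its value is the dimension; this is the origin of the factor
    \<open>CARD('d)\<close>.\<close>
  define A where "A e = (\<Sum>j<CARD('d). (1 - e) ^ j)" for e :: real
  have V: "0 < V" by (simp add: V_def content_ball_pos)
  have B: "0 \<le> B" using g(2)[of 0] by linarith
  have K: "0 \<le> K" using lip by (rule lipschitz_on_nonneg)
  note [measurable] = g(1)
  have main: "c - \<bar>c\<bar> * (e * A e) \<le> A e * (R + K * e * norm w)" if e: "0 < e" "e < 1" for e :: real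
  proof -
    have Ae: "1 - (1 - e) ^ CARD('d) = e * A e"
      using one_diff_power_eq[of "1 - e" "CARD('d)"] by (simp add: A_def)
    let ?S = "ball (0 :: real ^ 'd) 1 - ball 0 (1 - e)"
    let ?h = "\<lambda>x. g x * (x \<bullet> w)"
    have h: "?h \<in> borel_measurable borel" "norm x \<le> 1 \<Longrightarrow> \<bar>?h x\<bar> \<le> B * norm w" for x
    proof -
      show "\<bar>?h x\<bar> \<le> B * norm w" if "norm x \<le> 1"
        unfolding abs_mult using that B Cauchy_Schwarz_ineq2[of x w]
          mult_right_mono[OF that norm_ge_zero[of w]]
        by (intro mult_mono g) auto
    qed simp
    have S: "?S \<in> sets borel" by auto
    have SB: "indicator ?S x * f = indicator (ball 0 1) x * (indicator ?S x * f)" for f :: real and x :: "real ^ 'd"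
      by (auto simp: indicator_def)
    have intS: "integrable lborel (\<lambda>x. indicator ?S x * f x)"
      if "f \<in> borel_measurable borel" "\<And>x. norm x \<le> 1 \<Longrightarrow> \<bar>f x\<bar> \<le> Q" for f :: "real ^ 'd \<Rightarrow> real" and Q
    proof -
      have "0 \<le> Q" using that(2)[of 0] by simp
      then show ?thesis
        using that S by (subst SB, intro integrable_indicator_ball_mult[where K=Q])
          (auto simp: indicator_def intro!: borel_measurable_times borel_measurable_indicator)
    qed
    have vol: "(\<integral>x. indicator ?S x * (K * e * norm w) \<partial>lborel) = e * A e * V * (K * e * norm w)"
      using integral_shell_sgn[of "\<lambda>_ :: real ^ 'd. K * e * norm w" "K * e * norm w", OF _ _ e] K e
      by (simp add: Ae V_def prob_space.prob_space[OF prob_space_unif_sphere, simplified])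
    have "c * (\<integral>x. cutoff e (x :: real ^ 'd) \<partial>lborel) \<le>
        (\<integral>x. indicator ?S x * (g x * (sgn x \<bullet> w)) \<partial>lborel) / e"
      by (rule cutoff_smoothing[OF e g conv])
    also have "\<dots> \<le> (\<integral>x. indicator ?S x * ?h (sgn x) + indicator ?S x * (K * e * norm w) \<partial>lborel) / e"
    proof (intro divide_right_mono integral_mono)
      fix x :: "real ^ 'd"
      show "indicator ?S x * (g x * (sgn x \<bullet> w))
          \<le> indicator ?S x * ?h (sgn x) + indicator ?S x * (K * e * norm w)"
      proof (cases "x \<in> ?S")
        case True
        then have x: "x \<noteq> 0" "norm x < 1" "1 - e \<le> norm x" using e by auto
        \<comment> \<open>A point of the shell is within e of its radial projection, which bounds
          the change of \<open>g\<close> by K e.\<close>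
        have "x - sgn x = (norm x - 1) *\<^sub>R sgn x"
          using x by (simp add: sgn_div_norm algebra_simps)
        then have "norm (x - sgn x) = 1 - norm x"
          using x by (simp add: norm_sgn)
        then have "dist x (sgn x) \<le> e"
          using x by (simp add: dist_norm)
        moreover have "dist (g x) (g (sgn x)) \<le> K * dist x (sgn x)"
          using x by (intro lipschitz_onD[OF lip]) (auto simp: norm_sgn)
        ultimately have "\<bar>g x - g (sgn x)\<bar> \<le> K * e"
          using K by (smt (verit) dist_real_def mult_left_mono)
        moreover have "\<bar>sgn x \<bullet> w\<bar> \<le> norm w"
          using Cauchy_Schwarz_ineq2[of "sgn x" w] x by (simp add: norm_sgn)
        ultimately have "\<bar>g x - g (sgn x)\<bar> * \<bar>sgn x \<bullet> w\<bar> \<le> K * e * norm w"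
          using K e by (intro mult_mono) auto
        then have "(g x - g (sgn x)) * (sgn x \<bullet> w) \<le> K * e * norm w"
          by (metis abs_le_D1 abs_mult)
        then show ?thesis using True by (simp add: algebra_simps)
      qed simp
    next
      have hs: "\<bar>f (sgn x)\<bar> \<le> Q" if "\<And>x. norm x \<le> 1 \<Longrightarrow> \<bar>f x\<bar> \<le> Q" for f Q and x :: "real ^ 'd"
        by (rule that) (simp add: norm_sgn)
      show "integrable lborel (\<lambda>x. indicator ?S x * (g x * (sgn x \<bullet> w)))"
      proof (rule intS)
        fix x :: "real ^ 'd"
        have "\<bar>sgn x \<bullet> w\<bar> \<le> norm w"
          using Cauchy_Schwarz_ineq2[of "sgn x" w] mult_right_mono[of "norm (sgn x)" 1 "norm w"]
          by (auto simp: norm_sgn split: if_splits)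
        then show "\<bar>g x * (sgn x \<bullet> w)\<bar> \<le> B * norm w"
          unfolding abs_mult using B by (intro mult_mono g) auto
      qed measurable
      show "integrable lborel (\<lambda>x. indicator ?S x * ?h (sgn x) + indicator ?S x * (K * e * norm w))"
      proof (intro Bochner_Integration.integrable_add intS)
        show "\<bar>?h (sgn x)\<bar> \<le> B * norm w" for x by (rule hs[OF h(2)])
        show "\<bar>K * e * norm w\<bar> \<le> K * e * norm w" using K e by simp
      qed measurable
    qed (use e in auto)
    also have "\<dots> = A e * V * (R + K * e * norm w)"
    proof -
      have "(\<integral>x. indicator ?S x * ?h (sgn x) + indicator ?S x * (K * e * norm w) \<partial>lborel)
          = (\<integral>x. indicator ?S x * ?h (sgn x) \<partial>lborel) + (\<integral>x. indicator ?S x * (K * e * norm w) \<partial>lborel)"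
      proof (intro Bochner_Integration.integral_add intS)
        show "\<bar>?h (sgn x)\<bar> \<le> B * norm w" for x by (rule h(2)) (simp add: norm_sgn)
        show "\<bar>K * e * norm w\<bar> \<le> K * e * norm w" using K e by simp
      qed measurable
      also have "(\<integral>x. indicator ?S x * ?h (sgn x) \<partial>lborel) = e * A e * V * R"
        using integral_shell_sgn[OF h e] by (simp add: Ae V_def R_def)
      finally show ?thesis unfolding vol using e by (simp add: field_simps)
    qed
    finally have 1: "c * (\<integral>x. cutoff e (x :: real ^ 'd) \<partial>lborel) \<le> A e * V * (R + K * e * norm w)" .
    let ?I = "\<integral>x. cutoff e (x :: real ^ 'd) \<partial>lborel"
    have "(1 - e * A e) * V \<le> ?I" "?I \<le> V"
      using integral_cutoff(2,3)[OF e, where 'd='d] by (auto simp: V_def simp flip: Ae)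
    then have I: "V - ?I \<le> e * A e * V" "0 \<le> V - ?I"
      by (auto simp: algebra_simps)
    \<comment> \<open>The sign of \<open>c\<close> is unknown, so the missing volume
      \<open>V - ?I\<close> is charged at the rate \<open>\<bar>c\<bar>\<close>.\<close>
    have "\<bar>c\<bar> * (V - ?I) \<le> \<bar>c\<bar> * (e * A e * V)" "0 \<le> (\<bar>c\<bar> - c) * (V - ?I)"
      by (rule mult_left_mono[OF I(1)]) (auto intro!: mult_nonneg_nonneg I(2))
    then have "c * V - \<bar>c\<bar> * (e * A e) * V \<le> c * ?I"
      by (simp add: algebra_simps)
    with 1 have "V * (c - \<bar>c\<bar> * (e * A e)) \<le> V * (A e * (R + K * e * norm w))"
      by (simp add: algebra_simps)
    then show ?thesis using V by simp
  qed
  \<comment> \<open>Both sides are polynomials in e, so the inequality for small positive e extends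
    to e = 0.\<close>
  have "c - \<bar>c\<bar> * (0 * A 0) \<le> A 0 * (R + K * 0 * norm w)"
  proof (rule tendsto_le[of "at_right 0"])
    show "((\<lambda>e. c - \<bar>c\<bar> * (e * A e)) \<longlongrightarrow> c - \<bar>c\<bar> * (0 * A 0)) (at_right 0)"
      "((\<lambda>e. A e * (R + K * e * norm w)) \<longlongrightarrow> A 0 * (R + K * 0 * norm w)) (at_right 0)"
      unfolding A_def by (intro tendsto_intros)+
    show "\<forall>\<^sub>F e in at_right 0. c - \<bar>c\<bar> * (e * A e) \<le> A e * (R + K * e * norm w)"
      using eventually_at_right_less[of "0::real"] eventually_at_right_field[of _ "0::real"] 
      by (auto simp: eventually_at_right_field intro!: exI[of _ 1] main)
  qed simp
  then show ?thesis by (simp add: A_def R_def)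
qed

subsection \<open>Conditional value at risk\<close>

lemma borel_measurable_of_bool [measurable (raw)]:
  "Measurable.pred M P \<Longrightarrow> (\<lambda>x. of_bool (P x) :: real) \<in> borel_measurable M"
  unfolding of_bool_def by measurable

lemma (in prob_space) integrable_excess:
  assumes "Z \<in> borel_measurable M" "\<And>\<xi>. \<xi> \<in> space M \<Longrightarrow> \<bar>Z \<xi>\<bar> \<le> U"
  shows "integrable M (\<lambda>\<xi>. max (Z \<xi> - \<tau>) (0::real))"
  by (rule integrable_const_bound[of _ "U + \<bar>\<tau>\<bar>"])
    (use assms in \<open>fastforce intro!: AE_I2, measurable\<close>)

lemma cvar_le:
  assumes "prob_space P" "Z \<in> borel_measurable P" "\<And>\<xi>. \<xi> \<in> space P \<Longrightarrow> \<bar>Z \<xi>\<bar> \<le> U" "0 < \<alpha>" "\<alpha> < 1"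
  shows "cvar P \<alpha> Z \<le> \<tau> + 1 / \<alpha> * (\<integral>\<xi>. max (Z \<xi> - \<tau>) 0 \<partial>P)"
  using cvar_attained[OF assms] by auto

text \<open>Raise the optimal threshold of \<open>Y\<close> by \<open>c\<close>: the excess of
  \<open>Z\<close> over the raised threshold is at most the excess of \<open>Y\<close> over the old
  one.\<close>

lemma cvar_le_add:
  assumes P: "prob_space P" and \<alpha>: "0 < \<alpha>" "\<alpha> < 1"
    and Z: "Z \<in> borel_measurable P" "\<And>\<xi>. \<xi> \<in> space P \<Longrightarrow> \<bar>Z \<xi>\<bar> \<le> U"
    and Y: "Y \<in> borel_measurable P" "\<And>\<xi>. \<xi> \<in> space P \<Longrightarrow> \<bar>Y \<xi>\<bar> \<le> U"
    and le: "\<And>\<xi>. \<xi> \<in> space P \<Longrightarrow> Z \<xi> \<le> Y \<xi> + c"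
  shows "cvar P \<alpha> Z \<le> cvar P \<alpha> Y + c"
proof -
  obtain \<tau> where \<tau>: "cvar P \<alpha> Y = \<tau> + 1 / \<alpha> * (\<integral>\<xi>. max (Y \<xi> - \<tau>) 0 \<partial>P)"
    using cvar_attained[OF P Y \<alpha>] by blast
  have "cvar P \<alpha> Z \<le> (\<tau> + c) + 1 / \<alpha> * (\<integral>\<xi>. max (Z \<xi> - (\<tau> + c)) 0 \<partial>P)"
    by (rule cvar_le[OF P Z \<alpha>])
  also have "\<dots> \<le> (\<tau> + c) + 1 / \<alpha> * (\<integral>\<xi>. max (Y \<xi> - \<tau>) 0 \<partial>P)"
  proof (intro add_left_mono mult_left_mono integral_mono prob_space.integrable_excess[OF P])
    show "max (Z \<xi> - (\<tau> + c)) 0 \<le> max (Y \<xi> - \<tau>) 0" if "\<xi> \<in> space P" for \<xi>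
      using le[OF that] by simp
  qed (use \<alpha> Z Y in auto)
  finally show ?thesis using \<tau> by simp
qed

lemma cvar_abs_diff_le:
  assumes P: "prob_space P" and \<alpha>: "0 < \<alpha>" "\<alpha> < 1"
    and Z: "Z \<in> borel_measurable P" "\<And>\<xi>. \<xi> \<in> space P \<Longrightarrow> \<bar>Z \<xi>\<bar> \<le> U"
    and Y: "Y \<in> borel_measurable P" "\<And>\<xi>. \<xi> \<in> space P \<Longrightarrow> \<bar>Y \<xi>\<bar> \<le> U"
    and le: "\<And>\<xi>. \<xi> \<in> space P \<Longrightarrow> \<bar>Z \<xi> - Y \<xi>\<bar> \<le> c"
  shows "\<bar>cvar P \<alpha> Z - cvar P \<alpha> Y\<bar> \<le> c"
  using cvar_le_add[OF P \<alpha> Z Y, of c] cvar_le_add[OF P \<alpha> Y Z, of c] le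
  by (fastforce simp: abs_le_iff)

text \<open>The functional under the minimum is jointly convex in the threshold and the loss, and
  minimizing over the threshold preserves convexity. Concretely, the left side is tested at the same
  convex combination of the two optimal thresholds.\<close>

lemma cvar_convex:
  assumes P: "prob_space P" and \<alpha>: "0 < \<alpha>" "\<alpha> < 1" and a: "0 \<le> a" "a \<le> 1"
    and Z: "Z \<in> borel_measurable P" "\<And>\<xi>. \<xi> \<in> space P \<Longrightarrow> \<bar>Z \<xi>\<bar> \<le> U"
    and X: "X \<in> borel_measurable P" "\<And>\<xi>. \<xi> \<in> space P \<Longrightarrow> \<bar>X \<xi>\<bar> \<le> U"
    and Y: "Y \<in> borel_measurable P" "\<And>\<xi>. \<xi> \<in> space P \<Longrightarrow> \<bar>Y \<xi>\<bar> \<le> U"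
    and le: "\<And>\<xi>. \<xi> \<in> space P \<Longrightarrow> Z \<xi> \<le> (1 - a) * X \<xi> + a * Y \<xi>"
  shows "cvar P \<alpha> Z \<le> (1 - a) * cvar P \<alpha> X + a * cvar P \<alpha> Y"
proof -
  interpret prob_space P by (rule P)
  obtain \<sigma> where \<sigma>: "cvar P \<alpha> X = \<sigma> + 1 / \<alpha> * (\<integral>\<xi>. max (X \<xi> - \<sigma>) 0 \<partial>P)"
    using cvar_attained[OF P X \<alpha>] by blast
  obtain \<tau> where \<tau>: "cvar P \<alpha> Y = \<tau> + 1 / \<alpha> * (\<integral>\<xi>. max (Y \<xi> - \<tau>) 0 \<partial>P)"
    using cvar_attained[OF P Y \<alpha>] by blast
  define t where "t = (1 - a) * \<sigma> + a * \<tau>"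
  note int = integrable_excess[OF X, of \<sigma>] integrable_excess[OF Y, of \<tau>]
  have 1: "cvar P \<alpha> Z \<le> t + 1 / \<alpha> * (\<integral>\<xi>. max (Z \<xi> - t) 0 \<partial>P)"
    by (rule cvar_le[OF P Z \<alpha>])
  have "(\<integral>\<xi>. max (Z \<xi> - t) 0 \<partial>P)
      \<le> (\<integral>\<xi>. (1 - a) * max (X \<xi> - \<sigma>) 0 + a * max (Y \<xi> - \<tau>) 0 \<partial>P)"
  proof (rule integral_mono[OF integrable_excess[OF Z]])
    fix \<xi> assume "\<xi> \<in> space P"
    have "Z \<xi> - t \<le> (1 - a) * (X \<xi> - \<sigma>) + a * (Y \<xi> - \<tau>)"
      using le[OF \<open>\<xi> \<in> space P\<close>] by (simp add: t_def algebra_simps)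
    also have "\<dots> \<le> (1 - a) * max (X \<xi> - \<sigma>) 0 + a * max (Y \<xi> - \<tau>) 0"
      using a by (intro add_mono mult_left_mono) auto
    finally show "max (Z \<xi> - t) 0 \<le> (1 - a) * max (X \<xi> - \<sigma>) 0 + a * max (Y \<xi> - \<tau>) 0"
      using a by simp
  qed (use int in auto)
  also have "\<dots> = (1 - a) * (\<integral>\<xi>. max (X \<xi> - \<sigma>) 0 \<partial>P) + a * (\<integral>\<xi>. max (Y \<xi> - \<tau>) 0 \<partial>P)"
    using int by simp
  finally have "1 / \<alpha> * (\<integral>\<xi>. max (Z \<xi> - t) 0 \<partial>P)
      \<le> 1 / \<alpha> * ((1 - a) * (\<integral>\<xi>. max (X \<xi> - \<sigma>) 0 \<partial>P) + a * (\<integral>\<xi>. max (Y \<xi> - \<tau>) 0 \<partial>P))"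
    using \<alpha> by (intro mult_left_mono) auto
  with 1 show ?thesis
    unfolding \<sigma> \<tau> t_def
    by (simp add: diff_divide_distrib add_divide_distrib algebra_simps)
qed

text \<open>Above, the threshold U leaves no excess. Below, the mean excess over tau is at least (-
  U - tau)+, and 1 / alpha >= 1 allows it to compensate for a threshold below -U.\<close>

lemma cvar_abs_le:
  assumes P: "prob_space P" and \<alpha>: "0 < \<alpha>" "\<alpha> < 1"
    and Z: "Z \<in> borel_measurable P" "\<And>\<xi>. \<xi> \<in> space P \<Longrightarrow> \<bar>Z \<xi>\<bar> \<le> U"
  shows "\<bar>cvar P \<alpha> Z\<bar> \<le> U"
proof -
  interpret prob_space P by (rule P)
  have "cvar P \<alpha> Z \<le> U + 1 / \<alpha> * (\<integral>\<xi>. max (Z \<xi> - U) 0 \<partial>P)"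
    by (rule cvar_le[OF P Z \<alpha>])
  also have "(\<integral>\<xi>. max (Z \<xi> - U) 0 \<partial>P) = (\<integral>\<xi>. 0 \<partial>P)"
    using Z(2) by (intro Bochner_Integration.integral_cong) (force simp: max_def)+
  finally have 1: "cvar P \<alpha> Z \<le> U" by simp
  obtain \<tau> where \<tau>: "cvar P \<alpha> Z = \<tau> + 1 / \<alpha> * (\<integral>\<xi>. max (Z \<xi> - \<tau>) 0 \<partial>P)"
    using cvar_attained[OF P Z \<alpha>] by blast
  have "(\<integral>\<xi>. max (- U - \<tau>) 0 \<partial>P) \<le> (\<integral>\<xi>. max (Z \<xi> - \<tau>) 0 \<partial>P)"
    by (rule integral_mono[OF _ integrable_excess[OF Z]]) (use Z(2) in \<open>fastforce simp: max_def\<close>)+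
  then have I: "max (- U - \<tau>) 0 \<le> (\<integral>\<xi>. max (Z \<xi> - \<tau>) 0 \<partial>P)"
    by (simp add: prob_space)
  have "- U - \<tau> \<le> 1 * max (- U - \<tau>) 0" by simp
  also have "\<dots> \<le> 1 / \<alpha> * (\<integral>\<xi>. max (Z \<xi> - \<tau>) 0 \<partial>P)"
    using \<alpha> I by (intro mult_mono) auto
  finally show ?thesis using 1 \<tau> by linarith
qed

text \<open>Viewing the sample as a function on indices with the uniform law lets the bounds and the
  comparison estimate for \<open>cvar\<close> apply to the empirical version.\<close>

lemma emp_cvar_eq_cvar:
  assumes "1 \<le> s"
  shows "emp_cvar \<alpha> s z = cvar (uniform_count_measure {1..s}) \<alpha> z"
  using assms by (simp add: emp_cvar_def cvar_def integral_uniform_count_measure)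

lemma emp_cvar_abs_le:
  assumes "1 \<le> s" "0 < \<alpha>" "\<alpha> < 1" "\<And>j. j \<in> {1..s} \<Longrightarrow> \<bar>z j\<bar> \<le> U"
  shows "\<bar>emp_cvar \<alpha> s z\<bar> \<le> U"
  unfolding emp_cvar_eq_cvar[OF assms(1)]
  by (rule cvar_abs_le) (use assms in \<open>auto intro!: prob_space_uniform_count_measure simp: space_uniform_count_measure\<close>)

lemma emp_cvar_cong:
  "(\<And>j. j \<in> {1..s} \<Longrightarrow> z j = z' j) \<Longrightarrow> emp_cvar \<alpha> s z = emp_cvar \<alpha> s z'"
  by (simp add: emp_cvar_def)

text \<open>The points where \<open>g\<close> is at least its rational infimum form a closed set
  containing the rationals. The purpose is measurability: an infimum over the reals becomes a
  countable one.\<close>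

lemma continuous_INF_Rats:
  fixes g :: "real \<Rightarrow> real"
  assumes g: "continuous_on UNIV g" and bdd: "bdd_below (range g)"
  shows "(INF \<tau>. g \<tau>) = (INF \<tau>\<in>\<rat>. g \<tau>)"
proof (rule antisym)
  show "(INF \<tau>. g \<tau>) \<le> (INF \<tau>\<in>\<rat>. g \<tau>)"
    using bdd by (intro cINF_superset_mono) auto
  have "closed {\<tau>. (INF \<tau>\<in>\<rat>. g \<tau>) \<le> g \<tau>}"
    using g by (intro closed_Collect_le continuous_on_const)
  moreover have "\<rat> \<subseteq> {\<tau>. (INF \<tau>\<in>\<rat>. g \<tau>) \<le> g \<tau>}"
    using bdd by (auto intro!: cINF_lower intro: bdd_below_mono)
  ultimately have "closure \<rat> \<subseteq> {\<tau>. (INF \<tau>\<in>\<rat>. g \<tau>) \<le> g \<tau>}"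
    by (rule closure_minimal[rotated])
  then show "(INF \<tau>\<in>\<rat>. g \<tau>) \<le> (INF \<tau>. g \<tau>)"
    by (intro cINF_greatest) (auto simp: Rats_closure_real)
qed

lemma borel_measurable_emp_cvar:
  assumes \<alpha>: "0 < \<alpha>" "\<alpha> < 1" and s: "1 \<le> s"
    and z: "\<And>j. j \<in> {1..s} \<Longrightarrow> z j \<in> borel_measurable M"
  shows "(\<lambda>\<omega>. emp_cvar \<alpha> s (\<lambda>j. z j \<omega>)) \<in> borel_measurable M"
proof -
  define g where "g \<omega> \<tau> = \<tau> + 1 / (\<alpha> * real s) * (\<Sum>j=1..s. max (z j \<omega> - \<tau>) 0)" for \<omega> \<tau>
  have "bdd_below (range (g \<omega>))" for \<omega>
    using emp_cvar_attained[OF \<alpha> s, of "\<lambda>j. z j \<omega>"] unfolding g_def by (auto simp: bdd_below_def)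
  moreover have "continuous_on UNIV (g \<omega>)" for \<omega>
    unfolding g_def by (intro continuous_intros)
  ultimately have "emp_cvar \<alpha> s (\<lambda>j. z j \<omega>) = (INF \<tau>\<in>\<rat>. g \<omega> \<tau>)" for \<omega>
    unfolding emp_cvar_def g_def[symmetric] by (intro continuous_INF_Rats)
  moreover have "(\<lambda>\<omega>. INF \<tau>\<in>\<rat>. g \<omega> \<tau>) \<in> borel_measurable M"
  proof (rule borel_measurable_cINF_real[OF countable_rat])
    show "(\<lambda>\<omega>. g \<omega> \<tau>) \<in> borel_measurable M" for \<tau>
      using z unfolding g_def by measurable
  qed
  ultimately show ?thesis by simp
qed

text \<open>Layer cake: the excess is the length of the interval from tau to Z. Its part below -U is
  the same for every variable bounded by U; splitting it off leaves an integral over [-U, U], and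
  the first summand cancels when two laws with the same bound are compared.\<close>

lemma (in prob_space) expectation_excess:
  fixes Z :: "'a \<Rightarrow> real"
  assumes Z: "Z \<in> borel_measurable M" "\<And>\<xi>. \<xi> \<in> space M \<Longrightarrow> \<bar>Z \<xi>\<bar> \<le> U"
  shows "(\<integral>\<xi>. max (Z \<xi> - \<tau>) 0 \<partial>M) = max (- U - \<tau>) 0 +
      (\<integral>t. indicator {-U..U} t * (of_bool (\<tau> \<le> t) * (\<integral>\<xi>. of_bool (t < Z \<xi>) \<partial>M)) \<partial>lborel)"
proof -
  interpret pair_sigma_finite M lborel ..
  note [measurable] = Z(1)
  have [measurable]: "{-U..U} \<in> sets borel" by simp
  define f where "f \<xi> t = indicator {-U..U} t * (of_bool (\<tau> \<le> t) * of_bool (t < Z \<xi>) :: real)" for \<xi> t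
  have f [measurable]: "case_prod f \<in> borel_measurable (M \<Otimes>\<^sub>M lborel)"
    unfolding f_def by measurable
  have "integrable (M \<Otimes>\<^sub>M lborel) (case_prod f)"
  proof (rule Bochner_Integration.integrable_bound)
    show "integrable (M \<Otimes>\<^sub>M lborel) (indicator (space M \<times> {-U..U}) :: _ \<Rightarrow> real)"
      by (rule integrable_real_indicator)
        (auto simp: lborel.emeasure_pair_measure_Times emeasure_space_1 emeasure_lborel_Icc_eq)
  qed (auto simp: f_def indicator_def space_pair_measure)
  then have "(\<integral>t. (\<integral>\<xi>. f \<xi> t \<partial>M) \<partial>lborel) = (\<integral>\<xi>. (\<integral>t. f \<xi> t \<partial>lborel) \<partial>M)"
    by (rule Fubini_integral)
  also have "\<dots> = (\<integral>\<xi>. max (Z \<xi> - \<tau>) 0 - max (- U - \<tau>) 0 \<partial>M)"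
  proof (intro Bochner_Integration.integral_cong refl)
    fix \<xi> assume \<xi>: "\<xi> \<in> space M"
    have "f \<xi> = indicator {max \<tau> (- U)..<Z \<xi>}"
      using Z(2)[OF \<xi>] by (auto simp: f_def indicator_def fun_eq_iff)
    then have "(\<integral>t. f \<xi> t \<partial>lborel) = measure lborel {max \<tau> (- U)..<Z \<xi>}"
      by simp
    also have "\<dots> = max (Z \<xi> - \<tau>) 0 - max (- U - \<tau>) 0"
      using Z(2)[OF \<xi>] by (auto simp: max_def measure_lborel_Ico)
    finally show "(\<integral>t. f \<xi> t \<partial>lborel) = max (Z \<xi> - \<tau>) 0 - max (- U - \<tau>) 0" .
  qed
  also have "\<dots> = (\<integral>\<xi>. max (Z \<xi> - \<tau>) 0 \<partial>M) - max (- U - \<tau>) 0"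
    using integrable_excess[OF Z] by (simp add: prob_space)
  finally show ?thesis by (simp add: f_def)
qed

text \<open>Insert the minimizer of either functional into the other: only the mean excesses differ,
  and their distance is bounded by the integral of the difference of the tails, uniformly in tau.
  The two laws may live on different spaces, so that a law of samples can be compared with the
  uniform law on indices.\<close>

lemma cvar_abs_diff_le_integral_tail:
  assumes P: "prob_space P" and Q: "prob_space Q" and \<alpha>: "0 < \<alpha>" "\<alpha> < 1"
    and Z: "Z \<in> borel_measurable P" "\<And>\<xi>. \<xi> \<in> space P \<Longrightarrow> \<bar>Z \<xi>\<bar> \<le> U"
    and Y: "Y \<in> borel_measurable Q" "\<And>\<xi>. \<xi> \<in> space Q \<Longrightarrow> \<bar>Y \<xi>\<bar> \<le> U"
  shows "\<bar>cvar P \<alpha> Z - cvar Q \<alpha> Y\<bar> \<le> 1 / \<alpha> * (\<integral>t. indicator {-U..U} t *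
    \<bar>(\<integral>\<xi>. of_bool (t < Z \<xi>) \<partial>P) - (\<integral>\<xi>. of_bool (t < Y \<xi>) \<partial>Q)\<bar> \<partial>lborel)"
proof -
  interpret P: prob_space P by (rule P)
  interpret Q: prob_space Q by (rule Q)
  note [measurable] = Z(1) Y(1)
  define G :: "real \<Rightarrow> real" where "G t = (\<integral>\<xi>. of_bool (t < Z \<xi>) \<partial>P)" for t
  define H :: "real \<Rightarrow> real" where "H t = (\<integral>\<xi>. of_bool (t < Y \<xi>) \<partial>Q)" for t
  have GH [measurable]: "G \<in> borel_measurable lborel" "H \<in> borel_measurable lborel"
    unfolding G_def H_def by measurable
  have bd: "0 \<le> G t" "G t \<le> 1" "0 \<le> H t" "H t \<le> 1" for t
  proof -
    have "G t \<le> (\<integral>\<xi>. 1 \<partial>P)" "H t \<le> (\<integral>\<xi>. 1 \<partial>Q)"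
      unfolding G_def H_def
      by (intro integral_mono P.integrable_const_bound[of _ 1] Q.integrable_const_bound[of _ 1]; force)+
    then show "G t \<le> 1" "H t \<le> 1" by (simp_all add: P.prob_space Q.prob_space)
  qed (simp_all add: G_def H_def)
  define B where "B = (\<integral>t. indicator {-U..U} t * \<bar>G t - H t\<bar> \<partial>lborel)"
  have int: "integrable lborel (\<lambda>t. indicator {-U..U} t * f t)"
    if "f \<in> borel_measurable lborel" "\<And>t. \<bar>f t\<bar> \<le> 1" for f :: "real \<Rightarrow> real"
    by (rule Bochner_Integration.integrable_bound[of _ "indicator {-U..U} :: real \<Rightarrow> real"])
      (use that in \<open>auto simp: indicator_def emeasure_lborel_Icc_eq\<close>)
  have iG: "integrable lborel (\<lambda>t. indicator {-U..U} t * (of_bool (\<tau> \<le> t) * G t))"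
    and iH: "integrable lborel (\<lambda>t. indicator {-U..U} t * (of_bool (\<tau> \<le> t) * H t))" for \<tau>
    using bd by (auto intro!: int simp: abs_mult)
  have dev: "\<bar>(\<integral>\<xi>. max (Z \<xi> - \<tau>) 0 \<partial>P) - (\<integral>\<xi>. max (Y \<xi> - \<tau>) 0 \<partial>Q)\<bar> \<le> B" for \<tau>
  proof -
    have "\<bar>(\<integral>\<xi>. max (Z \<xi> - \<tau>) 0 \<partial>P) - (\<integral>\<xi>. max (Y \<xi> - \<tau>) 0 \<partial>Q)\<bar> =
        \<bar>\<integral>t. indicator {-U..U} t * (of_bool (\<tau> \<le> t) * G t)
          - indicator {-U..U} t * (of_bool (\<tau> \<le> t) * H t) \<partial>lborel\<bar>"
      unfolding Bochner_Integration.integral_diff[OF iG iH]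
      by (simp add: P.expectation_excess[OF Z] Q.expectation_excess[OF Y] G_def H_def)
    also have "\<dots> \<le> (\<integral>t. \<bar>indicator {-U..U} t * (of_bool (\<tau> \<le> t) * G t)
          - indicator {-U..U} t * (of_bool (\<tau> \<le> t) * H t)\<bar> \<partial>lborel)"
      by (rule integral_abs_bound)
    also have "\<dots> \<le> B"
      unfolding B_def
    proof (rule integral_mono)
      show "integrable lborel (\<lambda>t. indicator {-U..U} t * \<bar>G t - H t\<bar>)"
      proof (rule int)
        show "\<bar>\<bar>G t - H t\<bar>\<bar> \<le> 1" for t
          using bd[of t] by linarith
      qed measurable
    qed (use iG iH in \<open>auto simp: indicator_def\<close>)
    finally show ?thesis .
  qed
  obtain \<sigma> where \<sigma>: "cvar P \<alpha> Z = \<sigma> + 1 / \<alpha> * (\<integral>\<xi>. max (Z \<xi> - \<sigma>) 0 \<partial>P)"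
    using cvar_attained[OF P Z \<alpha>] by blast
  obtain \<tau> where \<tau>: "cvar Q \<alpha> Y = \<tau> + 1 / \<alpha> * (\<integral>\<xi>. max (Y \<xi> - \<tau>) 0 \<partial>Q)"
    using cvar_attained[OF Q Y \<alpha>] by blast
  have "cvar P \<alpha> Z - cvar Q \<alpha> Y
      \<le> 1 / \<alpha> * ((\<integral>\<xi>. max (Z \<xi> - \<tau>) 0 \<partial>P) - (\<integral>\<xi>. max (Y \<xi> - \<tau>) 0 \<partial>Q))"
    using cvar_le[OF P Z \<alpha>, of \<tau>] unfolding \<tau> by (simp add: diff_divide_distrib)
  also have "\<dots> \<le> 1 / \<alpha> * B"
    using \<alpha> dev[of \<tau>] by (intro mult_left_mono) auto
  finally have 1: "cvar P \<alpha> Z - cvar Q \<alpha> Y \<le> 1 / \<alpha> * B" .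
  have "cvar Q \<alpha> Y - cvar P \<alpha> Z
      \<le> 1 / \<alpha> * ((\<integral>\<xi>. max (Y \<xi> - \<sigma>) 0 \<partial>Q) - (\<integral>\<xi>. max (Z \<xi> - \<sigma>) 0 \<partial>P))"
    using cvar_le[OF Q Y \<alpha>, of \<sigma>] unfolding \<sigma> by (simp add: diff_divide_distrib)
  also have "\<dots> \<le> 1 / \<alpha> * B"
    using \<alpha> dev[of \<sigma>] by (intro mult_left_mono) auto
  finally show ?thesis using 1 unfolding B_def G_def H_def by (simp add: abs_le_iff)
qed

text \<open>Independence removes the off-diagonal products, so the second moment of the centred mean
  is at most (s / 4) / s^2. Its root bounds the first absolute moment, because the variance of the
  absolute value is nonnegative.\<close>

lemma (in prob_space) expectation_abs_mean_deviation:
  fixes B :: "nat \<Rightarrow> 'a \<Rightarrow> real"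
  assumes ind: "indep_vars (\<lambda>_. borel) B {1..s}" and s: "1 \<le> s"
    and bd: "\<And>j \<omega>. j \<in> {1..s} \<Longrightarrow> \<omega> \<in> space M \<Longrightarrow> 0 \<le> B j \<omega> \<and> B j \<omega> \<le> 1"
    and mean: "\<And>j. j \<in> {1..s} \<Longrightarrow> expectation (B j) = p"
  shows "expectation (\<lambda>\<omega>. \<bar>(\<Sum>j=1..s. B j \<omega>) / real s - p\<bar>) \<le> 1 / (2 * sqrt (real s))"
proof -
  have Bm: "B j \<in> borel_measurable M" if "j \<in> {1..s}" for j
    using ind that by (auto simp: indep_vars_def)
  have iB: "integrable M (B j)" if "j \<in> {1..s}" for j
    by (rule integrable_const_bound[of _ 1]) (use bd[OF that] Bm[OF that] in auto)
  define D where "D j \<omega> = B j \<omega> - p" for j \<omega>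
  have p: "0 \<le> p" "p \<le> 1"
  proof -
    have 1: "1 \<in> {1..s}" using s by simp
    show "0 \<le> p" unfolding mean[OF 1, symmetric]
      using bd[OF 1] by (intro Bochner_Integration.integral_nonneg_AE) auto
    have "expectation (B 1) \<le> expectation (\<lambda>_. 1)"
      using bd[OF 1] iB[OF 1] by (intro integral_mono) auto
    then show "p \<le> 1" using mean[OF 1] by (simp add: prob_space)
  qed
  have Dm: "D j \<in> borel_measurable M" and Db: "\<omega> \<in> space M \<Longrightarrow> \<bar>D j \<omega>\<bar> \<le> 1"
    and iD: "integrable M (D j)" and mD: "expectation (D j) = 0" if "j \<in> {1..s}" for j \<omega>
    using Bm[OF that] iB[OF that] bd[OF that, of \<omega>] p mean[OF that]
    unfolding D_def by (auto simp: prob_space)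
  have iDD: "integrable M (\<lambda>\<omega>. D j \<omega> * D l \<omega>)" if "j \<in> {1..s}" "l \<in> {1..s}" for j l
  proof (rule integrable_const_bound[of _ "1 * 1"])
    show "AE \<omega> in M. norm (D j \<omega> * D l \<omega>) \<le> 1 * 1"
      unfolding real_norm_def abs_mult using that Db by (intro AE_I2 mult_mono) auto
  qed (use that Dm in auto)
  have diag: "expectation (\<lambda>\<omega>. D j \<omega> * D j \<omega>) \<le> 1 / 4" if "j \<in> {1..s}" for j
  proof -
    \<comment> \<open>On [0, 1] the square of \<open>B j\<close> is at most \<open>B j\<close>, so
      the centred square is dominated by an affine function of \<open>B j\<close> and only the mean
      p enters. The resulting p - p^2 is largest at p = 1/2.\<close>
    have "expectation (\<lambda>\<omega>. D j \<omega> * D j \<omega>) \<le> expectation (\<lambda>\<omega>. (1 - 2 * p) * B j \<omega> + p\<^sup>2)"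
    proof (rule integral_mono[OF iDD[OF that that]])
      fix \<omega> assume "\<omega> \<in> space M"
      then have "B j \<omega> * B j \<omega> \<le> B j \<omega>" using bd[OF that] by (auto intro: mult_left_le)
      then show "D j \<omega> * D j \<omega> \<le> (1 - 2 * p) * B j \<omega> + p\<^sup>2"
        by (simp add: D_def algebra_simps power2_eq_square)
    qed (use iB[OF that] in auto)
    also have "\<dots> = p - p\<^sup>2"
      using iB[OF that] by (simp add: mean[OF that] prob_space algebra_simps power2_eq_square)
    also have "\<dots> \<le> 1 / 4"
      using zero_le_power2[of "p - 1 / 2"] by (simp add: power2_eq_square algebra_simps)
    finally show ?thesis .
  qed
  have off: "expectation (\<lambda>\<omega>. D j \<omega> * D l \<omega>) = 0" if jl: "j \<in> {1..s}" "l \<in> {1..s}" "j \<noteq> l" for j l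
  proof -
    have "indep_vars (\<lambda>_. borel) D {1..s}"
      unfolding D_def using indep_vars_compose2[OF ind, of "\<lambda>_ x. x - p" "\<lambda>_. borel"] by auto
    then have "indep_vars (\<lambda>_. borel) D {j, l}"
      by (rule indep_vars_subset) (use jl in auto)
    moreover have "integrable M (D i)" if "i \<in> {j, l}" for i
      using that jl by (auto intro: iD)
    ultimately show ?thesis
      using indep_vars_lebesgue_integral[of "{j, l}" D] jl by (simp add: mD)
  qed
  define Y where "Y \<omega> = (\<Sum>j=1..s. D j \<omega>) / real s" for \<omega>
  have Y: "(\<Sum>j=1..s. B j \<omega>) / real s - p = Y \<omega>" for \<omega>
    using s by (simp add: Y_def D_def sum_subtractf diff_divide_distrib)
  have iY: "integrable M Y" unfolding Y_def by (intro integrable_divide Bochner_Integration.integrable_sum iD)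
  have Y2: "(Y \<omega>)\<^sup>2 = (\<Sum>j=1..s. \<Sum>l=1..s. D j \<omega> * D l \<omega>) / (real s)\<^sup>2" for \<omega>
    by (simp add: Y_def power_divide power2_eq_square sum_product)
  have iY2: "integrable M (\<lambda>\<omega>. (Y \<omega>)\<^sup>2)"
    unfolding Y2 by (intro integrable_divide Bochner_Integration.integrable_sum iDD)
  have "expectation (\<lambda>\<omega>. (Y \<omega>)\<^sup>2) =
      (\<Sum>j=1..s. expectation (\<lambda>\<omega>. \<Sum>l=1..s. D j \<omega> * D l \<omega>)) / (real s)\<^sup>2"
    unfolding Y2 integral_divide_zero
    by (subst Bochner_Integration.integral_sum) (intro Bochner_Integration.integrable_sum iDD, auto)
  also have "(\<Sum>j=1..s. expectation (\<lambda>\<omega>. \<Sum>l=1..s. D j \<omega> * D l \<omega>))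
      = (\<Sum>j=1..s. \<Sum>l=1..s. expectation (\<lambda>\<omega>. D j \<omega> * D l \<omega>))"
    by (intro sum.cong refl Bochner_Integration.integral_sum iDD)
  also have "(\<Sum>j=1..s. \<Sum>l=1..s. expectation (\<lambda>\<omega>. D j \<omega> * D l \<omega>))
      = (\<Sum>j=1..s. \<Sum>l=1..s. if j = l then expectation (\<lambda>\<omega>. D j \<omega> * D j \<omega>) else 0)"
    using off by (intro sum.cong refl) auto
  also have "\<dots> = (\<Sum>j=1..s. expectation (\<lambda>\<omega>. D j \<omega> * D j \<omega>))"
    by simp
  also have "\<dots> \<le> (\<Sum>j=1..s. 1 / 4)"
    by (intro sum_mono diag)
  finally have EY2: "expectation (\<lambda>\<omega>. (Y \<omega>)\<^sup>2) \<le> 1 / (4 * real s)"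
    using s by (simp add: divide_right_mono power2_eq_square field_simps)
  have "0 \<le> variance (\<lambda>\<omega>. \<bar>Y \<omega>\<bar>)"
    by (rule variance_positive)
  also have "\<dots> = expectation (\<lambda>\<omega>. (Y \<omega>)\<^sup>2) - (expectation (\<lambda>\<omega>. \<bar>Y \<omega>\<bar>))\<^sup>2"
    by (subst variance_eq) (use iY iY2 in auto)
  finally have "(expectation (\<lambda>\<omega>. \<bar>Y \<omega>\<bar>))\<^sup>2 \<le> 1 / (4 * real s)"
    using EY2 by simp
  also have "1 / (4 * real s) = (1 / (2 * sqrt (real s)))\<^sup>2"
    by (simp add: power_divide power_mult_distrib)
  finally have "expectation (\<lambda>\<omega>. \<bar>Y \<omega>\<bar>) \<le> 1 / (2 * sqrt (real s))"
    by (rule power2_le_imp_le) simp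
  then show ?thesis by (simp only: Y)
qed

text \<open>Fubini moves the expectation inside the integral over t, where the empirical frequency
  of Z > t is a mean of s independent indicators. The length 2 U of the interval cancels the 2 in 1
  / (2 sqrt s).\<close>

lemma (in prob_space) expectation_emp_cvar_deviation:
  assumes \<alpha>: "0 < \<alpha>" "\<alpha> < 1" and s: "1 \<le> s" and P: "prob_space P"
    and ind: "indep_vars (\<lambda>_. P) \<xi> {1..s}"
    and distr: "\<And>j. j \<in> {1..s} \<Longrightarrow> distr M P (\<xi> j) = P"
    and Z: "Z \<in> borel_measurable P" "\<And>a. a \<in> space P \<Longrightarrow> \<bar>Z a\<bar> \<le> U"
  shows "expectation (\<lambda>\<omega>. \<bar>emp_cvar \<alpha> s (\<lambda>j. Z (\<xi> j \<omega>)) - cvar P \<alpha> Z\<bar>) \<le> U / (\<alpha> * sqrt (real s))"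
proof -
  interpret P: prob_space P by (rule P)
  interpret pair_sigma_finite M lborel ..
  note [measurable] = Z(1)
  have U: "0 \<le> U" using Z(2) P.not_empty by fastforce
  have \<xi> [measurable]: "\<xi> j \<in> measurable M P" if "j \<in> {1..s}" for j
    using ind that by (auto simp: indep_vars_def)
  have \<xi>s: "\<xi> j \<omega> \<in> space P" if "j \<in> {1..s}" "\<omega> \<in> space M" for j \<omega>
    using \<xi>[OF that(1)] that(2) by (rule measurable_space)
  define p :: "real \<Rightarrow> real" where "p t = (\<integral>a. of_bool (t < Z a) \<partial>P)" for t
  have [measurable]: "{-U..U} \<in> sets borel" by simp
  define f where "f \<omega> t = indicator {-U..U} t *
    \<bar>(\<Sum>j=1..s. of_bool (t < Z (\<xi> j \<omega>))) / real s - p t\<bar>" for \<omega> t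
  have [measurable]: "p \<in> borel_measurable lborel"
    unfolding p_def by measurable
  have p: "0 \<le> p t" "p t \<le> 1" for t
  proof -
    have "p t \<le> (\<integral>a. 1 \<partial>P)"
      unfolding p_def by (intro integral_mono P.integrable_const_bound[of _ 1]; force)
    then show "p t \<le> 1" by (simp add: P.prob_space)
  qed (simp add: p_def)
  have fm: "case_prod f \<in> borel_measurable (M \<Otimes>\<^sub>M lborel)"
    unfolding f_def by measurable
  have f1: "\<bar>f \<omega> t\<bar> \<le> 1" for \<omega> t
  proof -
    have "(\<Sum>j=1..s. of_bool (t < Z (\<xi> j \<omega>))) \<le> real (card {1..s}) * (1::real)"
      by (rule sum_bounded_above) simp
    then have "(\<Sum>j=1..s. of_bool (t < Z (\<xi> j \<omega>))) / real s \<le> (1::real)"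
      using s by (simp add: divide_le_eq)
    moreover have "0 \<le> (\<Sum>j=1..s. of_bool (t < Z (\<xi> j \<omega>))) / real s"
      by (intro divide_nonneg_nonneg sum_nonneg) auto
    ultimately have "\<bar>(\<Sum>j=1..s. of_bool (t < Z (\<xi> j \<omega>))) / real s - p t\<bar> \<le> 1"
      using p[of t] by linarith
    then show ?thesis
      by (simp add: f_def indicator_def)
  qed
  have fi: "integrable (M \<Otimes>\<^sub>M lborel) (case_prod f)"
  proof (rule Bochner_Integration.integrable_bound[OF _ fm])
    show "integrable (M \<Otimes>\<^sub>M lborel) (indicator (space M \<times> {-U..U}) :: _ \<Rightarrow> real)"
      by (rule integrable_real_indicator)
        (auto simp: lborel.emeasure_pair_measure_Times emeasure_space_1 emeasure_lborel_Icc_eq)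
    have "f \<omega> t = 0" if "t \<notin> {-U..U}" for \<omega> t using that by (auto simp: f_def)
    then show "AE x in M \<Otimes>\<^sub>M lborel. norm (case_prod f x) \<le> norm (indicator (space M \<times> {-U..U}) x :: real)"
      using f1 by (intro AE_I2) (fastforce simp: indicator_def space_pair_measure)
  qed
  have "expectation (\<lambda>\<omega>. \<bar>emp_cvar \<alpha> s (\<lambda>j. Z (\<xi> j \<omega>)) - cvar P \<alpha> Z\<bar>)
      \<le> expectation (\<lambda>\<omega>. 1 / \<alpha> * (\<integral>t. f \<omega> t \<partial>lborel))"
  proof (rule integral_mono)
    have "(\<lambda>\<omega>. emp_cvar \<alpha> s (\<lambda>j. Z (\<xi> j \<omega>))) \<in> borel_measurable M"
      by (rule borel_measurable_emp_cvar[OF \<alpha> s]) measurable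
    moreover have "\<bar>emp_cvar \<alpha> s (\<lambda>j. Z (\<xi> j \<omega>)) - cvar P \<alpha> Z\<bar> \<le> U + U" if "\<omega> \<in> space M" for \<omega>
      using emp_cvar_abs_le[OF s \<alpha>, of "\<lambda>j. Z (\<xi> j \<omega>)" U] cvar_abs_le[OF P \<alpha> Z] \<xi>s that Z(2)
      by fastforce
    ultimately show "integrable M (\<lambda>\<omega>. \<bar>emp_cvar \<alpha> s (\<lambda>j. Z (\<xi> j \<omega>)) - cvar P \<alpha> Z\<bar>)"
      by (intro integrable_const_bound[of _ "U + U"]) auto
    show "integrable M (\<lambda>\<omega>. 1 / \<alpha> * (\<integral>t. f \<omega> t \<partial>lborel))"
      using integrable_fst'[OF fi] by simp
    fix \<omega> assume "\<omega> \<in> space M"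
    then have "\<bar>cvar (uniform_count_measure {1..s}) \<alpha> (\<lambda>j. Z (\<xi> j \<omega>)) - cvar P \<alpha> Z\<bar> \<le>
      1 / \<alpha> * (\<integral>t. indicator {-U..U} t * \<bar>(\<integral>j. of_bool (t < Z (\<xi> j \<omega>)) \<partial>uniform_count_measure {1..s})
         - (\<integral>a. of_bool (t < Z a) \<partial>P)\<bar> \<partial>lborel)"
      using s \<xi>s Z(2)
      by (intro cvar_abs_diff_le_integral_tail[OF _ P \<alpha>] Z prob_space_uniform_count_measure)
        (auto simp: space_uniform_count_measure sets_uniform_count_measure measurable_def)
    then show "\<bar>emp_cvar \<alpha> s (\<lambda>j. Z (\<xi> j \<omega>)) - cvar P \<alpha> Z\<bar> \<le> 1 / \<alpha> * (\<integral>t. f \<omega> t \<partial>lborel)"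
      unfolding emp_cvar_eq_cvar[OF s] f_def p_def
      by (simp only: integral_uniform_count_measure[OF finite_atLeastAtMost]) simp
  qed
  also have "\<dots> = 1 / \<alpha> * (\<integral>t. expectation (\<lambda>\<omega>. f \<omega> t) \<partial>lborel)"
    using Fubini_integral[OF fi] by simp
  finally have 1: "expectation (\<lambda>\<omega>. \<bar>emp_cvar \<alpha> s (\<lambda>j. Z (\<xi> j \<omega>)) - cvar P \<alpha> Z\<bar>) \<le> \<dots>" .
  have "(\<integral>t. expectation (\<lambda>\<omega>. f \<omega> t) \<partial>lborel)
      \<le> (\<integral>t. indicator {-U..U} t * (1 / (2 * sqrt (real s))) \<partial>lborel)"
  proof (rule integral_mono)
    show "integrable lborel (\<lambda>t. expectation (\<lambda>\<omega>. f \<omega> t))"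
      using integrable_snd[OF fi] .
    show "integrable lborel (\<lambda>t. indicator {-U..U} t * (1 / (2 * sqrt (real s))))"
      by (auto simp: emeasure_lborel_Icc_eq)
    fix t
    have "expectation (\<lambda>\<omega>. \<bar>(\<Sum>j=1..s. of_bool (t < Z (\<xi> j \<omega>))) / real s - p t\<bar>) \<le> 1 / (2 * sqrt (real s))"
    proof (rule expectation_abs_mean_deviation[OF _ s])
      show "indep_vars (\<lambda>_. borel) (\<lambda>j \<omega>. of_bool (t < Z (\<xi> j \<omega>)) :: real) {1..s}"
        by (rule indep_vars_compose2[OF ind]) measurable
      show "expectation (\<lambda>\<omega>. of_bool (t < Z (\<xi> j \<omega>))) = p t" if j: "j \<in> {1..s}" for j
        unfolding p_def by (subst distr[OF j, symmetric], subst integral_distr) (use j in auto)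
    qed auto
    then show "expectation (\<lambda>\<omega>. f \<omega> t) \<le> indicator {-U..U} t * (1 / (2 * sqrt (real s)))"
      unfolding f_def by (auto simp: indicator_def)
  qed
  also have "\<dots> = U / sqrt (real s)"
    using U by simp
  finally have "1 / \<alpha> * (\<integral>t. expectation (\<lambda>\<omega>. f \<omega> t) \<partial>lborel) \<le> 1 / \<alpha> * (U / sqrt (real s))"
    using \<alpha> by (intro mult_left_mono) auto
  with 1 show ?thesis by simp
qed

subsection \<open>The zeroth-order gradient\<close>

text \<open>A K-Lipschitz function on X is the infimum over d of its value at d plus K times the
  distance to d, and a countable dense set of d suffices. Each term is measurable because its
  decision is fixed.\<close>

lemma borel_measurable_lipschitz_compose:
  fixes J :: "'a::{metric_space,second_countable_topology} \<Rightarrow> 'b \<Rightarrow> real"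
  assumes J: "\<And>z. z \<in> X \<Longrightarrow> J z \<in> borel_measurable P"
    and lip: "\<And>a. a \<in> space P \<Longrightarrow> K-lipschitz_on X (\<lambda>z. J z a)"
    and f: "f \<in> borel_measurable N" "\<And>\<omega>. \<omega> \<in> space N \<Longrightarrow> f \<omega> \<in> X"
    and g: "g \<in> measurable N P"
  shows "(\<lambda>\<omega>. J (f \<omega>) (g \<omega>)) \<in> borel_measurable N"
proof -
  obtain T where T: "countable T" "T \<subseteq> X" "X \<subseteq> closure T"
    using separable by blast
  have "J (f \<omega>) (g \<omega>) = (INF d\<in>T. J d (g \<omega>) + K * dist (f \<omega>) d)" if \<omega>: "\<omega> \<in> space N" for \<omega>
  proof -
    let ?h = "\<lambda>d. J d (g \<omega>) + K * dist (f \<omega>) d"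
    have ga: "g \<omega> \<in> space P" using g \<omega> by (rule measurable_space)
    note lip' = lipschitz_onD[OF lip[OF ga]]
    have K: "0 \<le> K" using lip[OF ga] by (rule lipschitz_on_nonneg)
    have fX: "f \<omega> \<in> X" by (rule f(2)[OF \<omega>])
    then have ne: "T \<noteq> {}" using T by auto
    have lb: "J (f \<omega>) (g \<omega>) \<le> ?h d" if "d \<in> T" for d
      using lip'[of "f \<omega>" d] that T fX by (auto simp: dist_real_def)
    show ?thesis
    proof (rule antisym)
      show "J (f \<omega>) (g \<omega>) \<le> (INF d\<in>T. ?h d)"
        by (rule cINF_greatest[OF ne lb])
      show "(INF d\<in>T. ?h d) \<le> J (f \<omega>) (g \<omega>)"
      proof (rule field_le_epsilon)
        fix e :: real assume e: "0 < e"
        have "f \<omega> \<in> closure T" using T fX by auto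
        \<comment> \<open>The added 1 keeps the denominator positive when K = 0.\<close>
        moreover have "0 < e / (2 * K + 1)" using e K by simp
        ultimately obtain d where d: "d \<in> T" "dist d (f \<omega>) < e / (2 * K + 1)"
          unfolding closure_approachable by blast
        have "(INF d\<in>T. ?h d) \<le> ?h d"
          using lb d by (intro cINF_lower) (auto simp: bdd_below_def)
        also have "\<dots> \<le> J (f \<omega>) (g \<omega>) + 2 * K * dist d (f \<omega>)"
          using lip'[of "f \<omega>" d] d T fX by (auto simp: dist_real_def dist_commute)
        also have "2 * K * dist d (f \<omega>) \<le> (2 * K + 1) * (e / (2 * K + 1))"
          using d K by (intro mult_mono) auto
        also have "\<dots> = e" using K by simp
        finally show "(INF d\<in>T. ?h d) \<le> J (f \<omega>) (g \<omega>) + e" by simp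
      qed
    qed
  qed
  moreover have "(\<lambda>\<omega>. INF d\<in>T. J d (g \<omega>) + K * dist (f \<omega>) d) \<in> borel_measurable N"
  proof (rule borel_measurable_cINF_real[OF T(1)])
    fix d assume "d \<in> T"
    then have [measurable]: "J d \<in> borel_measurable P" using J T by auto
    note [measurable] = f(1) g
    show "(\<lambda>\<omega>. J d (g \<omega>) + K * dist (f \<omega>) d) \<in> borel_measurable N"
      by measurable
  qed
  ultimately show ?thesis
    by (subst measurable_cong) auto
qed

text \<open>Sphere smoothing is applied to v -> f (y + delta v) in the direction w = (y - z) /
  delta, which is the source of the factor 1 / delta. A step -t w moves y + delta v along the
  segment to z + delta v; for t <= 1 this stays in \<open>X\<close>, so convexity bounds the
  quotient below by the difference of the end values. Moving both ends back to y and z costs K delta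
  each.\<close>

lemma unif_sphere_gradient_ineq:
  fixes f :: "real ^ 'd \<Rightarrow> real"
  assumes f: "f \<in> borel_measurable borel" "\<And>x. \<bar>f x\<bar> \<le> B"
    and conv: "convex_on X f" and lip: "K-lipschitz_on X f" and \<delta>: "0 < \<delta>"
    and y: "\<And>v. norm v \<le> 1 \<Longrightarrow> y + \<delta> *\<^sub>R v \<in> X" and z: "\<And>v. norm v \<le> 1 \<Longrightarrow> z + \<delta> *\<^sub>R v \<in> X"
  shows "f y - f z - 2 * K * \<delta> \<le>
    (\<integral>v. real CARD('d) / \<delta> * f (y + \<delta> *\<^sub>R v) * (v \<bullet> (y - z)) \<partial>unif_sphere)"
proof -
  have K: "0 \<le> K" using lip by (rule lipschitz_on_nonneg)
  note [measurable] = f(1)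
  define w where "w = (y - z) /\<^sub>R \<delta>"
  have "f y - f z - 2 * K * \<delta> \<le> real CARD('d) * (\<integral>v. f (y + \<delta> *\<^sub>R v) * (v \<bullet> w) \<partial>unif_sphere)"
  proof (rule unif_sphere_smoothing)
    show "(\<lambda>v. f (y + \<delta> *\<^sub>R v)) \<in> borel_measurable borel" by measurable
    show "\<bar>f (y + \<delta> *\<^sub>R v)\<bar> \<le> B" for v by (rule f(2))
    show "(K * \<delta>)-lipschitz_on (cball 0 1) (\<lambda>v. f (y + \<delta> *\<^sub>R v))"
    proof (rule lipschitz_onI)
      fix a b :: "real ^ 'd" assume "a \<in> cball 0 1" "b \<in> cball 0 1"
      then have "dist (f (y + \<delta> *\<^sub>R a)) (f (y + \<delta> *\<^sub>R b)) \<le> K * dist (y + \<delta> *\<^sub>R a) (y + \<delta> *\<^sub>R b)"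
        using y by (intro lipschitz_onD[OF lip]) auto
      also have "dist (y + \<delta> *\<^sub>R a) (y + \<delta> *\<^sub>R b) = \<delta> * dist a b"
        using \<delta> by (simp add: dist_norm flip: scaleR_diff_right)
      finally show "dist (f (y + \<delta> *\<^sub>R a)) (f (y + \<delta> *\<^sub>R b)) \<le> K * \<delta> * dist a b" by simp
    qed (use K \<delta> in simp)
    fix v :: "real ^ 'd" and t :: real
    assume v: "v \<in> ball 0 1" and t: "0 < t" "t \<le> 1"
    have X: "y + \<delta> *\<^sub>R v \<in> X" "z + \<delta> *\<^sub>R v \<in> X" "y \<in> X" "z \<in> X"
      using y[of v] z[of v] y[of 0] z[of 0] v by auto
    have "\<delta> *\<^sub>R t *\<^sub>R w = t *\<^sub>R (y - z)"
      using \<delta> by (simp add: w_def)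
    then have "y + \<delta> *\<^sub>R (v - t *\<^sub>R w) = (1 - t) *\<^sub>R (y + \<delta> *\<^sub>R v) + t *\<^sub>R (z + \<delta> *\<^sub>R v)"
      unfolding scaleR_diff_right[of \<delta>] by (simp add: algebra_simps)
    then have "f (y + \<delta> *\<^sub>R (v - t *\<^sub>R w)) \<le> (1 - t) * f (y + \<delta> *\<^sub>R v) + t * f (z + \<delta> *\<^sub>R v)"
      using conv X t by (simp add: convex_on_def)
    then have "t * (f (y + \<delta> *\<^sub>R v) - f (z + \<delta> *\<^sub>R v)) \<le> f (y + \<delta> *\<^sub>R v) - f (y + \<delta> *\<^sub>R (v - t *\<^sub>R w))"
      by (simp add: algebra_simps)
    then have 1: "f (y + \<delta> *\<^sub>R v) - f (z + \<delta> *\<^sub>R v) \<le> (f (y + \<delta> *\<^sub>R v) - f (y + \<delta> *\<^sub>R (v - t *\<^sub>R w))) / t"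
      using t by (simp add: field_simps)
    have "K * norm (\<delta> *\<^sub>R v) \<le> K * \<delta>"
      using v \<delta> K by (intro mult_left_mono) auto
    then have "\<bar>f (y + \<delta> *\<^sub>R v) - f y\<bar> \<le> K * \<delta>" "\<bar>f (z + \<delta> *\<^sub>R v) - f z\<bar> \<le> K * \<delta>"
      using lipschitz_onD[OF lip X(1,3)] lipschitz_onD[OF lip X(2,4)]
      by (auto simp: dist_norm)
    then show "f y - f z - 2 * K * \<delta> \<le> (f (y + \<delta> *\<^sub>R v) - f (y + \<delta> *\<^sub>R (v - t *\<^sub>R w))) / t"
      using 1 by linarith
  qed
  also have "\<dots> = (\<integral>v. real CARD('d) / \<delta> * f (y + \<delta> *\<^sub>R v) * (v \<bullet> (y - z)) \<partial>unif_sphere)"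
    by (simp add: w_def divide_inverse ac_simps flip: integral_mult_right_zero)
  finally show ?thesis .
qed

lemma lipschitz_on_cvar:
  assumes P: "prob_space P" and \<alpha>: "0 < \<alpha>" "\<alpha> < 1"
    and J: "\<And>z. z \<in> X \<Longrightarrow> J z \<in> borel_measurable P"
    and bd: "\<And>z a. z \<in> X \<Longrightarrow> a \<in> space P \<Longrightarrow> \<bar>J z a\<bar> \<le> U"
    and lip: "\<And>a. a \<in> space P \<Longrightarrow> K-lipschitz_on X (\<lambda>z. J z a)"
  shows "K-lipschitz_on X (\<lambda>z. cvar P \<alpha> (J z))"
proof (rule lipschitz_onI)
  show "0 \<le> K"
    using lipschitz_on_nonneg[OF lip] prob_space.not_empty[OF P] by blast
  show "dist (cvar P \<alpha> (J p)) (cvar P \<alpha> (J p')) \<le> K * dist p p'" if "p \<in> X" "p' \<in> X" for p p'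
    unfolding dist_real_def using lipschitz_onD[OF lip that] that
    by (intro cvar_abs_diff_le[OF P \<alpha> J bd J bd]) (auto simp: dist_real_def)
qed

lemma convex_on_cvar:
  assumes P: "prob_space P" and \<alpha>: "0 < \<alpha>" "\<alpha> < 1" and X: "convex X"
    and J: "\<And>z. z \<in> X \<Longrightarrow> J z \<in> borel_measurable P"
    and bd: "\<And>z a. z \<in> X \<Longrightarrow> a \<in> space P \<Longrightarrow> \<bar>J z a\<bar> \<le> U"
    and conv: "\<And>a. a \<in> space P \<Longrightarrow> convex_on X (\<lambda>z. J z a)"
  shows "convex_on X (\<lambda>z. cvar P \<alpha> (J z))"
proof (rule convex_onI[OF _ X])
  fix t p p' assume t: "0 < t" "t < (1::real)" and p: "p \<in> X" "p' \<in> X"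
  then have "(1 - t) *\<^sub>R p + t *\<^sub>R p' \<in> X"
    using X by (simp add: convex_alt)
  then show "cvar P \<alpha> (J ((1 - t) *\<^sub>R p + t *\<^sub>R p')) \<le> (1 - t) * cvar P \<alpha> (J p) + t * cvar P \<alpha> (J p')"
    using t p conv
    by (intro cvar_convex[OF P \<alpha> _ _ J bd J bd J bd]) (auto simp: convex_on_def)
qed

context prob_space
begin

text \<open>Both marginals are finite, so agreement on rectangles determines the joint law. The
  hypothesis has the form in which conditional laws and \<open>indep_set\<close> deliver
  independence.\<close>

lemma distr_Pair_eq_pair_measure:
  assumes [measurable]: "X \<in> measurable M S" "Y \<in> measurable M T"
    and indep: "\<And>A B. A \<in> sets S \<Longrightarrow> B \<in> sets T \<Longrightarrow>
      prob ((X -` A \<inter> space M) \<inter> (Y -` B \<inter> space M)) = prob (X -` A \<inter> space M) * prob (Y -` B \<inter> space M)"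
  shows "distr M (S \<Otimes>\<^sub>M T) (\<lambda>\<omega>. (X \<omega>, Y \<omega>)) = distr M S X \<Otimes>\<^sub>M distr M T Y"
proof (rule pair_measure_eqI[symmetric])
  interpret S: prob_space "distr M S X" by (rule prob_space_distr) simp
  interpret T: prob_space "distr M T Y" by (rule prob_space_distr) simp
  show "sigma_finite_measure (distr M S X)" "sigma_finite_measure (distr M T Y)" ..
  fix A B assume "A \<in> sets (distr M S X)" "B \<in> sets (distr M T Y)"
  then have [measurable]: "A \<in> sets S" "B \<in> sets T" by auto
  have "(\<lambda>\<omega>. (X \<omega>, Y \<omega>)) -` (A \<times> B) \<inter> space M = (X -` A \<inter> space M) \<inter> (Y -` B \<inter> space M)"
    by auto
  then show "emeasure (distr M S X) A * emeasure (distr M T Y) B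
      = emeasure (distr M (S \<Otimes>\<^sub>M T) (\<lambda>\<omega>. (X \<omega>, Y \<omega>))) (A \<times> B)"
    using indep[of A B] by (simp add: emeasure_distr emeasure_eq_measure ennreal_mult')
qed (simp cong: sets_pair_measure_cong)

text \<open>One agent in one round; \<open>S\<close> stands for the shrunken set. The empirical CVaR
  at the query point is split into the exact one and an error. For the exact part the direction is
  integrated out with the position frozen, which is the smoothing inequality. For the error the
  batch is integrated out with position and direction frozen, and the remaining factor is at most d
  / delta times D.\<close>

lemma expectation_zeroth_order_gradient:
  fixes Y u :: "'a \<Rightarrow> real ^ 'd" and \<Xi> :: "nat \<Rightarrow> 'a \<Rightarrow> 'b" and J :: "real ^ 'd \<Rightarrow> 'b \<Rightarrow> real"
  assumes X: "compact X" "convex X" and P: "prob_space P" and \<alpha>: "0 < \<alpha>" "\<alpha> < 1" and s: "1 \<le> s"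
    and J: "\<And>z. z \<in> X \<Longrightarrow> J z \<in> borel_measurable P"
    and lip: "\<And>a. a \<in> space P \<Longrightarrow> K-lipschitz_on X (\<lambda>z. J z a)"
    and bd: "\<And>z a. z \<in> X \<Longrightarrow> a \<in> space P \<Longrightarrow> \<bar>J z a\<bar> \<le> U"
    and conv: "\<And>a. a \<in> space P \<Longrightarrow> convex_on X (\<lambda>z. J z a)"
    and \<delta>: "0 < \<delta>" and S: "\<And>p v. p \<in> S \<Longrightarrow> norm v \<le> 1 \<Longrightarrow> p + \<delta> *\<^sub>R v \<in> X"
    and D: "\<And>p p'. p \<in> S \<Longrightarrow> p' \<in> S \<Longrightarrow> norm (p - p') \<le> D"
    and Y: "\<And>\<omega>. \<omega> \<in> space M \<Longrightarrow> Y \<omega> \<in> S" and z: "z \<in> S"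
    and Ym [measurable]: "Y \<in> borel_measurable M"
    and um [measurable]: "u \<in> borel_measurable M" and u: "\<And>\<omega>. \<omega> \<in> space M \<Longrightarrow> norm (u \<omega>) = 1"
    and Yu: "distr M (borel \<Otimes>\<^sub>M borel) (\<lambda>\<omega>. (Y \<omega>, u \<omega>)) = distr M borel Y \<Otimes>\<^sub>M unif_sphere"
    and \<Xi>m [measurable]: "\<And>j. j \<in> {1..s} \<Longrightarrow> \<Xi> j \<in> measurable M P"
    and batch: "distr M (PiM {1..s} (\<lambda>_. P) \<Otimes>\<^sub>M (borel \<Otimes>\<^sub>M borel))
        (\<lambda>\<omega>. (\<lambda>j\<in>{1..s}. \<Xi> j \<omega>, (Y \<omega>, u \<omega>)))
      = PiM {1..s} (\<lambda>_. P) \<Otimes>\<^sub>M distr M (borel \<Otimes>\<^sub>M borel) (\<lambda>\<omega>. (Y \<omega>, u \<omega>))"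
  shows "expectation (\<lambda>\<omega>. cvar P \<alpha> (J (Y \<omega>))) - cvar P \<alpha> (J z) - 2 * K * \<delta>
      - real CARD('d) * D * U / (\<delta> * \<alpha> * sqrt (real s))
    \<le> expectation (\<lambda>\<omega>. (real CARD('d) / \<delta> *
        emp_cvar \<alpha> s (\<lambda>j. J (Y \<omega> + \<delta> *\<^sub>R u \<omega>) (\<Xi> j \<omega>))) *\<^sub>R u \<omega> \<bullet> (Y \<omega> - z))"
proof -
  interpret P: prob_space P by (rule P)
  obtain a where a: "a \<in> space P" using P.not_empty by auto
  have K: "0 \<le> K" using lip[OF a] by (rule lipschitz_on_nonneg)
  have zX: "z \<in> X" using S[OF z, of 0] by simp
  have U: "0 \<le> U" using bd[OF zX a] by linarith
  have D0: "0 \<le> D" using D[OF z z] by simp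
  have closed: "closed X" using X by (simp add: compact_imp_closed)
  have Xb [measurable]: "X \<in> sets borel" using closed by auto
  have \<Xi>s: "\<Xi> j \<omega> \<in> space P" if "j \<in> {1..s}" "\<omega> \<in> space M" for j \<omega>
    using \<Xi>m[OF that(1)] that(2) by (rule measurable_space)
  have YX: "Y \<omega> \<in> X" if "\<omega> \<in> space M" for \<omega>
    using S[OF Y[OF that], of 0] by simp
  have uX: "Y \<omega> + \<delta> *\<^sub>R u \<omega> \<in> X" if "\<omega> \<in> space M" for \<omega>
    using S[OF Y[OF that]] u[OF that] by simp

  \<comment> \<open>Extending by 0 off \<open>X\<close> gives a bounded Borel function on the whole
    space, as smoothing and Fubini require. Convexity and the Lipschitz property are claimed on
    \<open>X\<close> alone.\<close>
  define C where "C v = (if v \<in> X then cvar P \<alpha> (J v) else 0)" for v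
  have CX: "C v = cvar P \<alpha> (J v)" if "v \<in> X" for v using that by (simp add: C_def)
  have Cb: "\<bar>C v\<bar> \<le> U" for v
    using cvar_abs_le[OF P \<alpha> J[of v] bd[of v]] U by (auto simp: C_def)
  have Clip: "K-lipschitz_on X C"
    by (rule lipschitz_on_transform[OF lipschitz_on_cvar[OF P \<alpha> J bd lip]]) (auto simp: CX)
  have Cconv: "convex_on X C"
  proof (rule convex_onI[OF _ X(2)])
    fix t p p' assume t: "0 < t" "t < (1::real)" and p: "p \<in> X" "p' \<in> X"
    then have "(1 - t) *\<^sub>R p + t *\<^sub>R p' \<in> X"
      using X(2) by (simp add: convex_alt)
    then show "C ((1 - t) *\<^sub>R p + t *\<^sub>R p') \<le> (1 - t) * C p + t * C p'"
      using convex_onD[OF convex_on_cvar[OF P \<alpha> X(2) J bd conv], of t p p'] t p by (simp add: CX)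
  qed
  have Cm [measurable]: "C \<in> borel_measurable borel"
  proof -
    have eq: "C = (\<lambda>v. if v \<in> X then C v else 0)"
      by (auto simp: C_def)
    show ?thesis
      by (subst eq) (intro borel_measurable_continuous_on_if lipschitz_on_continuous_on[OF Clip]
          continuous_on_const Xb)
  qed

  define J' where "J' v a = (if v \<in> X then J v a else 0)" for v a
  have J'm: "(\<lambda>\<omega>. J' (f \<omega>) (g \<omega>)) \<in> borel_measurable N"
    if [measurable]: "f \<in> borel_measurable N" "g \<in> measurable N P" for f g and N :: "'n measure"
  proof -
    \<comment> \<open>The inner conditional redirects points off \<open>X\<close> to
      \<open>z\<close>, because the composition lemma wants its argument in \<open>X\<close>
      everywhere.\<close>
    have "(\<lambda>\<omega>. if f \<omega> \<in> X then J (if f \<omega> \<in> X then f \<omega> else z) (g \<omega>) else 0) \<in> borel_measurable N"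
      using zX by (intro measurable_If borel_measurable_lipschitz_compose[OF J lip]) auto
    then show ?thesis by (simp add: J'_def cong: if_cong)
  qed
  define c where "c = real CARD('d) / \<delta>"
  have c: "0 \<le> c" using \<delta> by (simp add: c_def)
  define e where "e \<omega> = emp_cvar \<alpha> s (\<lambda>j. J (Y \<omega> + \<delta> *\<^sub>R u \<omega>) (\<Xi> j \<omega>))" for \<omega>
  \<comment> \<open>The estimate as a function of the batch and of the pair (position, direction)
    separately, so that the product law \<open>batch\<close> can be applied to it.\<close>
  define e' where "e' w q = emp_cvar \<alpha> s (\<lambda>j. J' (fst q + \<delta> *\<^sub>R snd q) (w j))" for w q
  have e': "e \<omega> = e' (\<lambda>j\<in>{1..s}. \<Xi> j \<omega>) (Y \<omega>, u \<omega>)" if "\<omega> \<in> space M" for \<omega>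
    unfolding e_def e'_def using uX[OF that] by (intro emp_cvar_cong) (simp add: J'_def)
  let ?PP = "PiM {1..s} (\<lambda>_. P)"
  have e'm [measurable]: "case_prod e' \<in> borel_measurable (?PP \<Otimes>\<^sub>M (borel \<Otimes>\<^sub>M borel))"
    unfolding e'_def split_beta'
    by (rule borel_measurable_emp_cvar[OF \<alpha> s], rule J'm) measurable
  have em [measurable]: "e \<in> borel_measurable M"
  proof -
    have "(\<lambda>\<omega>. case_prod e' (\<lambda>j\<in>{1..s}. \<Xi> j \<omega>, (Y \<omega>, u \<omega>))) \<in> borel_measurable M"
      by (rule measurable_compose[OF _ e'm]) measurable
    then show ?thesis by (subst measurable_cong[OF e']) auto
  qed
  have eb: "\<bar>e \<omega>\<bar> \<le> U" if "\<omega> \<in> space M" for \<omega>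
    unfolding e_def using \<Xi>s uX that by (intro emp_cvar_abs_le[OF s \<alpha> bd]) auto
  have ub: "\<bar>u \<omega> \<bullet> (Y \<omega> - z)\<bar> \<le> D" if "\<omega> \<in> space M" for \<omega>
    using Cauchy_Schwarz_ineq2[of "u \<omega>" "Y \<omega> - z"] D[OF Y[OF that] z] u[OF that] by simp
  let ?w = "\<lambda>\<omega>. u \<omega> \<bullet> (Y \<omega> - z)" and ?Cu = "\<lambda>\<omega>. C (Y \<omega> + \<delta> *\<^sub>R u \<omega>)"

  have bias: "expectation (\<lambda>\<omega>. \<bar>e \<omega> - ?Cu \<omega>\<bar>) \<le> U / (\<alpha> * sqrt (real s))"
  proof -
    let ?Q = "distr M (borel \<Otimes>\<^sub>M borel) (\<lambda>\<omega>. (Y \<omega>, u \<omega>))"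
    let ?f = "\<lambda>(w, q). \<bar>e' w q - C (fst q + \<delta> *\<^sub>R snd q)\<bar>"
    interpret PP: prob_space ?PP by (rule prob_space_PiM) (rule P)
    interpret Q: prob_space ?Q by (rule prob_space_distr) measurable
    interpret PQ: pair_prob_space ?PP ?Q ..
    have fm: "?f \<in> borel_measurable (?PP \<Otimes>\<^sub>M (borel \<Otimes>\<^sub>M borel))"
    proof -
      have "(\<lambda>x. \<bar>case_prod e' x - C (fst (snd x) + \<delta> *\<^sub>R snd (snd x))\<bar>)
          \<in> borel_measurable (?PP \<Otimes>\<^sub>M (borel \<Otimes>\<^sub>M borel))"
        by measurable
      then show ?thesis by (simp add: split_beta')
    qed
    have fm': "?f \<in> borel_measurable (?PP \<Otimes>\<^sub>M ?Q)"
      using fm by (simp cong: measurable_cong_sets sets_pair_measure_cong)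
    have int: "integrable (?PP \<Otimes>\<^sub>M ?Q) ?f"
    proof -
      have "integrable M (\<lambda>\<omega>. ?f (\<lambda>j\<in>{1..s}. \<Xi> j \<omega>, (Y \<omega>, u \<omega>)))"
      proof (rule integrable_const_bound[of _ "U + U"])
        show "AE \<omega> in M. norm (?f (\<lambda>j\<in>{1..s}. \<Xi> j \<omega>, (Y \<omega>, u \<omega>))) \<le> U + U"
        proof (rule AE_I2)
          fix \<omega> assume "\<omega> \<in> space M"
          then show "norm (?f (\<lambda>j\<in>{1..s}. \<Xi> j \<omega>, (Y \<omega>, u \<omega>))) \<le> U + U"
            using eb[of \<omega>] Cb[of "Y \<omega> + \<delta> *\<^sub>R u \<omega>"] e'[of \<omega>] by simp
        qed
      qed (rule measurable_compose[OF _ fm], measurable)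
      then show ?thesis
        unfolding batch[symmetric] by (subst integrable_distr_eq) (use fm in \<open>auto\<close>)
    qed
    have "expectation (\<lambda>\<omega>. \<bar>e \<omega> - ?Cu \<omega>\<bar>) = expectation (\<lambda>\<omega>. ?f (\<lambda>j\<in>{1..s}. \<Xi> j \<omega>, (Y \<omega>, u \<omega>)))"
      by (intro Bochner_Integration.integral_cong) (auto simp: e')
    also have "\<dots> = (\<integral>x. ?f x \<partial>(?PP \<Otimes>\<^sub>M ?Q))"
      unfolding batch[symmetric] by (subst integral_distr) (use fm in auto)
    also have "\<dots> = (\<integral>q. (\<integral>w. ?f (w, q) \<partial>?PP) \<partial>?Q)"
      using PQ.integral_snd[OF int] by simp
    also have "\<dots> \<le> (\<integral>q. U / (\<alpha> * sqrt (real s)) \<partial>?Q)"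
    proof (rule integral_mono_AE)
      show "integrable ?Q (\<lambda>q. \<integral>w. ?f (w, q) \<partial>?PP)"
        using PQ.integrable_snd[OF int] by simp
      \<comment> \<open>The deviation estimate needs the query point in \<open>X\<close>. Under the
        law of (Y, u) that holds almost surely only, hence the comparison of integrals almost
        everywhere.\<close>
      have "(\<integral>w. ?f (w, q) \<partial>?PP) \<le> U / (\<alpha> * sqrt (real s))"
        if q: "fst q + \<delta> *\<^sub>R snd q \<in> X" for q
      proof -
        let ?v = "fst q + \<delta> *\<^sub>R snd q"
        have "(\<integral>w. ?f (w, q) \<partial>?PP) = PP.expectation (\<lambda>w. \<bar>emp_cvar \<alpha> s (\<lambda>j. J ?v (w j)) - cvar P \<alpha> (J ?v)\<bar>)"
          using q by (simp add: e'_def J'_def CX)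
        also have "\<dots> \<le> U / (\<alpha> * sqrt (real s))"
        proof (rule PP.expectation_emp_cvar_deviation[OF \<alpha> s P _ _ J[OF q] bd[OF q]])
          show dj: "distr ?PP P (\<lambda>w. w j) = P" if "j \<in> {1..s}" for j
            using distr_PiM_component[of "{1..s}" "\<lambda>_. P" j] P that by simp
          \<comment> \<open>The coordinates taken jointly form the identity of the product space, so
            their joint law is the product measure itself.\<close>
          show "PP.indep_vars (\<lambda>_. P) (\<lambda>j w. w j) {1..s}"
          proof (subst PP.indep_vars_iff_distr_eq_PiM')
            have "distr ?PP ?PP (\<lambda>w. \<lambda>j\<in>{1..s}. w j) = distr ?PP ?PP (\<lambda>w. w)"
              by (intro distr_cong) (auto simp: space_PiM)
            also have "\<dots> = PiM {1..s} (\<lambda>j. distr ?PP P (\<lambda>w. w j))"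
              using dj by (auto simp: distr_id2 intro!: PiM_cong)
            finally show "distr ?PP ?PP (\<lambda>w. \<lambda>j\<in>{1..s}. w j) = PiM {1..s} (\<lambda>j. distr ?PP P (\<lambda>w. w j))" .
          qed (use s in auto)
        qed
        finally show ?thesis .
      qed
      moreover have "AE q in ?Q. fst q + \<delta> *\<^sub>R snd q \<in> X"
        using uX by (subst AE_distr_iff) auto
      ultimately show "AE q in ?Q. (\<integral>w. ?f (w, q) \<partial>?PP) \<le> U / (\<alpha> * sqrt (real s))"
        by (auto elim!: AE_mp)
    qed simp
    also have "\<dots> = U / (\<alpha> * sqrt (real s))"
      using Q.prob_space by simp
    finally show ?thesis .
  qed

  have smooth: "expectation (\<lambda>\<omega>. C (Y \<omega>)) - C z - 2 * K * \<delta> \<le> expectation (\<lambda>\<omega>. c * ?Cu \<omega> * ?w \<omega>)"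
  proof -
    let ?Q = "distr M borel Y"
    let ?H = "\<lambda>x. c * C (fst x + \<delta> *\<^sub>R snd x) * (snd x \<bullet> (fst x - z))"
    interpret Q: prob_space ?Q by (rule prob_space_distr) measurable
    interpret S: prob_space "unif_sphere :: (real ^ 'd) measure" by (rule prob_space_unif_sphere)
    interpret QS: pair_prob_space ?Q "unif_sphere :: (real ^ 'd) measure" ..
    have Hm: "?H \<in> borel_measurable (borel \<Otimes>\<^sub>M borel)" by measurable
    have intM: "integrable M (\<lambda>\<omega>. ?H (Y \<omega>, u \<omega>))"
    proof (rule integrable_const_bound[of _ "c * U * D"])
      show "AE \<omega> in M. norm (?H (Y \<omega>, u \<omega>)) \<le> c * U * D"
        unfolding real_norm_def abs_mult fst_conv snd_conv using c U ub Cb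
        by (intro AE_I2 mult_mono) auto
    qed (rule measurable_compose[OF _ Hm], measurable)
    then have int: "integrable (?Q \<Otimes>\<^sub>M unif_sphere) ?H"
      unfolding Yu[symmetric] by (subst integrable_distr_eq) (use Hm in auto)
    have intY: "integrable M (\<lambda>\<omega>. \<integral>v. ?H (Y \<omega>, v) \<partial>unif_sphere)"
      using QS.integrable_fst'[OF int] by (subst (asm) integrable_distr_eq) auto
    have iC: "integrable M (\<lambda>\<omega>. C (Y \<omega>))"
      by (rule integrable_const_bound[of _ U]) (use Cb in auto)
    have "expectation (\<lambda>\<omega>. C (Y \<omega>)) - C z - 2 * K * \<delta> = expectation (\<lambda>\<omega>. C (Y \<omega>) - C z - 2 * K * \<delta>)"
      using iC by (simp add: prob_space)
    also have "\<dots> \<le> expectation (\<lambda>\<omega>. \<integral>v. ?H (Y \<omega>, v) \<partial>unif_sphere)"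
    proof (rule integral_mono[OF _ intY])
      fix \<omega> assume "\<omega> \<in> space M"
      then have "Y \<omega> \<in> S" by (rule Y)
      then show "C (Y \<omega>) - C z - 2 * K * \<delta> \<le> (\<integral>v. ?H (Y \<omega>, v) \<partial>unif_sphere)"
        using unif_sphere_gradient_ineq[OF Cm Cb Cconv Clip \<delta> S S[OF z]] by (simp add: c_def)
    qed (use iC in auto)
    also have "\<dots> = (\<integral>p. (\<integral>v. ?H (p, v) \<partial>unif_sphere) \<partial>?Q)"
      using QS.integrable_fst'[OF int] by (subst integral_distr) auto
    also have "\<dots> = (\<integral>x. ?H x \<partial>(?Q \<Otimes>\<^sub>M unif_sphere))"
      by (rule QS.integral_fst'[OF int])
    also have "\<dots> = expectation (\<lambda>\<omega>. ?H (Y \<omega>, u \<omega>))"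
      unfolding Yu[symmetric] by (subst integral_distr) (use Hm in auto)
    finally show ?thesis by simp
  qed

  have i1: "integrable M (\<lambda>\<omega>. c * ?Cu \<omega> * ?w \<omega>)" and i2: "integrable M (\<lambda>\<omega>. c * e \<omega> * ?w \<omega>)"
    using c U ub Cb eb
    by (auto intro!: integrable_const_bound[of _ "c * U * D"] AE_I2 mult_mono simp: abs_mult)
  have i3: "integrable M (\<lambda>\<omega>. \<bar>e \<omega> - ?Cu \<omega>\<bar>)"
  proof (rule integrable_const_bound[of _ "U + U"])
    show "AE \<omega> in M. norm \<bar>e \<omega> - ?Cu \<omega>\<bar> \<le> U + U"
    proof (rule AE_I2)
      fix \<omega> assume "\<omega> \<in> space M"
      then show "norm \<bar>e \<omega> - ?Cu \<omega>\<bar> \<le> U + U"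
        using eb[of \<omega>] Cb[of "Y \<omega> + \<delta> *\<^sub>R u \<omega>"] by simp
    qed
  qed measurable
  have "expectation (\<lambda>\<omega>. c * ?Cu \<omega> * ?w \<omega>) - expectation (\<lambda>\<omega>. c * e \<omega> * ?w \<omega>)
      = expectation (\<lambda>\<omega>. c * ?Cu \<omega> * ?w \<omega> - c * e \<omega> * ?w \<omega>)"
    using i1 i2 by simp
  also have "\<dots> \<le> expectation (\<lambda>\<omega>. c * D * \<bar>e \<omega> - ?Cu \<omega>\<bar>)"
  proof (rule integral_mono)
    fix \<omega> assume \<omega>: "\<omega> \<in> space M"
    have "c * ?Cu \<omega> * ?w \<omega> - c * e \<omega> * ?w \<omega> = c * ((?Cu \<omega> - e \<omega>) * ?w \<omega>)"
      by (simp add: algebra_simps)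
    also have "\<dots> \<le> c * \<bar>(?Cu \<omega> - e \<omega>) * ?w \<omega>\<bar>"
      using c by (intro mult_left_mono) auto
    also have "\<dots> \<le> c * (\<bar>?Cu \<omega> - e \<omega>\<bar> * D)"
      unfolding abs_mult using c ub[OF \<omega>] by (intro mult_left_mono) auto
    finally show "c * ?Cu \<omega> * ?w \<omega> - c * e \<omega> * ?w \<omega> \<le> c * D * \<bar>e \<omega> - ?Cu \<omega>\<bar>"
      by (simp add: abs_minus_commute ac_simps)
  qed (use i1 i2 i3 in auto)
  also have "\<dots> \<le> c * D * (U / (\<alpha> * sqrt (real s)))"
    using mult_left_mono[OF bias, of "c * D"] c D0 by simp
  also have "\<dots> = real CARD('d) * D * U / (\<delta> * \<alpha> * sqrt (real s))"
    by (simp add: c_def)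
  finally have "expectation (\<lambda>\<omega>. C (Y \<omega>)) - C z - 2 * K * \<delta>
      - real CARD('d) * D * U / (\<delta> * \<alpha> * sqrt (real s)) \<le> expectation (\<lambda>\<omega>. c * e \<omega> * ?w \<omega>)"
    using smooth by linarith
  moreover have "expectation (\<lambda>\<omega>. C (Y \<omega>)) = expectation (\<lambda>\<omega>. cvar P \<alpha> (J (Y \<omega>)))"
    using YX by (intro Bochner_Integration.integral_cong) (auto simp: CX)
  ultimately show ?thesis
    using CX[OF zX] by (simp add: c_def e_def inner_scaleR_left)
qed

end

subsection \<open>Convergence of the iteration\<close>

text \<open>The convexity defect is exactly t (1 - t) |a - b|^2.\<close>

lemma convex_on_norm_diff_power2:
  fixes z :: "'a::real_inner"
  shows "convex_on UNIV (\<lambda>v. (norm (v - z))\<^sup>2)"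
proof (rule convex_onI)
  fix t and a b :: 'a assume t: "0 < t" "t < (1::real)"
  have "(1 - t) * (norm (a - z))\<^sup>2 + t * (norm (b - z))\<^sup>2 - (norm ((1 - t) *\<^sub>R a + t *\<^sub>R b - z))\<^sup>2
      = t * (1 - t) * (norm (a - b))\<^sup>2"
    by (simp add: power2_norm_eq_inner inner_diff_left inner_diff_right inner_add_left
        inner_add_right inner_commute algebra_simps)
  moreover have "0 \<le> t * (1 - t) * (norm (a - b))\<^sup>2"
    using t by simp
  ultimately show "(norm ((1 - t) *\<^sub>R a + t *\<^sub>R b - z))\<^sup>2
      \<le> (1 - t) * (norm (a - z))\<^sup>2 + t * (norm (b - z))\<^sup>2"
    by linarith
qed simp

text \<open>Jensen in each row uses that rows sum to 1; after exchanging the sums, the columns do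
  the rest. It serves twice: with the squared distance to a fixed point, and with the distance to
  the average.\<close>

lemma doubly_stochastic_sum_convex_le:
  fixes v :: "nat \<Rightarrow> 'a::real_vector"
  assumes W: "doubly_stochastic m W" and m: "1 \<le> m" and f: "convex_on UNIV f"
  shows "(\<Sum>i=1..m. f (\<Sum>j=1..m. W i j *\<^sub>R v j)) \<le> (\<Sum>j=1..m. f (v j))"
proof -
  have "(\<Sum>i=1..m. f (\<Sum>j=1..m. W i j *\<^sub>R v j)) \<le> (\<Sum>i=1..m. \<Sum>j=1..m. W i j * f (v j))"
    using W m unfolding doubly_stochastic_def by (intro sum_mono convex_on_sum[OF _ _ f]) auto
  also have "\<dots> = (\<Sum>j=1..m. (\<Sum>i=1..m. W i j) * f (v j))"
    by (subst sum.swap) (simp add: sum_distrib_right)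
  also have "\<dots> = (\<Sum>j=1..m. f (v j))"
    using W unfolding doubly_stochastic_def by (intro sum.cong) auto
  finally show ?thesis .
qed

text \<open>Deterministic bookkeeping. In its use, \<open>a k\<close> is the expected sum of squared
  distances to the comparison point, \<open>e k\<close> the expected objective at the average,
  \<open>n k\<close> the expected disagreement and \<open>c\<close> the objective at the comparison
  point. The last distance is dropped as nonnegative, and the rest is divided by 2 m H.\<close>

lemma descent_telescope:
  fixes \<eta> a e n :: "nat \<Rightarrow> real" and H :: real
  assumes \<eta>: "\<And>k. 0 < \<eta> k" and T: "1 \<le> (T::nat)" and m: "0 < m"
    and a0: "a 0 \<le> m * A" and aT: "0 \<le> a T"
    and step: "\<And>k. a (Suc k) \<le> a k - 2 * \<eta> k * (m * (e k - c) - K * n k - m * D) + m * (\<eta> k)\<^sup>2 * G"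
  defines "H \<equiv> \<Sum>k<T. \<eta> k"
  shows "(\<Sum>k<T. \<eta> k * e k) / H - c \<le>
    A / (2 * H) + G * ((\<Sum>k<T. (\<eta> k)\<^sup>2) / (2 * H)) + K / m * ((\<Sum>k<T. \<eta> k * n k) / H) + D"
proof -
  have H: "0 < H"
    unfolding H_def using T \<eta> by (intro sum_pos) (auto simp: lessThan_empty_iff)
  have "a t \<le> a 0 - (\<Sum>k<t. 2 * \<eta> k * (m * (e k - c) - K * n k - m * D)) + (\<Sum>k<t. m * (\<eta> k)\<^sup>2 * G)" for t
  proof (induction t)
    case (Suc t)
    then show ?case using step[of t] by simp
  qed simp
  from this[of T] have "(\<Sum>k<T. 2 * \<eta> k * (m * (e k - c) - K * n k - m * D))
      \<le> m * A + (\<Sum>k<T. m * (\<eta> k)\<^sup>2 * G)"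
    using a0 aT by linarith
  also have "(\<Sum>k<T. m * (\<eta> k)\<^sup>2 * G) = m * G * (\<Sum>k<T. (\<eta> k)\<^sup>2)"
    by (simp add: sum_distrib_left ac_simps)
  also have "(\<Sum>k<T. 2 * \<eta> k * (m * (e k - c) - K * n k - m * D))
      = 2 * (m * (\<Sum>k<T. \<eta> k * e k) - m * c * H - K * (\<Sum>k<T. \<eta> k * n k) - m * D * H)"
    by (simp add: H_def sum_distrib_left sum_distrib_right sum_subtractf sum.distrib algebra_simps)
  finally have "0 \<le> (m * A + m * G * (\<Sum>k<T. (\<eta> k)\<^sup>2)
      - 2 * (m * (\<Sum>k<T. \<eta> k * e k) - m * c * H - K * (\<Sum>k<T. \<eta> k * n k) - m * D * H)) / (2 * m * H)"
    using H m by simp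
  also have "\<dots> = A / (2 * H) + G * ((\<Sum>k<T. (\<eta> k)\<^sup>2) / (2 * H)) + K / m * ((\<Sum>k<T. \<eta> k * n k) / H) + D
      - ((\<Sum>k<T. \<eta> k * e k) / H - c)"
    using H m by (simp add: field_simps)
  finally show ?thesis by simp
qed

text \<open>Continuity is known on \<open>X\<close> only, so \<open>f\<close> is first extended by
  0; compactness supplies the bound and makes \<open>X\<close> a Borel set.\<close>

lemma (in prob_space) integrable_continuous_compose:
  fixes f :: "'b::euclidean_space \<Rightarrow> real"
  assumes f: "continuous_on X f" and X: "compact X"
    and g: "g \<in> borel_measurable M" "\<And>\<omega>. \<omega> \<in> space M \<Longrightarrow> g \<omega> \<in> X"
  shows "integrable M (\<lambda>\<omega>. f (g \<omega>))"
proof -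
  obtain B where B: "\<And>v. v \<in> X \<Longrightarrow> norm (f v) \<le> B"
    using compact_imp_bounded[OF compact_continuous_image[OF f X]] by (auto simp: bounded_iff)
  have "(\<lambda>v. if v \<in> X then f v else 0) \<in> borel_measurable borel"
    using X by (intro borel_measurable_continuous_on_if f continuous_on_const) (auto intro: borel_closed compact_imp_closed)
  from measurable_compose[OF g(1) this] have "(\<lambda>\<omega>. f (g \<omega>)) \<in> borel_measurable M"
    by (subst measurable_cong[where g="\<lambda>\<omega>. if g \<omega> \<in> X then f (g \<omega>) else 0"]) (auto simp: g(2))
  then show ?thesis
    using B g(2) by (intro integrable_const_bound[of _ B]) auto
qed

text \<open>\<open>G\<close> may contain more than the preimages of \<open>X\<close>, so that one
  generator serves all the variables of a history.\<close>

lemma measurable_sigma_preimages: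
  assumes "preimages M N X \<subseteq> G" "G \<subseteq> Pow (space M)" "X \<in> space M \<rightarrow> space N"
  shows "X \<in> measurable (sigma (space M) G) N"
proof (rule measurableI)
  fix A assume "A \<in> sets N"
  then have "X -` A \<inter> space M \<in> G" using assms(1) by (auto simp: preimages_def)
  then show "X -` A \<inter> space (sigma (space M) G) \<in> sets (sigma (space M) G)"
    using assms(2) by (auto simp: space_measure_of sets_measure_of intro: sigma_sets.Basic)
qed (use assms in \<open>auto simp: space_measure_of\<close>)

lemma preimages_subset_sets: "X \<in> measurable M N \<Longrightarrow> preimages M N X \<subseteq> sets M"
  by (auto simp: preimages_def measurable_sets)

theorem theorem1:
  fixes M :: "'o measure"
    and m :: nat and X :: "(real ^ 'd) set" and r :: real
    and P :: "nat \<Rightarrow> 'b measure" and J :: "nat \<Rightarrow> real ^ 'd \<Rightarrow> 'b \<Rightarrow> real"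
    and \<alpha> L U :: "nat \<Rightarrow> real"
    and E :: "nat \<Rightarrow> (nat \<times> nat) set" and W :: "nat \<Rightarrow> nat \<Rightarrow> nat \<Rightarrow> real"
    and q :: nat and \<rho> :: real
    and \<delta> :: "nat \<Rightarrow> real" and \<delta>max :: real and X\<delta> :: "(real ^ 'd) set"
    and \<eta> :: "nat \<Rightarrow> real" and s :: "nat \<Rightarrow> nat \<Rightarrow> nat" and es :: real
    and u :: "nat \<Rightarrow> nat \<Rightarrow> 'o \<Rightarrow> real ^ 'd" and \<xi> :: "nat \<Rightarrow> nat \<Rightarrow> nat \<Rightarrow> 'o \<Rightarrow> 'b"
    and x y yhat ghat :: "nat \<Rightarrow> nat \<Rightarrow> 'o \<Rightarrow> real ^ 'd"
    and C :: "real ^ 'd \<Rightarrow> real" and F :: "nat \<Rightarrow> 'o measure"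
    and xbar xhat :: "nat \<Rightarrow> 'o \<Rightarrow> real ^ 'd" and xstar :: "real ^ 'd"
    and Lmax Gmax D1 D2 :: real and T :: nat
  assumes m: "1 \<le> m"
    \<comment> \<open>feasible set\<close>
    and X: "X \<noteq> {}" "compact X" "convex X"
    and r: "0 < r" "cball 0 r \<subseteq> X"
    \<comment> \<open>risk-averse objective\<close>
    and P: "\<And>i. i \<in> {1..m} \<Longrightarrow> prob_space (P i)"
    and J_measurable: "\<And>i z. i \<in> {1..m} \<Longrightarrow> z \<in> X \<Longrightarrow> J i z \<in> borel_measurable (P i)"
    and \<alpha>: "\<And>i. i \<in> {1..m} \<Longrightarrow> 0 < \<alpha> i \<and> \<alpha> i < 1"
    and C: "\<And>z. C z = 1 / real m * (\<Sum>i=1..m. cvar (P i) (\<alpha> i) (J i z))"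
    \<comment> \<open>(L1)\<close>
    and lipschitz: "\<And>i a. i \<in> {1..m} \<Longrightarrow> a \<in> space (P i) \<Longrightarrow> (L i)-lipschitz_on X (\<lambda>z. J i z a)"
    and U_pos: "\<And>i. i \<in> {1..m} \<Longrightarrow> 0 < U i"
    and bounded: "\<And>i z a. i \<in> {1..m} \<Longrightarrow> z \<in> X \<Longrightarrow> a \<in> space (P i) \<Longrightarrow> \<bar>J i z a\<bar> \<le> U i"
    \<comment> \<open>(L2)\<close>
    and convex: "\<And>i a. i \<in> {1..m} \<Longrightarrow> a \<in> space (P i) \<Longrightarrow> convex_on X (\<lambda>z. J i z a)"
    \<comment> \<open>undirected graphs on the vertex set {1..m}, and (G1)\<close>
    and graph: "\<And>k. E k \<subseteq> {1..m} \<times> {1..m} \<and> sym (E k)"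
    and q: "1 \<le> q" "\<And>k. connected_graph {1..m} (\<Union>l\<in>{1..q}. E (k + l))"
    \<comment> \<open>(G2)\<close>
    and W_stochastic: "\<And>k. doubly_stochastic m (W k)"
    and W_zero: "\<And>k i j. i \<in> {1..m} \<Longrightarrow> j \<in> {1..m} \<Longrightarrow> j \<notin> nbhd (E k) i \<Longrightarrow> W k i j = 0"
    and W_diag: "\<And>k i. i \<in> {1..m} \<Longrightarrow> 0 < W k i i"
    and \<rho>: "0 < \<rho>" "\<And>k i j. i \<in> {1..m} \<Longrightarrow> j \<in> nbhd (E k) i \<Longrightarrow> \<rho> \<le> W k i j"
    \<comment> \<open>parameters of the algorithm, and (S)\<close>
    and \<delta>: "\<And>i. i \<in> {1..m} \<Longrightarrow> 0 < \<delta> i"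
    and \<delta>max: "\<delta>max = (MAX i\<in>{1..m}. \<delta> i)" "\<delta>max < r"
    and X\<delta>: "X\<delta> = {z. z /\<^sub>R (1 - \<delta>max / r) \<in> X}"
    and \<eta>: "\<And>k. 0 < \<eta> k"
    and s: "\<And>k i. i \<in> {1..m} \<Longrightarrow> 1 \<le> s k i"
    and es: "0 < es" "\<And>k. (\<Sum>i=1..m. 1 / (real m * sqrt (real (s k i)))) \<le> es"
    \<comment> \<open>random variables driving the algorithm\<close>
    and M: "prob_space M"
    and x0: "\<And>i. i \<in> {1..m} \<Longrightarrow> x 0 i \<in> borel_measurable M"
      "\<And>i \<omega>. i \<in> {1..m} \<Longrightarrow> \<omega> \<in> space M \<Longrightarrow> x 0 i \<omega> \<in> X\<delta>"
    and u: "\<And>k i. i \<in> {1..m} \<Longrightarrow> u k i \<in> borel_measurable M"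
      "\<And>k i \<omega>. i \<in> {1..m} \<Longrightarrow> \<omega> \<in> space M \<Longrightarrow> u k i \<omega> \<in> sphere 0 1"
    and \<xi>_indep: "\<And>i. i \<in> {1..m} \<Longrightarrow>
      prob_space.indep_vars M (\<lambda>_. P i) (\<lambda>(k, j). \<xi> k i j) {(k, j). j \<in> {1..s k i}}"
    and \<xi>_distr: "\<And>k i j. i \<in> {1..m} \<Longrightarrow> j \<in> {1..s k i} \<Longrightarrow> distr M (P i) (\<xi> k i j) = P i"
    and F: "\<And>k. F k = history M m P s (x 0) u \<xi> k"
    \<comment> \<open>given F k, the directions of round k are independent and uniform on the sphere\<close>
    and u_cond: "\<And>k A. (\<And>i. i \<in> {1..m} \<Longrightarrow> A i \<in> sets borel) \<Longrightarrow>
      AE \<omega> in M. real_cond_exp M (F k) (indicator {\<omega> \<in> space M. \<forall>i\<in>{1..m}. u k i \<omega> \<in> A i}) \<omega> =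
        (\<Prod>i=1..m. measure unif_sphere (A i))"
    \<comment> \<open>each batch of round k is independent of F k joined with the directions of round k\<close>
    and \<xi>_batch: "\<And>k i. i \<in> {1..m} \<Longrightarrow> prob_space.indep_set M
      (sigma_sets (space M) (\<Union>j\<in>{1..s k i}. preimages M (P i) (\<xi> k i j)))
      (sigma_sets (space M) (sets (F k) \<union> (\<Union>l\<in>{1..m}. preimages M borel (u k l))))"
    \<comment> \<open>the algorithm\<close>
    and y: "\<And>k i \<omega>. i \<in> {1..m} \<Longrightarrow> \<omega> \<in> space M \<Longrightarrow>
      y k i \<omega> = (\<Sum>j\<in>nbhd (E k) i. W k i j *\<^sub>R x k j \<omega>)"
    and yhat: "\<And>k i \<omega>. i \<in> {1..m} \<Longrightarrow> \<omega> \<in> space M \<Longrightarrow>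
      yhat k i \<omega> = y k i \<omega> + \<delta> i *\<^sub>R u k i \<omega>"
    and ghat: "\<And>k i \<omega>. i \<in> {1..m} \<Longrightarrow> \<omega> \<in> space M \<Longrightarrow>
      ghat k i \<omega> = (real CARD('d) / \<delta> i *
        emp_cvar (\<alpha> i) (s k i) (\<lambda>j. J i (yhat k i \<omega>) (\<xi> k i j \<omega>))) *\<^sub>R u k i \<omega>"
    and x: "\<And>k i \<omega>. i \<in> {1..m} \<Longrightarrow> \<omega> \<in> space M \<Longrightarrow>
      x (Suc k) i \<omega> = closest_point X\<delta> (y k i \<omega> - \<eta> k *\<^sub>R ghat k i \<omega>)"
    \<comment> \<open>minimizer, averages and constants\<close>
    and xstar: "is_arg_min C (\<lambda>z. z \<in> X) xstar"
    and xbar: "\<And>k \<omega>. xbar k \<omega> = (1 / real m) *\<^sub>R (\<Sum>i=1..m. x k i \<omega>)"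
    and xhat: "\<And>N \<omega>. xhat N \<omega> = (1 / (\<Sum>k<N. \<eta> k)) *\<^sub>R (\<Sum>k<N. \<eta> k *\<^sub>R xbar k \<omega>)"
    and Lmax: "Lmax = (MAX i\<in>{1..m}. L i)"
    and Gmax: "Gmax = (MAX i\<in>{1..m}. real CARD('d) * U i / \<delta> i)"
    and D1: "D1 = 2 * Lmax * \<delta>max +
      sqrt (2 * pi) * real CARD('d) * diameter X * (MAX i\<in>{1..m}. U i / (\<alpha> i * \<delta> i)) * es"
    and D2: "D2 = D1 + diameter X * \<delta>max * Lmax / r"
    and T: "1 \<le> T"
  shows "(\<integral>\<omega>. C (xhat T \<omega>) - C xstar \<partial>M) \<le>
      (diameter X)\<^sup>2 / (2 * (\<Sum>k<T. \<eta> k)) +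
      Gmax\<^sup>2 * ((\<Sum>k<T. (\<eta> k)\<^sup>2) / (2 * (\<Sum>k<T. \<eta> k))) +
      Lmax / real m *
        ((\<Sum>k<T. \<eta> k * (\<integral>\<omega>. (\<Sum>j=1..m. norm (xbar k \<omega> - x k j \<omega>)) \<partial>M)) / (\<Sum>k<T. \<eta> k)) +
      D2"
proof -
  interpret M: prob_space M by (rule M)
  note bd = bounded and conv = convex
  have fin: "finite {1..m}" "{1..m} \<noteq> {}" using m by auto
  have mpos: "0 < real m" using m by simp

  \<comment> \<open>Geometry of the shrunken feasible set\<close>
  define \<theta> where "\<theta> = 1 - \<delta>max / r"
  have \<delta>_le: "\<delta> i \<le> \<delta>max" if "i \<in> {1..m}" for i
    unfolding \<delta>max(1) using that by (intro Max_ge) auto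
  have \<delta>max_pos: "0 < \<delta>max" using \<delta>[of 1] \<delta>_le[of 1] m by auto
  have \<theta>: "0 < \<theta>" "\<theta> < 1" "1 - \<theta> = \<delta>max / r"
    using \<delta>max_pos \<delta>max(2) r by (auto simp: \<theta>_def)
  have X\<delta>_eq: "X\<delta> = (\<lambda>z. \<theta> *\<^sub>R z) ` X"
  proof (intro equalityI subsetI)
    fix p assume "p \<in> X\<delta>"
    then have "p /\<^sub>R \<theta> \<in> X" by (simp add: X\<delta> \<theta>_def)
    then have "\<theta> *\<^sub>R (p /\<^sub>R \<theta>) \<in> (\<lambda>z. \<theta> *\<^sub>R z) ` X" by (rule imageI)
    then show "p \<in> (\<lambda>z. \<theta> *\<^sub>R z) ` X" using \<theta> by simp
  qed (use \<theta> in \<open>auto simp: X\<delta> simp flip: \<theta>_def\<close>)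
  have X\<delta>_cc: "compact X\<delta>" "closed X\<delta>" "convex X\<delta>" "X\<delta> \<noteq> {}"
    unfolding X\<delta>_eq using X by (auto intro: compact_scaling convex_scaling compact_imp_closed)
  have ballX: "p + \<delta> i *\<^sub>R v \<in> X" if "p \<in> X\<delta>" "norm v \<le> 1" "i \<in> {1..m}" for p v i
  proof -
    obtain p' where p': "p' \<in> X" "p = \<theta> *\<^sub>R p'" using \<open>p \<in> X\<delta>\<close> by (auto simp: X\<delta>_eq)
    \<comment> \<open>Chosen so that p + delta_i v is the convex combination of p' and q' with
      weights theta and 1 - theta = delta_max / r. Its norm is at most r because delta_i <=
      delta_max.\<close>
    define q' where "q' = (r * \<delta> i / \<delta>max) *\<^sub>R v"
    have "norm q' = r * (\<delta> i / \<delta>max) * norm v"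
      using r \<delta>max_pos \<delta>[OF that(3)] by (simp add: q'_def)
    also have "\<dots> \<le> r * 1 * 1"
      using r \<delta>max_pos \<delta>[OF that(3)] \<delta>_le[OF that(3)] that(2) by (intro mult_mono) auto
    finally have "q' \<in> X" using r(2) by auto
    moreover have "\<delta> i *\<^sub>R v = (1 - \<theta>) *\<^sub>R q'"
      using r \<delta>max_pos by (simp add: q'_def \<theta>)
    ultimately show ?thesis
      using convexD[OF X(3) p'(1), of q' \<theta> "1 - \<theta>"] \<theta> p'(2) by simp
  qed
  have X\<delta>_sub: "X\<delta> \<subseteq> X" using ballX[of _ 0 1] m by auto
  have diam: "norm (p - p') \<le> diameter X" if "p \<in> X" "p' \<in> X" for p p'
    using diameter_bounded_bound[OF compact_imp_bounded[OF X(2)] that] by (simp add: dist_norm)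
  have zeroX: "0 \<in> X" using r by auto
  have diam0: "0 \<le> diameter X" using diam[OF zeroX zeroX] by simp

  \<comment> \<open>Lipschitz continuity and convexity of the objective\<close>
  define c where "c i z = cvar (P i) (\<alpha> i) (J i z)" for i z
  have C': "C z = 1 / real m * (\<Sum>i=1..m. c i z)" for z by (simp add: C c_def)
  have c_lip: "(L i)-lipschitz_on X (c i)" if "i \<in> {1..m}" for i
    unfolding c_def using \<alpha>[OF that]
    by (intro lipschitz_on_cvar[OF P[OF that] _ _ J_measurable[OF that] bd[OF that] lipschitz[OF that]]) auto
  have c_conv: "convex_on X (c i)" if "i \<in> {1..m}" for i
    unfolding c_def using \<alpha>[OF that]
    by (intro convex_on_cvar[OF P[OF that] _ _ X(3) J_measurable[OF that] bd[OF that] conv[OF that]]) auto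
  have L0: "0 \<le> L i" if "i \<in> {1..m}" for i
    using c_lip[OF that] by (rule lipschitz_on_nonneg)
  have L_le: "L i \<le> Lmax" if "i \<in> {1..m}" for i
    unfolding Lmax using that by (intro Max_ge) auto
  have Lmax0: "0 \<le> Lmax" using L0[of 1] L_le[of 1] m by auto
  have c_lip': "(Lmax)-lipschitz_on X (c i)" if "i \<in> {1..m}" for i
    using c_lip[OF that] L_le[OF that] by (rule lipschitz_on_le)
  have C_lip: "\<bar>C p - C p'\<bar> \<le> Lmax * norm (p - p')" if "p \<in> X" "p' \<in> X" for p p'
  proof -
    have "C p - C p' = 1 / real m * (\<Sum>i=1..m. c i p - c i p')"
      by (simp add: C' sum_subtractf diff_divide_distrib)
    also have "\<bar>\<dots>\<bar> \<le> 1 / real m * (\<Sum>i=1..m. \<bar>c i p - c i p'\<bar>)"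
      unfolding abs_mult by (intro mult_mono sum_abs) auto
    also have "\<dots> \<le> 1 / real m * (\<Sum>i=1..m. Lmax * norm (p - p'))"
      using lipschitz_onD[OF c_lip' that]
      by (intro mult_left_mono sum_mono) (auto simp: dist_real_def dist_norm)
    also have "\<dots> = Lmax * norm (p - p')" using mpos by simp
    finally show ?thesis .
  qed
  have C_cont: "continuous_on X C"
  proof (rule lipschitz_on_continuous_on)
    show "Lmax-lipschitz_on X C"
      using C_lip Lmax0 by (intro lipschitz_onI) (auto simp: dist_real_def dist_norm)
  qed
  have C_conv: "convex_on X C"
  proof (rule convex_onI[OF _ X(3)])
    fix t p p' assume t: "0 < t" "t < (1::real)" and p: "p \<in> X" "p' \<in> X"
    have "(\<Sum>i=1..m. c i ((1 - t) *\<^sub>R p + t *\<^sub>R p')) \<le> (\<Sum>i=1..m. (1 - t) * c i p + t * c i p')"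
      using t p by (intro sum_mono convex_onD[OF c_conv]) auto
    then have "C ((1 - t) *\<^sub>R p + t *\<^sub>R p') \<le> 1 / real m * (\<Sum>i=1..m. (1 - t) * c i p + t * c i p')"
      unfolding C' by (intro mult_left_mono) auto
    also have "\<dots> = (1 - t) * C p + t * C p'"
      by (simp add: C' sum.distrib add_divide_distrib flip: sum_distrib_left)
    finally show "C ((1 - t) *\<^sub>R p + t *\<^sub>R p') \<le> (1 - t) * C p + t * C p'" .
  qed

  \<comment> \<open>Feasibility of iterates, averages and query points\<close>
  have y': "y k i \<omega> = (\<Sum>j=1..m. W k i j *\<^sub>R x k j \<omega>)" if "i \<in> {1..m}" "\<omega> \<in> space M" for k i \<omega>
    unfolding y[OF that]
    using graph[of k] that W_zero[OF that(1)] by (intro sum.mono_neutral_left) (auto simp: nbhd_def)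
  have W0: "0 \<le> W k i j" "(\<Sum>j=1..m. W k i j) = 1" if "i \<in> {1..m}" "j \<in> {1..m}" for k i j
    using W_stochastic[of k] that by (auto simp: doubly_stochastic_def)
  have x_in: "x k i \<omega> \<in> X\<delta>" if "i \<in> {1..m}" "\<omega> \<in> space M" for k i \<omega>
    using that x0(2) x by (cases k) (auto intro!: closest_point_in_set X\<delta>_cc)
  have y_in: "y k i \<omega> \<in> X\<delta>" if "i \<in> {1..m}" "\<omega> \<in> space M" for k i \<omega>
    unfolding y'[OF that] using W0 that x_in by (intro convex_sum X\<delta>_cc) auto
  have xbar_in: "xbar k \<omega> \<in> X\<delta>" if "\<omega> \<in> space M" for k \<omega>
  proof -
    have "(\<Sum>i=1..m. (1 / real m) *\<^sub>R x k i \<omega>) \<in> X\<delta>"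
      using mpos x_in that by (intro convex_sum X\<delta>_cc) auto
    then show ?thesis by (simp add: xbar scaleR_sum_right)
  qed
  define H where "H = (\<Sum>k<T. \<eta> k)"
  have H: "0 < H" unfolding H_def using T \<eta> by (intro sum_pos) (auto simp: lessThan_empty_iff)
  have xhat': "xhat T \<omega> = (\<Sum>k<T. (\<eta> k / H) *\<^sub>R xbar k \<omega>)" for \<omega>
    by (simp add: xhat H_def[symmetric] scaleR_sum_right)
  have \<eta>H: "(\<Sum>k<T. \<eta> k / H) = 1" "0 \<le> \<eta> k / H" for k
    using H \<eta>[of k] by (auto simp: H_def simp flip: sum_divide_distrib)
  have xhat_in: "xhat T \<omega> \<in> X" if "\<omega> \<in> space M" for \<omega>
    unfolding xhat' using xbar_in[OF that] X\<delta>_sub X \<eta>H by (intro convex_sum) auto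
  have yhat_in: "yhat k i \<omega> \<in> X" if "i \<in> {1..m}" "\<omega> \<in> space M" for k i \<omega>
    unfolding yhat[OF that] using u(2)[OF that, of k] that by (intro ballX y_in) auto

  \<comment> \<open>Measurability of the iterates with respect to the history\<close>
  have \<xi>_meas: "\<xi> k i j \<in> measurable M (P i)" if "i \<in> {1..m}" "j \<in> {1..s k i}" for k i j
    using \<xi>_indep[OF that(1)] that(2) by (auto simp: M.indep_vars_def)
  have \<xi>_in: "\<xi> k i j \<omega> \<in> space (P i)" if "i \<in> {1..m}" "j \<in> {1..s k i}" "\<omega> \<in> space M" for k i j \<omega>
    using \<xi>_meas[OF that(1,2)] that(3) by (rule measurable_space)

  define G where "G k = (\<Union>i\<in>{1..m}. preimages M borel (x 0 i)) \<union>
      (\<Union>t\<in>{..<k}. \<Union>i\<in>{1..m}. preimages M borel (u t i)) \<union>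
      (\<Union>t\<in>{..<k}. \<Union>i\<in>{1..m}. \<Union>j\<in>{1..s t i}. preimages M (P i) (\<xi> t i j))" for k
  have F': "F k = sigma (space M) (G k)" for k by (simp add: F history_def G_def)
  have G_sets: "G k \<subseteq> sets M" for k
    unfolding G_def by (intro Un_least UN_least preimages_subset_sets x0(1) u(1) \<xi>_meas)
  have G_Pow: "G k \<subseteq> Pow (space M)" for k
    using G_sets sets.space_closed by blast
  have F_space: "space (F k) = space M" and F_sets: "sets (F k) = sigma_sets (space M) (G k)" for k
    unfolding F' using G_Pow by (auto simp: space_measure_of sets_measure_of)
  have F_sub: "subalgebra M (F k)" for k
    unfolding subalgebra_def using sets.sigma_sets_subset[OF G_sets] by (simp add: F_space F_sets)
  have G_mono: "G k \<subseteq> G (Suc k)" for k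
    by (force simp: G_def)
  have F_mono: "f \<in> measurable (F (Suc k)) N" if "f \<in> measurable (F k) N"
    for f :: "'o \<Rightarrow> real ^ 'd" and N k
    using that measurable_mono[of N N "F k" "F (Suc k)"] sigma_sets_mono'[OF G_mono[of k]]
    by (auto simp: F_space F_sets)
  have u_F: "u k i \<in> borel_measurable (F (Suc k))" if "i \<in> {1..m}" for k i
    unfolding F' using that by (intro measurable_sigma_preimages G_Pow) (auto simp: G_def)
  have \<xi>_F: "\<xi> k i j \<in> measurable (F (Suc k)) (P i)" if "i \<in> {1..m}" "j \<in> {1..s k i}" for k i j
    unfolding F' using that \<xi>_in[OF that]
    by (intro measurable_sigma_preimages G_Pow) (auto simp: G_def intro!: bexI[of _ k])
  \<comment> \<open>The sigma-algebra \<open>N\<close> is left open: \<open>y k i\<close> is wanted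
    at \<open>F k\<close>, and in the induction below also at \<open>F (Suc k)\<close>, where the
    gradient of round k becomes measurable.\<close>
  have y_Fx: "y k i \<in> borel_measurable N"
    if i: "i \<in> {1..m}" and N: "space N = space M" and xN: "\<And>j. j \<in> {1..m} \<Longrightarrow> x k j \<in> borel_measurable N" for k i N
  proof -
    have "(\<lambda>\<omega>. \<Sum>j=1..m. W k i j *\<^sub>R x k j \<omega>) \<in> borel_measurable N"
      using xN by (intro borel_measurable_sum borel_measurable_scaleR) auto
    then show ?thesis by (subst measurable_cong[where g="\<lambda>\<omega>. \<Sum>j=1..m. W k i j *\<^sub>R x k j \<omega>"]) (auto simp: N y'[OF i])
  qed
  have ghat_F: "ghat k i \<in> borel_measurable N"
    if i: "i \<in> {1..m}" and N: "space N = space M" and yN: "y k i \<in> borel_measurable N"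
      and uN: "u k i \<in> borel_measurable N" and \<xi>N: "\<And>j. j \<in> {1..s k i} \<Longrightarrow> \<xi> k i j \<in> measurable N (P i)" for k i N
  proof -
    note [measurable] = yN uN
    have yh: "yhat k i \<in> borel_measurable N"
      by (subst measurable_cong[where g="\<lambda>\<omega>. y k i \<omega> + \<delta> i *\<^sub>R u k i \<omega>"]) (auto simp: N yhat[OF i])
    have "(\<lambda>\<omega>. emp_cvar (\<alpha> i) (s k i) (\<lambda>j. J i (yhat k i \<omega>) (\<xi> k i j \<omega>))) \<in> borel_measurable N"
      using \<alpha>[OF i] s[OF i] yhat_in[OF i] \<xi>N
      by (intro borel_measurable_emp_cvar
          borel_measurable_lipschitz_compose[OF J_measurable[OF i] lipschitz[OF i] yh]) (auto simp: N)
    note [measurable] = this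
    show ?thesis
      by (subst measurable_cong[OF ghat[OF i]]) (auto simp: N)
  qed
  have x_F: "\<forall>i\<in>{1..m}. x k i \<in> borel_measurable (F k)" for k
  proof (induction k)
    case 0
    show ?case
      unfolding F' by (intro ballI measurable_sigma_preimages G_Pow) (auto simp: G_def)
  next
    case (Suc k)
    show ?case
    proof
      fix i assume i: "i \<in> {1..m}"
      have yF [measurable]: "y k i \<in> borel_measurable (F (Suc k))"
        by (rule y_Fx[OF i F_space], rule F_mono) (use Suc in blast)
      have [measurable]: "ghat k i \<in> borel_measurable (F (Suc k))"
        by (rule ghat_F[OF i F_space yF u_F[OF i] \<xi>_F[OF i]])
      have "closest_point X\<delta> \<in> borel_measurable borel"
        using X\<delta>_cc by (intro borel_measurable_continuous_onI continuous_on_closest_point)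
      then have "(\<lambda>\<omega>. closest_point X\<delta> (y k i \<omega> - \<eta> k *\<^sub>R ghat k i \<omega>)) \<in> borel_measurable (F (Suc k))"
        by (rule measurable_compose[rotated]) measurable
      then show "x (Suc k) i \<in> borel_measurable (F (Suc k))"
        by (subst measurable_cong[OF x[OF i]]) (auto simp: F_space)
    qed
  qed
  \<comment> \<open>The mixed point is known before the randomness of its round is drawn; both
    product laws below rest on this.\<close>
  have y_F: "y k i \<in> borel_measurable (F k)" if "i \<in> {1..m}" for k i
    by (rule y_Fx[OF that F_space]) (use x_F in blast)
  have x_M [measurable]: "x k i \<in> borel_measurable M" and y_M [measurable]: "y k i \<in> borel_measurable M"
    and ghat_M [measurable]: "ghat k i \<in> borel_measurable M" if "i \<in> {1..m}" for k i
  proof -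
    show "x k i \<in> borel_measurable M" using x_F that measurable_from_subalg[OF F_sub] by blast
    show yM: "y k i \<in> borel_measurable M" using y_F[OF that] measurable_from_subalg[OF F_sub] by blast
    show "ghat k i \<in> borel_measurable M"
      by (rule ghat_F[OF that refl yM u(1)[OF that] \<xi>_meas[OF that]])
  qed

  \<comment> \<open>Product laws of position, direction and batch\<close>
  have u_indep: "M.prob (B \<inter> (u k i -` A \<inter> space M)) = M.prob B * measure unif_sphere A"
    if i: "i \<in> {1..m}" and B: "B \<in> sets (F k)" and A: "A \<in> sets borel" for i k A B
  proof -
    interpret finite_measure_subalgebra M "F k"
      by unfold_locales (rule F_sub)
    \<comment> \<open>Letting the directions of the other agents range over the whole space extracts
      the marginal of agent i from the joint conditional law.\<close>
    define A' where "A' l = (if l = i then A else UNIV)" for l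
    let ?S = "{\<omega> \<in> space M. \<forall>l\<in>{1..m}. u k l \<omega> \<in> A' l}"
    have S: "?S = u k i -` A \<inter> space M" using i by (auto simp: A'_def)
    have Sm: "?S \<in> sets M" unfolding S using u(1)[OF i] A by (rule measurable_sets)
    have BM: "B \<in> sets M" using B F_sub by (auto simp: subalgebra_def)
    have "(\<Prod>l=1..m. measure unif_sphere (A' l)) = (\<Prod>l=1..m. if l = i then measure unif_sphere A else 1)"
      using prob_space.prob_space[OF prob_space_unif_sphere] by (intro prod.cong) (auto simp: A'_def)
    also have "\<dots> = measure unif_sphere A" using i by simp
    finally have prod: "(\<Prod>l=1..m. measure unif_sphere (A' l)) = measure unif_sphere A" .
    have "A' l \<in> sets borel" for l using A by (simp add: A'_def)
    then have AE: "AE \<omega> in M. real_cond_exp M (F k) (indicator ?S) \<omega> = measure unif_sphere A"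
      using u_cond[of A' k] unfolding prod by blast
    have "M.prob (B \<inter> ?S) = (\<integral>\<omega>\<in>B. indicator ?S \<omega> \<partial>M)"
      using Sm BM by (simp add: set_lebesgue_integral_def flip: indicator_inter_arith)
    also have "\<dots> = (\<integral>\<omega>\<in>B. real_cond_exp M (F k) (indicator ?S) \<omega> \<partial>M)"
      by (intro real_cond_exp_intA B integrable_real_indicator Sm) (simp add: M.emeasure_eq_measure)
    also have "\<dots> = (\<integral>\<omega>\<in>B. measure unif_sphere A \<partial>M)"
      unfolding set_lebesgue_integral_def using AE BM by (intro integral_cong_AE) auto
    also have "\<dots> = M.prob B * measure unif_sphere A"
      using BM by (simp add: set_lebesgue_integral_def)
    finally show ?thesis by (simp only: S)
  qed
  have u_distr: "distr M borel (u k i) = unif_sphere" if i: "i \<in> {1..m}" for k i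
  proof (rule measure_eqI)
    fix A assume "A \<in> sets (distr M borel (u k i))"
    then have A: "A \<in> sets borel" by simp
    have "M.prob (u k i -` A \<inter> space M) = measure unif_sphere A"
      using u_indep[OF i sets.top A, of k] by (simp add: F_space M.prob_space Int_absorb1)
    then show "emeasure (distr M borel (u k i)) A = emeasure unif_sphere A"
      using u(1)[OF i] A
      by (simp add: emeasure_distr M.emeasure_eq_measure
          finite_measure.emeasure_eq_measure[OF prob_space.finite_measure[OF prob_space_unif_sphere]])
  qed simp
  have yu: "distr M (borel \<Otimes>\<^sub>M borel) (\<lambda>\<omega>. (y k i \<omega>, u k i \<omega>)) = distr M borel (y k i) \<Otimes>\<^sub>M unif_sphere"
    if i: "i \<in> {1..m}" for k i
  proof -
    have "distr M (borel \<Otimes>\<^sub>M borel) (\<lambda>\<omega>. (y k i \<omega>, u k i \<omega>))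
        = distr M borel (y k i) \<Otimes>\<^sub>M distr M borel (u k i)"
    proof (rule M.distr_Pair_eq_pair_measure[OF y_M[OF i] u(1)[OF i]])
      fix A B :: "(real ^ 'd) set" assume A: "A \<in> sets borel" and B: "B \<in> sets borel"
      have "y k i -` A \<inter> space M \<in> sets (F k)"
        using measurable_sets[OF y_F[OF i] A, of k] by (simp add: F_space)
      from u_indep[OF i this B] u_indep[OF i sets.top B, of k]
      show "M.prob ((y k i -` A \<inter> space M) \<inter> (u k i -` B \<inter> space M))
          = M.prob (y k i -` A \<inter> space M) * M.prob (u k i -` B \<inter> space M)"
        by (simp add: F_space M.prob_space Int_absorb1)
    qed
    then show ?thesis by (simp add: u_distr[OF i])
  qed
  have batch: "distr M (PiM {1..s k i} (\<lambda>_. P i) \<Otimes>\<^sub>M (borel \<Otimes>\<^sub>M borel))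
        (\<lambda>\<omega>. (\<lambda>j\<in>{1..s k i}. \<xi> k i j \<omega>, (y k i \<omega>, u k i \<omega>)))
      = PiM {1..s k i} (\<lambda>_. P i) \<Otimes>\<^sub>M distr M (borel \<Otimes>\<^sub>M borel) (\<lambda>\<omega>. (y k i \<omega>, u k i \<omega>))"
    if i: "i \<in> {1..m}" for k i
  proof -
    let ?I = "{1..s k i}" and ?K = "{(k, j). j \<in> {1..s k i}}"
    let ?\<Xi> = "\<lambda>\<omega>. \<lambda>j\<in>?I. \<xi> k i j \<omega>"
    have \<Xi>: "?\<Xi> \<in> measurable M (PiM ?I (\<lambda>_. P i))"
      using \<xi>_meas[OF i] by (intro measurable_restrict) auto
    \<comment> \<open>The description of independence by the joint law needs a nonempty index set; a
      sample size of at least 1 supplies an element.\<close>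
    have 1: "(1, 1) \<in> {(k, j). j \<in> {1..s k i}}"
      using s[OF i, of 1] by simp
    have "distr M (PiM ?K (\<lambda>_. P i)) (\<lambda>\<omega>. \<lambda>p\<in>?K. (case p of (k, j) \<Rightarrow> \<xi> k i j) \<omega>)
        = PiM ?K (\<lambda>p. distr M (P i) (case p of (k, j) \<Rightarrow> \<xi> k i j))"
      using \<xi>_indep[OF i] 1 by (subst (asm) M.indep_vars_iff_distr_eq_PiM') (auto intro: \<xi>_meas[OF i])
    also have "\<dots> = PiM ?K (\<lambda>_. P i)"
      by (intro PiM_cong) (auto simp: \<xi>_distr[OF i])
    finally have all: "distr M (PiM ?K (\<lambda>_. P i)) (\<lambda>\<omega>. \<lambda>p\<in>?K. (case p of (k, j) \<Rightarrow> \<xi> k i j) \<omega>)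
        = PiM ?K (\<lambda>_. P i)" .
    \<comment> \<open>The samples of an agent form one family over all rounds; the injection j ->
      (k, j) picks out round k and yields the law of its batch.\<close>
    have "PiM ?I (\<lambda>_. P i) = distr (PiM ?K (\<lambda>_. P i)) (PiM ?I (\<lambda>_. P i)) (\<lambda>w. \<lambda>j\<in>?I. w (k, j))"
      using distr_PiM_reindex[of ?K "\<lambda>_. P i" "Pair k" ?I] P[OF i] by (simp add: inj_on_def Pi_def)
    also have "\<dots> = distr (distr M (PiM ?K (\<lambda>_. P i)) (\<lambda>\<omega>. \<lambda>p\<in>?K. (case p of (k, j) \<Rightarrow> \<xi> k i j) \<omega>))
        (PiM ?I (\<lambda>_. P i)) (\<lambda>w. \<lambda>j\<in>?I. w (k, j))"
      by (simp only: all)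
    also have "\<dots> = distr M (PiM ?I (\<lambda>_. P i)) ?\<Xi>"
    proof (subst distr_distr)
      show "(\<lambda>w. \<lambda>j\<in>?I. w (k, j)) \<in> measurable (PiM ?K (\<lambda>_. P i)) (PiM ?I (\<lambda>_. P i))"
        by (intro measurable_restrict measurable_component_singleton) auto
      show "(\<lambda>\<omega>. \<lambda>p\<in>?K. (case p of (k, j) \<Rightarrow> \<xi> k i j) \<omega>) \<in> measurable M (PiM ?K (\<lambda>_. P i))"
        by (intro measurable_restrict) (auto intro: \<xi>_meas[OF i])
    qed (auto intro!: distr_cong simp: restrict_def fun_eq_iff)
    finally have distr_\<Xi>: "distr M (PiM ?I (\<lambda>_. P i)) ?\<Xi> = PiM ?I (\<lambda>_. P i)" ..
    have "distr M (PiM ?I (\<lambda>_. P i) \<Otimes>\<^sub>M (borel \<Otimes>\<^sub>M borel)) (\<lambda>\<omega>. (?\<Xi> \<omega>, (y k i \<omega>, u k i \<omega>)))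
      = distr M (PiM ?I (\<lambda>_. P i)) ?\<Xi> \<Otimes>\<^sub>M distr M (borel \<Otimes>\<^sub>M borel) (\<lambda>\<omega>. (y k i \<omega>, u k i \<omega>))"
    proof (rule M.distr_Pair_eq_pair_measure[OF \<Xi> measurable_Pair[OF y_M[OF i] u(1)[OF i]]])
      fix A and B :: "((real ^ 'd) \<times> (real ^ 'd)) set"
      assume A: "A \<in> sets (PiM ?I (\<lambda>_. P i))" and B: "B \<in> sets (borel \<Otimes>\<^sub>M borel)"
      let ?G1 = "\<Union>j\<in>?I. preimages M (P i) (\<xi> k i j)"
      let ?G2 = "sets (F k) \<union> (\<Union>l\<in>{1..m}. preimages M borel (u k l))"
      have G1: "?G1 \<subseteq> Pow (space M)" by (auto simp: preimages_def)
      have G2: "?G2 \<subseteq> Pow (space M)"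
        using sets.space_closed[of "F k"] by (auto simp: preimages_def F_space)
      have "?\<Xi> \<in> measurable (sigma (space M) ?G1) (PiM ?I (\<lambda>_. P i))"
        using \<xi>_in[OF i] by (intro measurable_restrict measurable_sigma_preimages G1) auto
      from measurable_sets[OF this A] have a: "?\<Xi> -` A \<inter> space M \<in> sigma_sets (space M) ?G1"
        using G1 by (simp add: space_measure_of sets_measure_of)
      have "y k i \<in> borel_measurable (sigma (space M) ?G2)"
      proof (rule measurable_sigma_preimages[OF _ G2])
        show "preimages M borel (y k i) \<subseteq> ?G2"
          using measurable_sets[OF y_F[OF i], of _ k] by (auto simp: preimages_def F_space)
      qed simp
      moreover have "u k i \<in> borel_measurable (sigma (space M) ?G2)"
        using i by (intro measurable_sigma_preimages G2) auto
      ultimately have "(\<lambda>\<omega>. (y k i \<omega>, u k i \<omega>)) \<in> measurable (sigma (space M) ?G2) (borel \<Otimes>\<^sub>M borel)"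
        by (rule measurable_Pair)
      from measurable_sets[OF this B]
      have b: "(\<lambda>\<omega>. (y k i \<omega>, u k i \<omega>)) -` B \<inter> space M \<in> sigma_sets (space M) ?G2"
        using G2 by (simp add: space_measure_of sets_measure_of)
      show "M.prob ((?\<Xi> -` A \<inter> space M) \<inter> ((\<lambda>\<omega>. (y k i \<omega>, u k i \<omega>)) -` B \<inter> space M))
        = M.prob (?\<Xi> -` A \<inter> space M) * M.prob ((\<lambda>\<omega>. (y k i \<omega>, u k i \<omega>)) -` B \<inter> space M)"
        by (rule M.indep_setD[OF \<xi>_batch[OF i] a b])
    qed
    then show ?thesis by (simp only: distr_\<Xi>)
  qed

  have grad: "M.expectation (\<lambda>\<omega>. c i (y k i \<omega>)) - c i z - 2 * L i * \<delta> i
      - real CARD('d) * diameter X * U i / (\<delta> i * \<alpha> i * sqrt (real (s k i)))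
    \<le> M.expectation (\<lambda>\<omega>. ghat k i \<omega> \<bullet> (y k i \<omega> - z))"
    if i: "i \<in> {1..m}" and z: "z \<in> X\<delta>" for i k z
  proof -
    have "M.expectation (\<lambda>\<omega>. ghat k i \<omega> \<bullet> (y k i \<omega> - z)) = M.expectation (\<lambda>\<omega>. (real CARD('d) / \<delta> i *
        emp_cvar (\<alpha> i) (s k i) (\<lambda>j. J i (y k i \<omega> + \<delta> i *\<^sub>R u k i \<omega>) (\<xi> k i j \<omega>))) *\<^sub>R u k i \<omega> \<bullet> (y k i \<omega> - z))"
      by (intro Bochner_Integration.integral_cong) (auto simp: ghat[OF i] yhat[OF i])
    then show ?thesis
      unfolding c_def using \<alpha>[OF i] u(2)[OF i] X\<delta>_sub
      by (simp only:) (intro M.expectation_zeroth_order_gradient[OF X(2,3) P[OF i] _ _ s[OF i]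
            J_measurable[OF i] lipschitz[OF i] bd[OF i] conv[OF i] \<delta>[OF i], where S = X\<delta>]
          yu[OF i] batch[OF i] ballX[OF _ _ i] y_in[OF i] z diam y_M[OF i] u(1)[OF i] \<xi>_meas[OF i]; auto)
  qed

  \<comment> \<open>Comparison point, gradient bound and integrability\<close>
  define z where "z = \<theta> *\<^sub>R xstar"
  have xstar_in: "xstar \<in> X" using xstar by (simp add: is_arg_min_def)
  have z: "z \<in> X\<delta>" unfolding z_def X\<delta>_eq using xstar_in by (rule imageI)
  have zX: "z \<in> X" using z X\<delta>_sub by auto
  \<comment> \<open>Since 0 lies in \<open>X\<close>, the norm of the minimizer is at most the
    diameter. This produces the summand by which \<open>D2\<close> exceeds
    \<open>D1\<close>.\<close>
  have shrink: "C z - C xstar \<le> diameter X * \<delta>max * Lmax / r"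
  proof -
    have "z - xstar = - ((1 - \<theta>) *\<^sub>R xstar)"
      by (simp add: z_def algebra_simps)
    then have "norm (z - xstar) = \<delta>max / r * norm xstar"
      using \<delta>max_pos r \<theta>(3) by simp
    also have "\<dots> \<le> \<delta>max / r * diameter X"
      using diam[OF xstar_in zeroX] \<delta>max_pos r by (intro mult_left_mono) auto
    finally have "Lmax * norm (z - xstar) \<le> Lmax * (\<delta>max / r * diameter X)"
      using Lmax0 by (rule mult_left_mono)
    with C_lip[OF zX xstar_in] show ?thesis by (simp add: ac_simps)
  qed
  have ghat_norm: "norm (ghat k i \<omega>) \<le> Gmax" if i: "i \<in> {1..m}" and \<omega>: "\<omega> \<in> space M" for k i \<omega>
  proof -
    have "\<bar>emp_cvar (\<alpha> i) (s k i) (\<lambda>j. J i (yhat k i \<omega>) (\<xi> k i j \<omega>))\<bar> \<le> U i"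
      using \<alpha>[OF i] \<xi>_in[OF i _ \<omega>] yhat_in[OF i \<omega>]
      by (intro emp_cvar_abs_le[OF s[OF i] _ _ bd[OF i]]) auto
    then have "norm (ghat k i \<omega>) \<le> real CARD('d) / \<delta> i * U i"
      using u(2)[OF i \<omega>, of k] \<delta>[OF i] unfolding ghat[OF i \<omega>] norm_scaleR abs_mult
      by (simp add: divide_right_mono)
    also have "\<dots> = real CARD('d) * U i / \<delta> i" by simp
    also have "\<dots> \<le> Gmax" unfolding Gmax using i by (intro Max_ge) auto
    finally show ?thesis .
  qed
  have Gmax0: "0 \<le> Gmax"
  proof -
    obtain \<omega> where "\<omega> \<in> space M" using M.not_empty by auto
    then have "norm (ghat 0 1 \<omega>) \<le> Gmax" using m by (intro ghat_norm) auto
    then show ?thesis using norm_ge_zero[of "ghat 0 1 \<omega>"] by linarith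
  qed

  have xbar_M [measurable]: "xbar k \<in> borel_measurable M" for k
  proof -
    have "(\<lambda>\<omega>. (1 / real m) *\<^sub>R (\<Sum>i=1..m. x k i \<omega>)) \<in> borel_measurable M"
      by (intro borel_measurable_scaleR borel_measurable_sum borel_measurable_const x_M)
    then show ?thesis by (simp add: xbar[abs_def])
  qed
  have int_sq: "integrable M (\<lambda>\<omega>. (norm (x k i \<omega> - z))\<^sup>2)" if "i \<in> {1..m}" for k i
    by (rule M.integrable_continuous_compose[OF _ X\<delta>_cc(1) x_M[OF that] x_in[OF that]])
      (auto intro!: continuous_intros)
  have int_c: "integrable M (\<lambda>\<omega>. c i (y k i \<omega>))" if "i \<in> {1..m}" for k i
    using y_in[OF that] X\<delta>_sub
    by (intro M.integrable_continuous_compose[OF _ X(2) y_M[OF that]] lipschitz_on_continuous_on[OF c_lip[OF that]]) auto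
  have int_C: "integrable M (\<lambda>\<omega>. C (xbar k \<omega>))" for k
    using xbar_in X\<delta>_sub by (intro M.integrable_continuous_compose[OF C_cont X(2) xbar_M]) auto
  have int_n: "integrable M (\<lambda>\<omega>. norm (xbar k \<omega> - x k j \<omega>))" if "j \<in> {1..m}" for k j
  proof (rule M.integrable_const_bound[of _ "diameter X"])
    show "AE \<omega> in M. norm (norm (xbar k \<omega> - x k j \<omega>)) \<le> diameter X"
      unfolding norm_ge_zero[THEN abs_of_nonneg] real_norm_def using xbar_in x_in[OF that] X\<delta>_sub by (intro AE_I2 diam) auto
  qed (use x_M[OF that] in measurable)
  have int_g: "integrable M (\<lambda>\<omega>. ghat k i \<omega> \<bullet> (y k i \<omega> - z))" if i: "i \<in> {1..m}" for k i
  proof (rule M.integrable_const_bound[of _ "Gmax * diameter X"])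
    show "AE \<omega> in M. norm (ghat k i \<omega> \<bullet> (y k i \<omega> - z)) \<le> Gmax * diameter X"
    proof (rule AE_I2)
      fix \<omega> assume \<omega>: "\<omega> \<in> space M"
      have "norm (ghat k i \<omega> \<bullet> (y k i \<omega> - z)) \<le> norm (ghat k i \<omega>) * norm (y k i \<omega> - z)"
        using Cauchy_Schwarz_ineq2 by simp
      also have "\<dots> \<le> Gmax * diameter X"
        using ghat_norm[OF i \<omega>] y_in[OF i \<omega>] X\<delta>_sub zX Gmax0 by (intro mult_mono diam) auto
      finally show "norm (ghat k i \<omega> \<bullet> (y k i \<omega> - z)) \<le> Gmax * diameter X" .
    qed
    show "(\<lambda>\<omega>. ghat k i \<omega> \<bullet> (y k i \<omega> - z)) \<in> borel_measurable M"
      using ghat_M[OF i] y_M[OF i] by (intro borel_measurable_inner borel_measurable_diff) auto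
  qed

  \<comment> \<open>Descent in expectation\<close>
  define a where "a k = M.expectation (\<lambda>\<omega>. \<Sum>i=1..m. (norm (x k i \<omega> - z))\<^sup>2)" for k
  define e where "e k = M.expectation (\<lambda>\<omega>. C (xbar k \<omega>))" for k
  define n where "n k = M.expectation (\<lambda>\<omega>. \<Sum>j=1..m. norm (xbar k \<omega> - x k j \<omega>))" for k

  have gap: "real m * (e k - C z) - Lmax * n k - real m * D1
    \<le> (\<Sum>i=1..m. M.expectation (\<lambda>\<omega>. ghat k i \<omega> \<bullet> (y k i \<omega> - z)))" for k
  proof -
    define Q where "Q = (MAX i\<in>{1..m}. U i / (\<alpha> i * \<delta> i))"
    have Q: "U i / (\<alpha> i * \<delta> i) \<le> Q" if "i \<in> {1..m}" for i
      unfolding Q_def using that by (intro Max_ge) auto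
    have Q0: "0 \<le> Q"
    proof -
      have 1: "1 \<in> {1..m}" using m by simp
      have "0 \<le> U 1 / (\<alpha> 1 * \<delta> 1)" using U_pos[OF 1] \<alpha>[OF 1] \<delta>[OF 1] by simp
      then show ?thesis using Q[OF 1] by linarith
    qed
    have err: "(\<Sum>i=1..m. 2 * L i * \<delta> i + real CARD('d) * diameter X * U i / (\<delta> i * \<alpha> i * sqrt (real (s k i))))
        \<le> real m * D1"
    proof -
      have "(\<Sum>i=1..m. 2 * L i * \<delta> i) \<le> (\<Sum>i=1..m. 2 * Lmax * \<delta>max)"
        using L0 L_le \<delta>_le Lmax0 \<delta> by (intro sum_mono mult_mono) (auto intro: less_imp_le)
      then have 1: "(\<Sum>i=1..m. 2 * L i * \<delta> i) \<le> real m * (2 * Lmax * \<delta>max)" by simp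
      \<comment> \<open>The factor m is written out and divided away again so that the sum bounded
        by condition (S) appears literally.\<close>
      have "(\<Sum>i=1..m. real CARD('d) * diameter X * U i / (\<delta> i * \<alpha> i * sqrt (real (s k i))))
          \<le> (\<Sum>i=1..m. real CARD('d) * diameter X * Q * (real m * (1 / (real m * sqrt (real (s k i))))))"
      proof (rule sum_mono)
        fix i assume i: "i \<in> {1..m}"
        have "real CARD('d) * diameter X * U i / (\<delta> i * \<alpha> i * sqrt (real (s k i)))
            = real CARD('d) * diameter X * (U i / (\<alpha> i * \<delta> i)) * (1 / sqrt (real (s k i)))"
          by (simp add: ac_simps)
        also have "\<dots> \<le> real CARD('d) * diameter X * Q * (1 / sqrt (real (s k i)))"
          using Q[OF i] diam0 by (intro mult_right_mono mult_left_mono) auto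
        also have "\<dots> = real CARD('d) * diameter X * Q * (real m * (1 / (real m * sqrt (real (s k i)))))"
          using mpos by simp
        finally show "real CARD('d) * diameter X * U i / (\<delta> i * \<alpha> i * sqrt (real (s k i)))
          \<le> real CARD('d) * diameter X * Q * (real m * (1 / (real m * sqrt (real (s k i)))))" .
      qed
      also have "\<dots> = real CARD('d) * diameter X * Q * (real m * (\<Sum>i=1..m. 1 / (real m * sqrt (real (s k i)))))"
        by (simp only: sum_distrib_left)
      also have "\<dots> \<le> real CARD('d) * diameter X * Q * (real m * es)"
        using es(2)[of k] diam0 Q0 by (intro mult_left_mono) auto
      \<comment> \<open>The estimate already holds with constant 1; the next line enlarges it to the
        constant in \<open>D1\<close>.\<close>
      also have "\<dots> = 1 * (real CARD('d) * diameter X * Q * (real m * es))" by simp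
      also have "\<dots> \<le> sqrt (2 * pi) * (real CARD('d) * diameter X * Q * (real m * es))"
        using es(1) diam0 Q0 pi_ge_two by (intro mult_right_mono) auto
      finally show ?thesis
        using 1 unfolding D1 Q_def[symmetric] by (simp add: sum.distrib algebra_simps)
    qed
    \<comment> \<open>The bound concerns the objective at the average, while gradients belong to the
      mixed points y_i. Lipschitz continuity bridges the gap, and averaging does not increase the
      total distance to \<open>xbar\<close>, so the disagreement of the x_j takes its place.\<close>
    have "real m * C (xbar k \<omega>) - Lmax * (\<Sum>j=1..m. norm (xbar k \<omega> - x k j \<omega>)) \<le> (\<Sum>i=1..m. c i (y k i \<omega>))"
      if \<omega>: "\<omega> \<in> space M" for \<omega>
    proof -
      have bX: "xbar k \<omega> \<in> X" using xbar_in[OF \<omega>] X\<delta>_sub by auto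
      have "(\<Sum>i=1..m. c i (xbar k \<omega>)) \<le> (\<Sum>i=1..m. c i (y k i \<omega>) + Lmax * dist (xbar k \<omega>) (y k i \<omega>))"
      proof (rule sum_mono)
        fix i assume i: "i \<in> {1..m}"
        then have "y k i \<omega> \<in> X" using y_in[OF i \<omega>] X\<delta>_sub by auto
        then show "c i (xbar k \<omega>) \<le> c i (y k i \<omega>) + Lmax * dist (xbar k \<omega>) (y k i \<omega>)"
          using lipschitz_onD[OF c_lip'[OF i] bX, of "y k i \<omega>"] by (auto simp: dist_real_def)
      qed
      also have "\<dots> = (\<Sum>i=1..m. c i (y k i \<omega>)) + Lmax * (\<Sum>i=1..m. dist (xbar k \<omega>) (\<Sum>j=1..m. W k i j *\<^sub>R x k j \<omega>))"
        using y'[OF _ \<omega>] by (simp add: sum.distrib sum_distrib_left)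
      also have "\<dots> \<le> (\<Sum>i=1..m. c i (y k i \<omega>)) + Lmax * (\<Sum>j=1..m. dist (xbar k \<omega>) (x k j \<omega>))"
        using Lmax0 by (intro add_left_mono mult_left_mono
            doubly_stochastic_sum_convex_le[OF W_stochastic m] convex_on_dist) auto
      finally show ?thesis
        using mpos by (simp add: C' dist_norm)
    qed
    then have "M.expectation (\<lambda>\<omega>. real m * C (xbar k \<omega>) - Lmax * (\<Sum>j=1..m. norm (xbar k \<omega> - x k j \<omega>)))
        \<le> M.expectation (\<lambda>\<omega>. \<Sum>i=1..m. c i (y k i \<omega>))"
      by (intro integral_mono Bochner_Integration.integrable_diff integrable_mult_right
          Bochner_Integration.integrable_sum int_C int_n int_c)
    also have "M.expectation (\<lambda>\<omega>. real m * C (xbar k \<omega>) - Lmax * (\<Sum>j=1..m. norm (xbar k \<omega> - x k j \<omega>)))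
        = real m * e k - Lmax * n k"
      unfolding e_def n_def
    proof (subst Bochner_Integration.integral_diff)
      show "integrable M (\<lambda>\<omega>. real m * C (xbar k \<omega>))"
        by (intro integrable_mult_right int_C)
      show "integrable M (\<lambda>\<omega>. Lmax * (\<Sum>j=1..m. norm (xbar k \<omega> - x k j \<omega>)))"
        by (intro integrable_mult_right Bochner_Integration.integrable_sum int_n)
    qed simp
    also have "M.expectation (\<lambda>\<omega>. \<Sum>i=1..m. c i (y k i \<omega>)) = (\<Sum>i=1..m. M.expectation (\<lambda>\<omega>. c i (y k i \<omega>)))"
      by (intro Bochner_Integration.integral_sum int_c)
    finally have "real m * e k - Lmax * n k \<le> (\<Sum>i=1..m. M.expectation (\<lambda>\<omega>. c i (y k i \<omega>)))" .
    moreover have "(\<Sum>i=1..m. c i z) = real m * C z" using mpos by (simp add: C')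
    ultimately have "real m * (e k - C z) - Lmax * n k - real m * D1
        \<le> (\<Sum>i=1..m. M.expectation (\<lambda>\<omega>. c i (y k i \<omega>)) - c i z
          - (2 * L i * \<delta> i + real CARD('d) * diameter X * U i / (\<delta> i * \<alpha> i * sqrt (real (s k i)))))"
      using err unfolding sum_subtractf by (simp only: right_diff_distrib)
    also have "\<dots> \<le> (\<Sum>i=1..m. M.expectation (\<lambda>\<omega>. ghat k i \<omega> \<bullet> (y k i \<omega> - z)))"
      using grad[OF _ z] by (intro sum_mono) (simp add: diff_diff_eq add.assoc)
    finally show ?thesis .
  qed

  have descent: "(\<Sum>i=1..m. (norm (x (Suc k) i \<omega> - z))\<^sup>2) \<le> (\<Sum>i=1..m. (norm (x k i \<omega> - z))\<^sup>2)
      - 2 * \<eta> k * (\<Sum>i=1..m. ghat k i \<omega> \<bullet> (y k i \<omega> - z)) + real m * (\<eta> k)\<^sup>2 * Gmax\<^sup>2"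
    if \<omega>: "\<omega> \<in> space M" for k \<omega>
  proof -
    have "(\<Sum>i=1..m. (norm (x (Suc k) i \<omega> - z))\<^sup>2) \<le> (\<Sum>i=1..m. (norm (y k i \<omega> - z))\<^sup>2
        - 2 * \<eta> k * (ghat k i \<omega> \<bullet> (y k i \<omega> - z)) + (\<eta> k)\<^sup>2 * Gmax\<^sup>2)"
    proof (rule sum_mono)
      fix i assume i: "i \<in> {1..m}"
      let ?g = "ghat k i \<omega>" and ?y = "y k i \<omega>"
      \<comment> \<open>The comparison point lies in the shrunken set and is its own projection, so
        nonexpansiveness removes the projection.\<close>
      have "norm (x (Suc k) i \<omega> - z) \<le> norm (?y - \<eta> k *\<^sub>R ?g - z)"
        using closest_point_lipschitz[OF X\<delta>_cc(3,2,4), of "?y - \<eta> k *\<^sub>R ?g" z]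
        by (simp add: x[OF i \<omega>] closest_point_self[OF z] dist_norm)
      then have "(norm (x (Suc k) i \<omega> - z))\<^sup>2 \<le> (norm (?y - \<eta> k *\<^sub>R ?g - z))\<^sup>2"
        by (intro power_mono) auto
      also have "\<dots> = (norm (?y - z))\<^sup>2 - 2 * \<eta> k * (?g \<bullet> (?y - z)) + (\<eta> k)\<^sup>2 * (norm ?g)\<^sup>2"
        unfolding power2_norm_eq_inner
        by (simp add: inner_diff_left inner_diff_right inner_commute algebra_simps power2_eq_square)
      also have "\<dots> \<le> (norm (?y - z))\<^sup>2 - 2 * \<eta> k * (?g \<bullet> (?y - z)) + (\<eta> k)\<^sup>2 * Gmax\<^sup>2"
        using ghat_norm[OF i \<omega>, of k] by (intro add_left_mono mult_left_mono power_mono) auto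
      finally show "(norm (x (Suc k) i \<omega> - z))\<^sup>2
        \<le> (norm (?y - z))\<^sup>2 - 2 * \<eta> k * (?g \<bullet> (?y - z)) + (\<eta> k)\<^sup>2 * Gmax\<^sup>2" .
    qed
    also have "\<dots> = (\<Sum>i=1..m. (norm ((\<Sum>j=1..m. W k i j *\<^sub>R x k j \<omega>) - z))\<^sup>2)
        - 2 * \<eta> k * (\<Sum>i=1..m. ghat k i \<omega> \<bullet> (y k i \<omega> - z)) + real m * (\<eta> k)\<^sup>2 * Gmax\<^sup>2"
      using y'[OF _ \<omega>] by (simp add: sum.distrib sum_subtractf sum_distrib_left)
    \<comment> \<open>Mixing does not increase the total squared distance to \<open>z\<close>, which
      closes the recursion in the x_i.\<close>
    also have "(\<Sum>i=1..m. (norm ((\<Sum>j=1..m. W k i j *\<^sub>R x k j \<omega>) - z))\<^sup>2) \<le> (\<Sum>i=1..m. (norm (x k i \<omega> - z))\<^sup>2)"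
      by (rule doubly_stochastic_sum_convex_le[OF W_stochastic m convex_on_norm_diff_power2])
    finally show ?thesis by simp
  qed
  have step: "a (Suc k) \<le> a k - 2 * \<eta> k * (real m * (e k - C z) - Lmax * n k - real m * D1)
      + real m * (\<eta> k)\<^sup>2 * Gmax\<^sup>2" for k
  proof -
    let ?g = "\<lambda>\<omega>. \<Sum>i=1..m. ghat k i \<omega> \<bullet> (y k i \<omega> - z)"
    let ?s = "\<lambda>\<omega>. \<Sum>i=1..m. (norm (x k i \<omega> - z))\<^sup>2"
    have ints: "integrable M (\<lambda>\<omega>. \<Sum>i=1..m. (norm (x t i \<omega> - z))\<^sup>2)" for t
      by (intro Bochner_Integration.integrable_sum int_sq)
    have ig: "integrable M ?g"
      by (intro Bochner_Integration.integrable_sum int_g)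
    have "a (Suc k) \<le> M.expectation (\<lambda>\<omega>. ?s \<omega> - 2 * \<eta> k * ?g \<omega> + real m * (\<eta> k)\<^sup>2 * Gmax\<^sup>2)"
      unfolding a_def by (rule integral_mono[OF ints _ descent])
        (intro ints Bochner_Integration.integrable_add Bochner_Integration.integrable_diff
          integrable_mult_right[OF ig] M.integrable_const)
    also have "\<dots> = M.expectation ?s - 2 * \<eta> k * M.expectation ?g + real m * (\<eta> k)\<^sup>2 * Gmax\<^sup>2"
      using ints[of k] ig by (simp add: M.prob_space del: sum.cl_ivl_Suc)
    also have "M.expectation ?g = (\<Sum>i=1..m. M.expectation (\<lambda>\<omega>. ghat k i \<omega> \<bullet> (y k i \<omega> - z)))"
      by (intro Bochner_Integration.integral_sum int_g)
    finally have "a (Suc k) \<le> a k - 2 * \<eta> k * (\<Sum>i=1..m. M.expectation (\<lambda>\<omega>. ghat k i \<omega> \<bullet> (y k i \<omega> - z)))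
        + real m * (\<eta> k)\<^sup>2 * Gmax\<^sup>2" by (simp add: a_def)
    moreover have "2 * \<eta> k * (real m * (e k - C z) - Lmax * n k - real m * D1)
        \<le> 2 * \<eta> k * (\<Sum>i=1..m. M.expectation (\<lambda>\<omega>. ghat k i \<omega> \<bullet> (y k i \<omega> - z)))"
      using gap[of k] \<eta>[of k] by (intro mult_left_mono) auto
    ultimately show ?thesis by linarith
  qed

  \<comment> \<open>Telescoping and the weighted average\<close>
  have a0: "a 0 \<le> real m * (diameter X)\<^sup>2"
  proof -
    have "a 0 \<le> M.expectation (\<lambda>\<omega>. \<Sum>i=1..m. (diameter X)\<^sup>2)"
      unfolding a_def
    proof (intro integral_mono Bochner_Integration.integrable_sum int_sq M.integrable_const sum_mono power_mono)
      show "norm (x 0 i \<omega> - z) \<le> diameter X" if "\<omega> \<in> space M" "i \<in> {1..m}" for \<omega> i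
        using x_in[OF that(2,1)] X\<delta>_sub zX by (intro diam) auto
    qed auto
    then show ?thesis by (simp add: M.prob_space)
  qed
  have aT: "0 \<le> a T"
    unfolding a_def by (intro Bochner_Integration.integral_nonneg sum_nonneg) auto
  have avg: "M.expectation (\<lambda>\<omega>. C (xhat T \<omega>)) \<le> (\<Sum>k<T. \<eta> k * e k) / H"
    and int_hat: "integrable M (\<lambda>\<omega>. C (xhat T \<omega>))"
  proof -
    have "xhat T \<in> borel_measurable M"
      unfolding xhat'[abs_def] by (intro borel_measurable_sum borel_measurable_scaleR borel_measurable_const xbar_M)
    then show int_hat: "integrable M (\<lambda>\<omega>. C (xhat T \<omega>))"
      by (rule M.integrable_continuous_compose[OF C_cont X(2) _ xhat_in])
    have "C (xhat T \<omega>) \<le> (\<Sum>k<T. \<eta> k / H * C (xbar k \<omega>))" if "\<omega> \<in> space M" for \<omega>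
      unfolding xhat' using xbar_in[OF that] X\<delta>_sub \<eta>H T
      by (intro convex_on_sum[OF _ _ C_conv]) (auto simp: lessThan_empty_iff)
    then have "M.expectation (\<lambda>\<omega>. C (xhat T \<omega>)) \<le> M.expectation (\<lambda>\<omega>. \<Sum>k<T. \<eta> k / H * C (xbar k \<omega>))"
      by (intro integral_mono int_hat Bochner_Integration.integrable_sum integrable_mult_right int_C)
    also have "\<dots> = (\<Sum>k<T. \<eta> k / H * e k)"
      unfolding e_def by (subst Bochner_Integration.integral_sum) (intro integrable_mult_right int_C, simp)
    also have "\<dots> = (\<Sum>k<T. \<eta> k * e k) / H"
      by (simp add: sum_divide_distrib)
    finally show "M.expectation (\<lambda>\<omega>. C (xhat T \<omega>)) \<le> (\<Sum>k<T. \<eta> k * e k) / H" .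
  qed
  have "(\<integral>\<omega>. C (xhat T \<omega>) - C xstar \<partial>M) = M.expectation (\<lambda>\<omega>. C (xhat T \<omega>)) - C xstar"
    using int_hat by (simp add: M.prob_space)
  \<comment> \<open>The value at \<open>z\<close> is inserted: descent controls the distance to it,
    and shrinking controls its distance to the optimum.\<close>
  also have "\<dots> \<le> ((\<Sum>k<T. \<eta> k * e k) / H - C z) + (C z - C xstar)"
    using avg by simp
  also have "\<dots> \<le> ((diameter X)\<^sup>2 / (2 * H) + Gmax\<^sup>2 * ((\<Sum>k<T. (\<eta> k)\<^sup>2) / (2 * H))
      + Lmax / real m * ((\<Sum>k<T. \<eta> k * n k) / H) + D1) + diameter X * \<delta>max * Lmax / r"
    using descent_telescope[of \<eta>, OF \<eta> T mpos a0 aT step] shrink unfolding H_def by (intro add_mono)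
  finally show ?thesis
    unfolding H_def n_def D2 by simp
qed

end
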